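(* Let $k\ge1$, let $f:\mathbb R\to\mathbb R$ be a (smooth) $k$-good function and let $F:B^1\to B^0$, $F(u)(t)=u'(t)+f(u(t))$. Let $\hat\gamma_k(x)=(f'(x),\dots,f^{(k)}(x))\in\mathbb R^k$ and $\hat S_k=\{v\in B^1:\int_{\mathbb S^1}\hat\gamma_k(v(t))\,dt=0\}$. Then $\hat S_k\neq\varnothing$ if and only if $0\in\mathbb R^k$ is in the interior of the convex hull of the image of $\hat\gamma_k$. Also, $\hat S_k\neq\varnothing$ implies $S_k\ne\varnothing$.
   Context: $\mathbb S^1=\mathbb R/\mathbb Z$. The pair $(B^1,B^0)$ is either $(H^1(\mathbb S^1;\mathbb R),L^2(\mathbb S^1;\mathbb R))$ or $(C^1(\mathbb S^1;\mathbb R),C^0(\mathbb S^1;\mathbb R))$; the result is asserted in both cases. $\tilde B^0$ is the space of average-zero functions in $B^0$. A smooth $f:\mathbb R\to\mathbb R$ is *$k$-good* if $\hat\gamma_k$ never vanishes and the image under $\hat\gamma_k$ of any nonempty open interval is not contained in a hyperplane through the origin of $\mathbb R^k$. For autonomous smooth $f$ the map $\Psi:B^1\to B^0$, $\Psi(u)=F(u)-\int F(u)+\int u$, is a diffeomorphism and $F\circ\Psi^{-1}(\tilde v,\overline u)=(\tilde v,\phi(\tilde v,\overline u))$ on $B^0=\tilde B^0\oplus\mathbb R$, with $\phi:\tilde B^0\times\mathbb R\to\mathbb R$ smooth. $S_k\subset B^1$ is the set of $u$ such that $D_2\phi=\dots=D_2^k\phi=0$ at $\Psi(u)$, where $D_2$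 is the derivative in the real variable $\overline u$. *)

theory Defs
  imports "HOL-Analysis.Analysis"
begin

section \<open>Function spaces on the circle\<close>

text \<open>
  A function on the circle \<open>\<real> / \<int>\<close> is a 1-periodic function on \<open>\<real>\<close>, and integration over the
  circle is integration over the fundamental domain \<open>[0, 1]\<close>. The total length is 1, so the
  integral of a function is also its average.
\<close>

definition periodic :: "(real \<Rightarrow> 'a) \<Rightarrow> bool" where
  "periodic u \<longleftrightarrow> (\<forall>t. u (t + 1) = u t)"

abbreviation circle_measure :: "real measure" where
  "circle_measure \<equiv> lebesgue_on {0..1}"

abbreviation circle_int :: "(real \<Rightarrow> 'a) \<Rightarrow> 'a::{banach, second_countable_topology}" where
  "circle_int u \<equiv> integral\<^sup>L circle_measure u"

definition C0 :: "(real \<Rightarrow> real) set" where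
  "C0 = {u. periodic u \<and> continuous_on UNIV u}"

definition C1 :: "(real \<Rightarrow> real) set" where
  "C1 = {u. periodic u \<and> (\<forall>t. u differentiable (at t)) \<and> continuous_on UNIV (deriv u)}"

text \<open>
  Elements of \<open>L\<^sup>2\<close> are represented by square-integrable functions, to be compared up to
  almost-everywhere equality (see \<open>B0_eq\<close> below).
\<close>

definition L2 :: "(real \<Rightarrow> real) set" where
  "L2 = {g. periodic g \<and> g \<in> borel_measurable circle_measure
            \<and> integrable circle_measure (\<lambda>t. (g t)\<^sup>2)}"

definition weak_deriv :: "(real \<Rightarrow> real) \<Rightarrow> (real \<Rightarrow> real) \<Rightarrow> bool" where
  "weak_deriv u g \<longleftrightarrow>
     (\<forall>\<eta>\<in>C1. circle_int (\<lambda>t. u t * deriv \<eta> t) = - circle_int (\<lambda>t. g t * \<eta> t))"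

text \<open>
  Every class in \<open>H\<^sup>1\<close> of the circle has exactly one continuous representative; that one stands
  for the class.
\<close>

definition H1 :: "(real \<Rightarrow> real) set" where
  "H1 = {u \<in> L2. continuous_on UNIV u \<and> (\<exists>g\<in>L2. weak_deriv u g)}"

datatype space_pair = Sobolev | Classical

fun B0 :: "space_pair \<Rightarrow> (real \<Rightarrow> real) set" where
  "B0 Sobolev = L2"
| "B0 Classical = C0"

fun B1 :: "space_pair \<Rightarrow> (real \<Rightarrow> real) set" where
  "B1 Sobolev = H1"
| "B1 Classical = C1"

fun B0_eq :: "space_pair \<Rightarrow> (real \<Rightarrow> real) \<Rightarrow> (real \<Rightarrow> real) \<Rightarrow> bool" where
  "B0_eq Sobolev v w \<longleftrightarrow> (AE t in circle_measure. v t = w t)"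
| "B0_eq Classical v w \<longleftrightarrow> v = w"

text \<open>The weak derivative is unique only up to a null set; any representative will do.\<close>

fun D :: "space_pair \<Rightarrow> (real \<Rightarrow> real) \<Rightarrow> real \<Rightarrow> real" where
  "D Sobolev u = (SOME g. g \<in> L2 \<and> weak_deriv u g)"
| "D Classical u = deriv u"


section \<open>The operator and its adapted coordinates\<close>

definition F :: "space_pair \<Rightarrow> (real \<Rightarrow> real) \<Rightarrow> (real \<Rightarrow> real) \<Rightarrow> real \<Rightarrow> real" where
  "F B f u = (\<lambda>t. D B u t + f (u t))"

definition Psi :: "space_pair \<Rightarrow> (real \<Rightarrow> real) \<Rightarrow> (real \<Rightarrow> real) \<Rightarrow> real \<Rightarrow> real" where
  "Psi B f u = (\<lambda>t. F B f u t - circle_int (F B f u) + circle_int u)"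

definition Psi_inv :: "space_pair \<Rightarrow> (real \<Rightarrow> real) \<Rightarrow> (real \<Rightarrow> real) \<Rightarrow> real \<Rightarrow> real" where
  "Psi_inv B f v = (THE u. u \<in> B1 B \<and> B0_eq B (Psi B f u) v)"

text \<open>
  \<open>v \<in> B\<^sup>0\<close> corresponds to the pair consisting of \<open>tilde v\<close>, of average zero, and the average
  \<open>circle_int v\<close>; conversely \<open>(w, x)\<close> corresponds to the function \<open>w + x\<close>. The component of
  \<open>F \<circ> \<Psi>\<^sup>-\<^sup>1\<close> in the space of average-zero functions is the identity, and \<open>phi\<close> is its real
  component.
\<close>

definition tilde :: "(real \<Rightarrow> real) \<Rightarrow> real \<Rightarrow> real" where
  "tilde v = (\<lambda>t. v t - circle_int v)"

definition phi :: "space_pair \<Rightarrow> (real \<Rightarrow> real) \<Rightarrow> (real \<Rightarrow> real) \<Rightarrow> real \<Rightarrow> real" where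
  "phi B f w x = circle_int (F B f (Psi_inv B f (\<lambda>t. w t + x)))"

definition S :: "space_pair \<Rightarrow> nat \<Rightarrow> (real \<Rightarrow> real) \<Rightarrow> (real \<Rightarrow> real) set" where
  "S B k f = {u \<in> B1 B. \<forall>j\<in>{1..k}.
     (deriv ^^ j) (phi B f (tilde (Psi B f u))) (circle_int (Psi B f u)) = 0}"


section \<open>The curve of derivatives\<close>

definition smooth :: "(real \<Rightarrow> real) \<Rightarrow> bool" where
  "smooth f \<longleftrightarrow> (\<forall>n x. (deriv ^^ n) f differentiable (at x))"

text \<open>
  The dimension is \<open>k = CARD('k)\<close>. In the linear order on \<open>'k\<close>, the element \<open>i\<close> is the
  \<open>card {..i}\<close>-th one, so the ranks run through \<open>1, \<dots>, k\<close> and the curve is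
  \<open>x \<mapsto> (f' x, \<dots>, (deriv ^^ k) f x)\<close>.
\<close>

definition gamma_hat :: "(real \<Rightarrow> real) \<Rightarrow> real \<Rightarrow> real ^ 'k::{finite, linorder}" where
  "gamma_hat f x = (\<chi> i. (deriv ^^ card {..i}) f x)"

definition good :: "'k::{finite, linorder} itself \<Rightarrow> (real \<Rightarrow> real) \<Rightarrow> bool" where
  "good _ f \<longleftrightarrow>
     (\<forall>x. (gamma_hat f x :: real ^ 'k::{finite, linorder}) \<noteq> 0) \<and>
     (\<forall>I. open I \<and> is_interval I \<and> I \<noteq> {} \<longrightarrow>
        \<not> (\<exists>a :: real ^ 'k::{finite, linorder}. a \<noteq> 0 \<and> gamma_hat f ` I \<subseteq> {y. a \<bullet> y = 0}))"

definition S_hat ::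
  "'k::{finite, linorder} itself \<Rightarrow> space_pair \<Rightarrow> (real \<Rightarrow> real) \<Rightarrow> (real \<Rightarrow> real) set" where
  "S_hat _ B f = {v \<in> B1 B. circle_int (\<lambda>t. gamma_hat f (v t) :: real ^ 'k::{finite, linorder}) = 0}"

end

theory Submission
  imports Defs
begin

text \<open>
  Write \<open>\<gamma>\<close> for \<open>gamma_hat f\<close>. If 0 is not interior to the convex hull of the image of \<open>\<gamma>\<close>, then
  \<open>a \<bullet> \<gamma> \<ge> 0\<close> for some \<open>a \<noteq> 0\<close>; a vanishing integral of \<open>\<gamma> \<circ> v\<close> forces \<open>a \<bullet> \<gamma> = 0\<close> on the range
  of \<open>v\<close>, which contradicts goodness. Conversely, reparametrizing the circle turns the integral of
  \<open>\<gamma> \<circ> v\<close> into that of \<open>\<rho> * \<gamma> \<circ> v\<close> with an arbitrary positive density \<open>\<rho>\<close>. For a wave \<open>v\<close> of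
  large amplitude these integrals form a convex set with 0 in its interior, which gives a family
  \<open>v\<^sub>p\<close>, continuous in \<open>p\<close> near 0, such that \<open>\<gamma> \<circ> v\<^sub>p\<close> has integral \<open>p\<close>.

  The fibres of \<open>F\<close> modulo constants are the curves \<open>x \<mapsto> u\<^sub>x\<close> with
  \<open>\<partial>\<^sub>x u\<^sub>x = W (f' \<circ> u\<^sub>x)\<close>, where \<open>w = W h\<close> is the periodic solution with average 1 of
  \<open>w' + h w = d\<close>, \<open>d\<close> a constant. This differential equation in \<open>x\<close> is solved by Picard
  iteration, and its solution is smooth in \<open>x\<close> since \<open>W\<close> is given by an explicit formula. Along
  the curve \<open>\<phi>' = d\<close>, which vanishes to the same order as the integral of \<open>f' \<circ> u\<^sub>x\<close>.
  Now replace \<open>f\<close> by \<open>\<epsilon> f\<close> with \<open>\<epsilon> = 1 / N\<close> and start from \<open>v\<^sub>p\<close>; substituting \<open>N t\<close> for \<open>t\<close>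
  returns to \<open>f\<close> itself. As \<open>\<epsilon>\<close> tends to 0, \<open>u\<^sub>x\<close> tends to \<open>v\<^sub>p + x\<close>, so the map from \<open>p\<close> to the
  \<open>(k - 1)\<close>-jet of the integral of \<open>f' \<circ> u\<^sub>x\<close> tends uniformly to the identity, and by Brouwer's
  theorem it has a zero for small \<open>\<epsilon>\<close>.
\<close>

section \<open>Parametric smoothness\<close>

text \<open>\<open>\<phi>'\<close> itself cannot carry the perturbation argument: it is proportional
  to \<open>exp (\<epsilon> I) - 1\<close>, with \<open>I\<close> the integral of \<open>f'\<close>
  along \<open>u_x\<close>, so it is identically zero at \<epsilon> = 0, whereas the jet of
  \<open>I\<close> has a nondegenerate limit. The factor \<epsilon> is treated as a parameter in a
  compact set containing 0, on the same footing as \<open>p\<close>; this yields one \<delta> and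
  one modulus of continuity for all parameters. Brouwer's theorem asks for continuity only, so the
  parameters are never differentiated. The restriction \<epsilon> = 1 / N is there because
  \<open>t \<mapsto> N t\<close> has to map the circle to itself. \<open>phi\<close> is defined
  through a description operator, so its values are accessible only where a preimage under
  \<open>Psi\<close> is exhibited and shown to be unique. One curve through the desired point is
  enough, since \<open>S\<close> involves derivatives in the real variable alone. All functions
  constructed are C1, so that one construction serves both pairs of spaces; the pair matters for
  uniqueness, where the derivative of a competitor in H1 is known merely almost everywhere.\<close>

lemma smooth_DERIV: "smooth f \<Longrightarrow> ((deriv ^^ n) f has_real_derivative (deriv ^^ Suc n) f x) (at x)"
  by (simp add: smooth_def DERIV_deriv_iff_real_differentiable)

lemma smooth_deriv: "smooth f \<Longrightarrow> smooth (deriv f)"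
  unfolding smooth_def by (metis funpow_Suc_right o_apply)

lemma smooth_continuous_on: "smooth f \<Longrightarrow> continuous_on A ((deriv ^^ n) f)"
  by (meson DERIV_continuous_on smooth_DERIV has_field_derivative_at_within)

lemma smooth_compose_continuous_on:
  "smooth f \<Longrightarrow> continuous_on A g \<Longrightarrow> continuous_on A (\<lambda>x. (deriv ^^ n) f (g x))"
  by (rule continuous_on_compose2[OF smooth_continuous_on[of f UNIV]]) auto

lemma smooth_exp: "smooth exp"
proof -
  have "deriv exp = (exp :: real \<Rightarrow> real)"
    by (intro ext DERIV_imp_deriv) (auto intro!: derivative_eq_intros)
  then have "(deriv ^^ n) exp = (exp :: real \<Rightarrow> real)" for n
    by (induction n) auto
  then show ?thesis
    unfolding smooth_def using DERIV_exp real_differentiable_def by metis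
qed

lemma deriv_funpow_cong_open:
  fixes f g :: "real \<Rightarrow> real"
  assumes "open J" "\<And>x. x \<in> J \<Longrightarrow> f x = g x" "x \<in> J"
  shows "(deriv ^^ n) f x = (deriv ^^ n) g x"
  using assms(3)
proof (induction n arbitrary: x)
  case 0
  then show ?case using assms by simp
next
  case (Suc n)
  have "eventually (\<lambda>y. (deriv ^^ n) f y = (deriv ^^ n) g y) (nhds x)"
    using Suc assms(1) eventually_nhds by blast
  then show ?case by (simp add: deriv_cong_ev)
qed

lemma deriv_funpow_shift:
  fixes f :: "real \<Rightarrow> real"
  shows "(deriv ^^ n) (\<lambda>x. f (x + a)) = (\<lambda>x. (deriv ^^ n) f (x + a))"
proof (induction n)
  case (Suc n)
  have "deriv (\<lambda>x. g (x + a)) = (\<lambda>x. deriv g (x + a))" for g :: "real \<Rightarrow> real"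
    by (simp add: deriv_def DERIV_shift fun_eq_iff)
  then show ?case using Suc by simp
qed auto

text \<open>Class C^m in \<open>x\<close> on \<open>J\<close>, with all derivatives jointly
  continuous in the parameter and \<open>x\<close>. The parameter lives in any topological space and
  is never differentiated. Derivatives are existential witnesses rather than iterated
  \<open>deriv\<close>, so that each closure property is one induction on \<open>m\<close>.\<close>

primrec Ck :: "nat \<Rightarrow> real set \<Rightarrow> 'z::topological_space set \<Rightarrow> ('z \<Rightarrow> real \<Rightarrow> real) \<Rightarrow> bool" where
  "Ck 0 J Z g \<longleftrightarrow> continuous_on (Z \<times> J) (\<lambda>(z, x). g z x)"
| "Ck (Suc m) J Z g \<longleftrightarrow> continuous_on (Z \<times> J) (\<lambda>(z, x). g z x) \<and>
     (\<exists>g'. (\<forall>z\<in>Z. \<forall>x\<in>J. (g z has_real_derivative g' z x) (at x)) \<and> Ck m J Z g')"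

lemma Ck_imp_continuous_on: "Ck m J Z g \<Longrightarrow> continuous_on (Z \<times> J) (\<lambda>(z, x). g z x)"
  by (cases m) auto

lemma continuous_on_joint_compose:
  assumes "continuous_on (A \<times> B) (\<lambda>(z, x). g z x)" "continuous_on T a" "continuous_on T b"
    "\<And>p. p \<in> T \<Longrightarrow> a p \<in> A" "\<And>p. p \<in> T \<Longrightarrow> b p \<in> B"
  shows "continuous_on T (\<lambda>p. g (a p) (b p))"
  using continuous_on_compose2[OF assms(1) continuous_on_Pair[OF assms(2,3)]] assms(4,5) by auto

lemma Ck_SucD: "Ck (Suc m) J Z g \<Longrightarrow> Ck m J Z g"
proof (induction m arbitrary: g)
  case (Suc m)
  then obtain g' where
    "\<forall>z\<in>Z. \<forall>x\<in>J. (g z has_real_derivative g' z x) (at x)" "Ck (Suc m) J Z g'"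
    by auto
  then show ?case
    using Suc.IH[of g'] Suc.prems Ck.simps(2)[of m J Z g] Ck_imp_continuous_on[OF Suc.prems] by blast
qed auto

lemma Ck_cong:
  assumes "open J" "\<And>z x. z \<in> Z \<Longrightarrow> x \<in> J \<Longrightarrow> g z x = h z x" "Ck m J Z g"
  shows "Ck m J Z h"
proof -
  have c: "continuous_on (Z \<times> J) (\<lambda>(z, x). g z x) \<longleftrightarrow> continuous_on (Z \<times> J) (\<lambda>(z, x). h z x)"
    using assms(2) by (intro continuous_on_cong) auto
  show ?thesis
  proof (cases m)
    case 0
    then show ?thesis using c assms(3) by simp
  next
    case (Suc n)
    then obtain g' where g': "\<forall>z\<in>Z. \<forall>x\<in>J. (g z has_real_derivative g' z x) (at x)" "Ck n J Z g'"
      using assms(3) by auto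
    have "(h z has_real_derivative g' z x) (at x)" if "z \<in> Z" "x \<in> J" for z x
      by (rule has_field_derivative_transform_within_open[of "g z" _ _ J]) (use that g'(1) assms(1,2) in auto)
    then show ?thesis
      using Suc c g'(2) assms(3) by auto
  qed
qed

lemma Ck_const: "continuous_on Z c \<Longrightarrow> Ck m J Z (\<lambda>z x. c z)"
proof (induction m arbitrary: c)
  case 0
  then show ?case
    by (auto simp: split_beta intro!: continuous_intros elim: continuous_on_compose2)
next
  case (Suc m)
  have "Ck m J Z (\<lambda>z x. 0)" using Suc.IH[of "\<lambda>z. 0"] by simp
  moreover have "continuous_on (Z \<times> J) (\<lambda>(z, x). c z)"
    using Suc.prems by (auto simp: split_beta intro!: continuous_intros elim: continuous_on_compose2)
  ultimately show ?case by (auto intro!: exI[of _ "\<lambda>z x. 0"])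
qed

lemma Ck_add: "Ck m J Z g \<Longrightarrow> Ck m J Z h \<Longrightarrow> Ck m J Z (\<lambda>z x. g z x + h z x)"
proof (induction m arbitrary: g h)
  case 0
  then show ?case by (auto simp: split_beta intro!: continuous_intros)
next
  case (Suc m)
  from Suc.prems obtain g' h' where
    "\<forall>z\<in>Z. \<forall>x\<in>J. (g z has_real_derivative g' z x) (at x)" "Ck m J Z g'"
    "\<forall>z\<in>Z. \<forall>x\<in>J. (h z has_real_derivative h' z x) (at x)" "Ck m J Z h'"
    by auto
  then show ?case
    using Suc.IH[of g' h'] Suc.prems
    by (auto simp: split_beta intro!: continuous_intros derivative_intros
        exI[of _ "\<lambda>z x. g' z x + h' z x"])
qed

lemma Ck_mult: "Ck m J Z g \<Longrightarrow> Ck m J Z h \<Longrightarrow> Ck m J Z (\<lambda>z x. g z x * h z x)"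
proof (induction m arbitrary: g h)
  case 0
  then show ?case by (auto simp: split_beta intro!: continuous_intros)
next
  case (Suc m)
  from Suc.prems obtain g' h' where
    *: "\<forall>z\<in>Z. \<forall>x\<in>J. (g z has_real_derivative g' z x) (at x)" "Ck m J Z g'"
    "\<forall>z\<in>Z. \<forall>x\<in>J. (h z has_real_derivative h' z x) (at x)" "Ck m J Z h'"
    by auto
  have "Ck m J Z (\<lambda>z x. g' z x * h z x + h' z x * g z x)"
    using * Suc.IH Suc.prems[THEN Ck_SucD] by (intro Ck_add) auto
  then show ?case
    using * Suc.prems
    by (auto simp: split_beta intro!: continuous_intros DERIV_mult
        exI[of _ "\<lambda>z x. g' z x * h z x + h' z x * g z x"])
qed

lemma Ck_compose: "smooth f \<Longrightarrow> Ck m J Z g \<Longrightarrow> Ck m J Z (\<lambda>z x. f (g z x))"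
proof (induction m arbitrary: f g)
  case 0
  then show ?case
    using smooth_compose_continuous_on[of f "Z \<times> J" "\<lambda>(z, x). g z x" 0]
    by (simp add: split_beta)
next
  case (Suc m)
  from Suc.prems obtain g' where
    *: "\<forall>z\<in>Z. \<forall>x\<in>J. (g z has_real_derivative g' z x) (at x)" "Ck m J Z g'"
    by auto
  have "Ck m J Z (\<lambda>z x. deriv f (g z x) * g' z x)"
    using Suc.IH[OF smooth_deriv] Suc.prems Ck_SucD by (intro Ck_mult *) blast
  moreover have "((\<lambda>x. f (g z x)) has_real_derivative deriv f (g z x) * g' z x) (at x)"
    if "z \<in> Z" "x \<in> J" for z x
    using DERIV_chain2[of f "deriv f (g z x)" "g z" x "g' z x" UNIV] smooth_DERIV[of f 0 "g z x"]
      Suc.prems(1) * that by auto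
  ultimately show ?case
    using smooth_compose_continuous_on[of f "Z \<times> J" "\<lambda>(z, x). g z x" 0] Suc.prems
    by (auto simp: split_beta intro!: exI[of _ "\<lambda>z x. deriv f (g z x) * g' z x"])
qed

lemma Ck_inverse:
  "(\<And>z x. z \<in> Z \<Longrightarrow> x \<in> J \<Longrightarrow> g z x \<noteq> 0) \<Longrightarrow> Ck m J Z g \<Longrightarrow> Ck m J Z (\<lambda>z x. inverse (g z x))"
proof (induction m)
  case 0
  then show ?case by (auto simp: split_beta intro!: continuous_intros)
next
  case (Suc m)
  from Suc.prems obtain g' where
    *: "\<forall>z\<in>Z. \<forall>x\<in>J. (g z has_real_derivative g' z x) (at x)" "Ck m J Z g'"
    by auto
  have "Ck m J Z (\<lambda>z x. inverse (g z x))"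
    using Suc.IH Suc.prems Ck_SucD by blast
  then have "Ck m J Z (\<lambda>z x. - 1 * (inverse (g z x) * g' z x * inverse (g z x)))"
    by (intro Ck_mult * Ck_const continuous_intros)
  then have "Ck m J Z (\<lambda>z x. - (inverse (g z x) * g' z x * inverse (g z x)))"
    by simp
  then show ?case
    using Suc.prems *
    by (auto simp: split_beta intro!: continuous_intros DERIV_inverse'
        exI[of _ "\<lambda>z x. - (inverse (g z x) * g' z x * inverse (g z x))"])
qed

lemma continuous_on_subst_fst:
  assumes "continuous_on (Y \<times> J) (\<lambda>(z, x). g z x)" "continuous_on Z s" "s ` Z \<subseteq> Y"
  shows "continuous_on (Z \<times> J) (\<lambda>(z, x). g (s z) x)"
  unfolding split_beta using assms(3)
  by (intro continuous_on_joint_compose[OF assms(1)] continuous_on_compose2[OF assms(2)])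
    (auto intro!: continuous_intros)

text \<open>Parameters enter only through continuity, so every continuous substitution is harmless.
  In this way a value at the moved point \<open>t + s * r\<close> becomes a family with the further
  parameters \<open>s\<close> and \<open>r\<close>.\<close>

lemma Ck_subst:
  "continuous_on Z s \<Longrightarrow> s ` Z \<subseteq> Y \<Longrightarrow> Ck m J Y g \<Longrightarrow> Ck m J Z (\<lambda>z x. g (s z) x)"
proof (induction m arbitrary: g)
  case 0
  then show ?case using continuous_on_subst_fst by auto
next
  case (Suc m)
  from Suc.prems obtain g' where
    *: "\<forall>z\<in>Y. \<forall>x\<in>J. (g z has_real_derivative g' z x) (at x)" "Ck m J Y g'"
    by auto
  have "continuous_on (Z \<times> J) (\<lambda>(z, x). g (s z) x)"
    using Suc.prems continuous_on_subst_fst by auto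
  then show ?case
    using * Suc by (auto intro!: exI[of _ "\<lambda>z x. g' (s z) x"])
qed

lemma parametric_integral_has_derivative:
  fixes g g' :: "real \<Rightarrow> real \<Rightarrow> real"
  assumes J: "open J" "convex J" "x \<in> J"
    and D: "\<And>x r. x \<in> J \<Longrightarrow> r \<in> {0..1} \<Longrightarrow> ((\<lambda>x. g x r) has_real_derivative g' x r) (at x)"
    and c: "\<And>x. x \<in> J \<Longrightarrow> continuous_on {0..1} (g x)"
    and c': "continuous_on (J \<times> {0..1}) (\<lambda>(x, r). g' x r)"
  shows "((\<lambda>x. integral {0..1} (g x)) has_real_derivative integral {0..1} (g' x)) (at x)"
proof -
  have "((\<lambda>x. integral (cbox 0 1) (g x)) has_real_derivative integral (cbox 0 1) (g' x)) (at x within J)"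
  proof (rule leibniz_rule_field_derivative)
    show "((\<lambda>x. g x r) has_real_derivative g' x r) (at x within J)" if "x \<in> J" "r \<in> cbox 0 1" for x r
      using D[of x r] that by (simp add: has_field_derivative_at_within)
    show "g x integrable_on cbox 0 1" if "x \<in> J" for x
      using integrable_continuous_real[OF c[OF that]] by simp
    show "continuous_on (J \<times> cbox 0 1) (\<lambda>(x, r). g' x r)" using c' by simp
  qed (rule J)+
  then show ?thesis using at_within_open[OF J(3,1)] by simp
qed

text \<open>The variable of integration is one more parameter, over a compact interval; Leibniz'
  rule moves each \<open>x\<close>-derivative under the integral.\<close>

lemma Ck_integral:
  assumes "open J" "convex J"
  shows "Ck m J (Z \<times> {0..1}) g \<Longrightarrow> Ck m J Z (\<lambda>z x. integral {0..1} (\<lambda>r::real. g (z, r) x))"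
proof (induction m arbitrary: g)
  case 0
  then have "continuous_on ((Z \<times> J) \<times> {0..1}) (\<lambda>p. g (fst (fst p), snd p) (snd (fst p)))"
    by (intro continuous_on_joint_compose[of "Z \<times> {0..1}" J g]) (auto intro!: continuous_intros)
  then show ?case
    using integral_continuous_on_param[of "Z \<times> J" 0 1 "\<lambda>p r. g (fst p, r) (snd p)"]
    by (simp add: split_beta)
next
  case (Suc m)
  from Suc.prems obtain g' where
    *: "\<forall>z\<in>Z \<times> {0..1}. \<forall>x\<in>J. (g z has_real_derivative g' z x) (at x)" "Ck m J (Z \<times> {0..1}) g'"
    by auto
  have "((\<lambda>x. integral {0..1} (\<lambda>r. g (z, r) x)) has_real_derivative
      integral {0..1} (\<lambda>r. g' (z, r) x)) (at x)" if zx: "z \<in> Z" "x \<in> J" for z x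
  proof (rule parametric_integral_has_derivative[OF assms zx(2)])
    show "((\<lambda>x. g (z, r) x) has_real_derivative g' (z, r) x) (at x)" if "x \<in> J" "r \<in> {0..1}" for x r
      using *(1) zx(1) that by simp
    show "continuous_on {0..1} (\<lambda>r. g (z, r) x)" if "x \<in> J" for x
      by (rule continuous_on_joint_compose[OF Ck_imp_continuous_on[OF Suc.prems]])
        (use zx(1) that in \<open>auto intro!: continuous_intros\<close>)
    show "continuous_on (J \<times> {0..1}) (\<lambda>(x, r). g' (z, r) x)"
      unfolding split_beta
      by (rule continuous_on_joint_compose[OF Ck_imp_continuous_on[OF *(2)]])
        (use zx(1) in \<open>auto intro!: continuous_intros\<close>)
  qed
  moreover have "continuous_on (Z \<times> J) (\<lambda>(z, x). integral {0..1} (\<lambda>r. g (z, r) x))"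
    using Suc.IH[OF Ck_SucD[OF Suc.prems]] Ck_imp_continuous_on by blast
  ultimately show ?case
    using Suc.IH[OF *(2)] by (auto intro!: exI[of _ "\<lambda>z x. integral {0..1} (\<lambda>r. g' (z, r) x)"])
qed

text \<open>On an open set the witnesses in \<open>Ck\<close> agree with \<open>deriv\<close>, so
  joint continuity passes to the iterated derivatives in which the jets are expressed.\<close>

lemma Ck_deriv_funpow:
  assumes "open J"
  shows "Ck (n + m) J Z g \<Longrightarrow> Ck m J Z (\<lambda>z. (deriv ^^ n) (g z))"
proof (induction n arbitrary: g)
  case (Suc n)
  then obtain g' where
    *: "\<forall>z\<in>Z. \<forall>x\<in>J. (g z has_real_derivative g' z x) (at x)" "Ck (n + m) J Z g'"
    by auto
  have "Ck (n + m) J Z (\<lambda>z. deriv (g z))"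
    by (rule Ck_cong[OF assms _ *(2)]) (use * DERIV_imp_deriv in force)
  from Suc.IH[OF this] show ?case
    by (simp add: funpow_Suc_right del: funpow.simps)
qed auto

text \<open>Vanishing to order \<open>m\<close> at \<open>a\<close>: the derivatives of orders below
  \<open>m\<close> are zero there. Differentiability is asked on all of \<open>J\<close>, since the
  product rule is applied to functions and not just at \<open>a\<close>.\<close>

primrec vanishes :: "nat \<Rightarrow> real set \<Rightarrow> real \<Rightarrow> (real \<Rightarrow> real) \<Rightarrow> bool" where
  "vanishes 0 J a g \<longleftrightarrow> True"
| "vanishes (Suc m) J a g \<longleftrightarrow> g a = 0 \<and>
     (\<exists>g'. (\<forall>x\<in>J. (g has_real_derivative g' x) (at x)) \<and> vanishes m J a g')"

lemma vanishes_SucD: "vanishes (Suc m) J a g \<Longrightarrow> vanishes m J a g"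
proof (induction m arbitrary: g)
  case (Suc m)
  then obtain g' where
    "\<forall>x\<in>J. (g has_real_derivative g' x) (at x)" "vanishes (Suc m) J a g'"
    by auto
  then show ?case
    using Suc.IH[of g'] Suc.prems vanishes.simps(2)[of m J a g] vanishes.simps(2)[of "Suc m" J a g]
    by blast
qed auto

lemma vanishes_add: "vanishes m J a g \<Longrightarrow> vanishes m J a h \<Longrightarrow> vanishes m J a (\<lambda>x. g x + h x)"
proof (induction m arbitrary: g h)
  case (Suc m)
  from Suc.prems obtain g' h' where
    "\<forall>x\<in>J. (g has_real_derivative g' x) (at x)" "vanishes m J a g'"
    "\<forall>x\<in>J. (h has_real_derivative h' x) (at x)" "vanishes m J a h'"
    by auto
  then show ?case
    using Suc.IH[of g' h'] Suc.prems
    by (auto intro!: derivative_intros exI[of _ "\<lambda>x. g' x + h' x"])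
qed auto

text \<open>In \<open>g' h + g h'\<close> the first summand vanishes to order \<open>m\<close> by
  induction, and so does the second, because \<open>g\<close> vanishes to even higher order.\<close>

lemma vanishes_mult:
  "vanishes m J a g \<Longrightarrow> z \<in> Z \<Longrightarrow> Ck m J Z h \<Longrightarrow> vanishes m J a (\<lambda>x. g x * h z x)"
proof (induction m arbitrary: g h)
  case (Suc m)
  from Suc.prems obtain g' h' where
    *: "\<forall>x\<in>J. (g has_real_derivative g' x) (at x)" "vanishes m J a g'"
    "\<forall>x\<in>J. (h z has_real_derivative h' z x) (at x)" "Ck m J Z h'"
    by auto
  have "vanishes m J a (\<lambda>x. g' x * h z x + g x * h' z x)"
    using Suc.IH[OF *(2) Suc.prems(2) Ck_SucD[OF Suc.prems(3)]]
      Suc.IH[OF vanishes_SucD[OF Suc.prems(1)] Suc.prems(2) *(4)] by (rule vanishes_add)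
  then show ?case
    using * Suc.prems
    by (auto intro!: exI[of _ "\<lambda>x. g' x * h z x + g x * h' z x"] derivative_eq_intros)
qed auto

text \<open>The value at \<open>a\<close> is \<open>exp 0 - 1\<close>, and the derivative is
  \<open>g'\<close> times the smooth factor \<open>exp g\<close>, where \<open>g'\<close> vanishes
  to one order less than \<open>g\<close>.\<close>

lemma vanishes_exp_minus_1:
  assumes "vanishes m J a (g z)" "z \<in> Z" "Ck m J Z g"
  shows "vanishes m J a (\<lambda>x. exp (g z x) - 1)"
proof (cases m)
  case (Suc n)
  then obtain g' where
    *: "\<forall>x\<in>J. (g z has_real_derivative g' x) (at x)" "vanishes n J a g'"
    using assms by auto
  have "Ck n J Z (\<lambda>z x. exp (g z x))"
    using Ck_compose[OF smooth_exp] assms(3) Suc Ck_SucD by blast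
  from vanishes_mult[OF *(2) assms(2) this] show ?thesis
    using * assms Suc
    by (auto intro!: exI[of _ "\<lambda>x. g' x * exp (g z x)"] derivative_eq_intros)
qed auto

lemma vanishes_imp_deriv:
  assumes "open J" "a \<in> J"
  shows "vanishes m J a g \<Longrightarrow> n < m \<Longrightarrow> (deriv ^^ n) g a = 0"
proof (induction n arbitrary: m g)
  case 0
  then show ?case by (cases m) auto
next
  case (Suc n)
  then obtain m' where m: "m = Suc m'" "n < m'" by (cases m) auto
  then obtain g' where
    *: "\<forall>x\<in>J. (g has_real_derivative g' x) (at x)" "vanishes m' J a g'"
    using Suc by auto
  have "(deriv ^^ n) (deriv g) a = (deriv ^^ n) g' a"
    by (rule deriv_funpow_cong_open[OF assms(1) _ assms(2)]) (use * DERIV_imp_deriv in blast)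
  then show ?case
    using Suc.IH[OF *(2) m(2)] by (simp add: funpow_Suc_right del: funpow.simps)
qed

text \<open>Since \<open>deriv\<close> is total, zero values of iterated derivatives say nothing
  about differentiability; \<open>Ck\<close> supplies it.\<close>

lemma Ck_imp_vanishes:
  assumes "open J" "a \<in> J" "z \<in> Z"
  shows "Ck m J Z g \<Longrightarrow> (\<And>n. n < m \<Longrightarrow> (deriv ^^ n) (g z) a = 0) \<Longrightarrow> vanishes m J a (g z)"
proof (induction m arbitrary: g)
  case (Suc m)
  then obtain g' where
    *: "\<forall>z\<in>Z. \<forall>x\<in>J. (g z has_real_derivative g' z x) (at x)" "Ck m J Z g'"
    by auto
  have "(deriv ^^ n) (g' z) a = 0" if "n < m" for n
  proof -
    have "(deriv ^^ n) (deriv (g z)) a = (deriv ^^ n) (g' z) a"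
      by (rule deriv_funpow_cong_open[OF assms(1) _ assms(2)]) (use * assms DERIV_imp_deriv in blast)
    then show ?thesis
      using Suc.prems(2)[of "Suc n"] that by (simp add: funpow_Suc_right del: funpow.simps)
  qed
  then show ?case
    using Suc.IH[OF *(2)] Suc.prems(2)[of 0] * assms by auto
qed auto

section \<open>The periodic linear equation\<close>

lemma periodic_add_nat:
  fixes g :: "real \<Rightarrow> 'a"
  assumes "\<And>t. g (t + 1) = g t"
  shows "g (t + real n) = g t"
proof (induction n)
  case (Suc n)
  have "g (t + real (Suc n)) = g (t + real n + 1)" by (simp add: add_ac)
  then show ?case using Suc assms[of "t + real n"] by simp
qed simp

lemma periodic_frac:
  fixes g :: "real \<Rightarrow> 'a"
  assumes "\<And>t. g (t + 1) = g t"
  shows "g (frac t) = g t"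
proof -
  note n = periodic_add_nat[of g, OF assms]
  have "g (x + of_int k) = g x" for x k
  proof (cases "0 \<le> k")
    case True
    then show ?thesis using n[of x "nat k"] by simp
  next
    case False
    then have "x + of_int k + of_nat (nat (- k)) = x" by simp
    from n[of "x + of_int k" "nat (- k)", unfolded this] show ?thesis by (rule sym)
  qed
  moreover have "frac t + of_int \<lfloor>t\<rfloor> = t" by (simp add: frac_def)
  ultimately show ?thesis by metis
qed

lemma frac_unit: "frac t \<in> {0..1::real}"
  by (simp add: frac_ge_0 frac_lt_1 less_imp_le)

lemma periodic_continuous_bounded:
  fixes g :: "real \<Rightarrow> real"
  assumes "continuous_on UNIV g" "\<And>t. g (t + 1) = g t"
  shows "\<exists>M. \<forall>t. \<bar>g t\<bar> \<le> M"
proof -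
  have "compact (g ` {0..1})"
    using assms(1) continuous_on_subset by (intro compact_continuous_image) blast+
  then obtain M where "\<And>t. t \<in> {0..1} \<Longrightarrow> \<bar>g t\<bar> \<le> M"
    using compact_imp_bounded bounded_real by (metis imageI)
  then have "\<bar>g (frac t)\<bar> \<le> M" for t
    using frac_unit by blast
  then show ?thesis using periodic_frac[of g, OF assms(2)] by auto
qed

section \<open>Antiderivatives and periods\<close>

lemma continuous_has_antiderivative:
  fixes g :: "real \<Rightarrow> real"
  assumes "continuous_on UNIV g"
  shows "\<exists>G. \<forall>x. (G has_real_derivative g x) (at x)"
proof -
  have "\<exists>G. \<forall>x::real. -\<infinity> < ereal x \<longrightarrow> ereal x < \<infinity> \<longrightarrow> (G has_vector_derivative g x) (at x)"
    using assms by (intro einterval_antiderivative) (auto simp: continuous_on_eq_continuous_at)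
  then show ?thesis
    by (auto simp: has_real_derivative_iff_has_vector_derivative)
qed

text \<open>The fundamental theorem pulled back to \<open>[0, 1]\<close> along
  \<open>r \<mapsto> t + s * r\<close>. The number \<open>s\<close> may be negative or zero, so
  orientations of segments need no case distinction.\<close>

lemma integral_segment:
  fixes g G :: "real \<Rightarrow> real"
  assumes "\<And>r. r \<in> {0..1} \<Longrightarrow> (G has_real_derivative g (t + s * r)) (at (t + s * r))"
  shows "s * integral {0..1} (\<lambda>r. g (t + s * r)) = G (t + s) - G t"
proof -
  have "((\<lambda>r. s * g (t + s * r)) has_integral (G (t + s * 1) - G (t + s * 0))) {0..1}"
  proof (rule fundamental_theorem_of_calculus)
    fix r :: real assume "r \<in> {0..1}"
    then have "((\<lambda>r. G (t + s * r)) has_real_derivative g (t + s * r) * s) (at r within {0..1})"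
      by (intro DERIV_chain2[of G] assms) (auto intro!: derivative_eq_intros)
    then show "((\<lambda>r. G (t + s * r)) has_vector_derivative s * g (t + s * r)) (at r within {0..1})"
      by (simp add: has_real_derivative_iff_has_vector_derivative mult.commute)
  qed simp
  then show ?thesis by (simp add: integral_unique flip: integral_mult_right)
qed

lemma antiderivative_shift:
  fixes g G :: "real \<Rightarrow> real"
  assumes G: "\<And>x. (G has_real_derivative g x) (at x)" and per: "\<And>t. g (t + 1) = g t"
  shows "G (t + 1) = G t + integral {0..1} g"
proof -
  have GD: "((\<lambda>x. G (x + 1)) has_real_derivative g x) (at x)" for x
    using G[of "x + 1"] per by (simp add: DERIV_shift)
  have "((\<lambda>x. G (x + 1) - G x) has_real_derivative 0) (at x)" for x
    using DERIV_diff[OF GD G, of x] by simp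
  then have "G (t + 1) - G t = G (0 + 1) - G 0"
    using DERIV_isconst_all[of "\<lambda>x. G (x + 1) - G x" t 0] by blast
  moreover have "integral {0..1} g = G (0 + 1) - G 0"
    using integral_segment[where g = g and G = G and t = 0 and s = 1] G by simp
  ultimately show ?thesis by linarith
qed

lemma integral_unit_bounds:
  fixes k :: "real \<Rightarrow> real"
  assumes "continuous_on {0..1} k" "\<And>s. s \<in> {0..1} \<Longrightarrow> c \<le> k s" "\<And>s. s \<in> {0..1} \<Longrightarrow> k s \<le> d"
  shows "c \<le> integral {0..1} k" "integral {0..1} k \<le> d"
  using integral_le[OF integrable_const_ivl integrable_continuous_real[OF assms(1)], of c]
    integral_le[OF integrable_continuous_real[OF assms(1)] integrable_const_ivl, of d] assms
  by auto

lemma integral_unit_diff_le: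
  fixes k l :: "real \<Rightarrow> real"
  assumes "continuous_on {0..1} k" "continuous_on {0..1} l" "\<And>s. s \<in> {0..1} \<Longrightarrow> \<bar>k s - l s\<bar> \<le> c"
  shows "\<bar>integral {0..1} k - integral {0..1} l\<bar> \<le> c"
  using integral_bound[of 0 1 "\<lambda>s. k s - l s" c] assms
  by (auto simp: integral_diff integrable_continuous_real continuous_on_diff)

lemma continuous_on_unit_shift:
  fixes g :: "real \<Rightarrow> real"
  assumes "continuous_on UNIV g" shows "continuous_on A (\<lambda>r. g (t + s * r))"
  by (rule continuous_on_compose2[OF assms]) (auto intro!: continuous_intros)

text \<open>For continuous 1-periodic \<open>g\<close> the function \<open>flow_speed g\<close> is the periodic solution \<open>w\<close> of
  \<open>w' + g w = d\<close> with average 1, for the only constant \<open>d\<close> that admits one. The integral of \<open>g\<close>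
  over \<open>[t, t + s]\<close> is written as \<open>s * integral {0..1} (\<lambda>r. g (t + s * r))\<close> so that only
  integrals over the fixed interval \<open>[0, 1]\<close> occur, as required by \<open>Ck_integral\<close>.\<close>

definition gain :: "(real \<Rightarrow> real) \<Rightarrow> real \<Rightarrow> real" where
  "gain g t = integral {0..1} (\<lambda>s. exp (s * integral {0..1} (\<lambda>r. g (t + s * r))))"

definition flow_speed :: "(real \<Rightarrow> real) \<Rightarrow> real \<Rightarrow> real" where
  "flow_speed g t = gain g t / integral {0..1} (gain g)"

lemma continuous_on_exp_segment:
  fixes g :: "real \<Rightarrow> real"
  assumes "continuous_on UNIV g"
  shows "continuous_on A (\<lambda>s. exp (s * integral {0..1} (\<lambda>r. g (t + s * r))))"
proof -
  obtain G where "\<forall>x. (G has_real_derivative g x) (at x)"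
    using continuous_has_antiderivative[OF assms] by (rule exE)
  then have G: "(G has_real_derivative g x) (at x)" for x by (rule spec)
  have "continuous_on UNIV G"
    by (rule DERIV_continuous_on) (rule G)
  then have "continuous_on A (\<lambda>s. exp (G (t + s) - G t))"
    by (intro continuous_intros continuous_on_compose2[of UNIV G A "\<lambda>s. t + s"]) auto
  then show ?thesis
    using integral_segment[where g = g, OF G] by simp
qed

lemma segment_bound:
  fixes g :: "real \<Rightarrow> real"
  assumes "continuous_on UNIV g" "\<And>t. \<bar>g t\<bar> \<le> M" "s \<in> {0..1}"
  shows "\<bar>s * integral {0..1} (\<lambda>r. g (t + s * r))\<bar> \<le> M"
proof -
  have "\<bar>integral {0..1} (\<lambda>r. g (t + s * r)) - integral {0..1} (\<lambda>r::real. 0 :: real)\<bar> \<le> M"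
    by (rule integral_unit_diff_le[OF continuous_on_unit_shift[OF assms(1), of _ t s]]) (use assms(2) in auto)
  then show ?thesis
    using assms(3) mult_left_le_one_le[of "\<bar>integral {0..1} (\<lambda>r. g (t + s * r))\<bar>" s]
    by (auto simp: abs_mult)
qed

lemma gain_bounds:
  assumes "continuous_on UNIV g" "\<And>t. \<bar>g t\<bar> \<le> M"
  shows "exp (- M) \<le> gain g t" "gain g t \<le> exp M"
proof -
  have "exp (- M) \<le> exp (s * integral {0..1} (\<lambda>r. g (t + s * r)))"
    "exp (s * integral {0..1} (\<lambda>r. g (t + s * r))) \<le> exp M" if "s \<in> {0..1}" for s
    using segment_bound[OF assms that, of t] by auto
  from integral_unit_bounds[OF continuous_on_exp_segment[OF assms(1)] this]
  show "exp (- M) \<le> gain g t" "gain g t \<le> exp M"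
    by (auto simp: gain_def)
qed

text \<open>Variation of constants: if \<open>G' = g\<close> and \<open>K' = exp G\<close>, then
  \<open>gain g t = exp (- G t) * (K (t + 1) - K t)\<close>. Over one period \<open>exp G\<close> is
  multiplied by \<open>exp (integral {0..1} g)\<close>, so the inhomogeneity comes out as the
  constant \<open>exp (integral {0..1} g) - 1\<close>, which is zero exactly if \<open>g\<close> has
  average 0.\<close>

lemma gain_has_derivative:
  assumes "continuous_on UNIV g" "\<And>t. g (t + 1) = g t"
  shows "(gain g has_real_derivative exp (integral {0..1} g) - 1 - g t * gain g t) (at t)"
proof -
  obtain G where "\<forall>x. (G has_real_derivative g x) (at x)"
    using continuous_has_antiderivative[OF assms(1)] by (rule exE)
  then have G: "(G has_real_derivative g x) (at x)" for x by (rule spec)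
  have "continuous_on UNIV G"
    by (rule DERIV_continuous_on) (rule G)
  then have "continuous_on UNIV (\<lambda>x. exp (G x))"
    by (intro continuous_intros)
  from continuous_has_antiderivative[OF this]
  obtain K where "\<forall>x. (K has_real_derivative exp (G x)) (at x)"
    by (rule exE)
  then have K: "(K has_real_derivative exp (G x)) (at x)" for x by (rule spec)
  have "gain g t = exp (- G t) * (K (t + 1) - K t)" for t
  proof -
    have "gain g t = integral {0..1} (\<lambda>s. exp (- G t) * exp (G (t + 1 * s)))"
      unfolding gain_def integral_segment[where g = g, OF G]
      by (simp flip: exp_add)
    also have "\<dots> = exp (- G t) * (K (t + 1) - K t)"
      using integral_segment[where g = "\<lambda>x. exp (G x)", OF K, of 1 t] by simp
    finally show ?thesis .
  qed
  then have gain: "gain g = (\<lambda>t. exp (- G t) * (K (t + 1) - K t))" by auto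
  have "G (t + 1) = G t + integral {0..1} g"
    by (rule antiderivative_shift[OF G assms(2)])
  then have eq: "exp (G (t + 1)) = exp (G t) * exp (integral {0..1} g)"
    by (simp only: exp_add)
  have "((\<lambda>x. K (x + 1)) has_real_derivative exp (G (t + 1))) (at t)"
    using K[of "t + 1"] by (simp add: DERIV_shift)
  then have "(gain g has_real_derivative (exp (- G t) * - g t) * (K (t + 1) - K t)
      + (exp (G (t + 1)) - exp (G t)) * exp (- G t)) (at t)"
    unfolding gain by (auto intro!: derivative_eq_intros G K)
  moreover have "exp (G t) * exp (- G t) = 1" by (simp flip: exp_add)
  then have "(exp (- G t) * - g t) * (K (t + 1) - K t) + (exp (G (t + 1)) - exp (G t)) * exp (- G t)
      = exp (integral {0..1} g) - 1 - g t * gain g t"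
    unfolding gain eq by (simp add: algebra_simps)
  ultimately show ?thesis by simp
qed

lemma gain_periodic:
  assumes "\<And>t. g (t + 1) = g t"
  shows "gain g (t + 1) = gain g t"
proof -
  have "g (t + 1 + x) = g (t + x)" for x
    using assms[of "t + x"] by (simp add: algebra_simps)
  then show ?thesis by (simp add: gain_def)
qed

lemma exp_lipschitz:
  fixes a b M :: real
  assumes "\<bar>a\<bar> \<le> M" "\<bar>b\<bar> \<le> M"
  shows "\<bar>exp a - exp b\<bar> \<le> exp M * \<bar>a - b\<bar>"
proof -
  have *: "exp a - exp b \<le> exp M * (a - b)" if "b \<le> a" "a \<le> M" for a b :: real
  proof -
    \<comment> \<open>The graph of \<open>exp\<close> lies above its tangent at 0.\<close>
    have "exp a * (1 - (a - b)) \<le> exp a * exp (- (a - b))"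
      using exp_ge_add_one_self[of "- (a - b)"] by (intro mult_left_mono) (simp_all add: algebra_simps)
    then have "exp a - exp b \<le> exp a * (a - b)" by (simp add: algebra_simps flip: exp_add)
    also have "\<dots> \<le> exp M * (a - b)" using that by (intro mult_right_mono) auto
    finally show ?thesis .
  qed
  show ?thesis
    using *[of a b] *[of b a] abs_le_D1[OF assms(1)] abs_le_D1[OF assms(2)]
    by (cases "b \<le> a") (simp_all add: abs_of_nonneg abs_of_nonpos)
qed

lemma gain_lipschitz:
  assumes g: "continuous_on UNIV g" "\<And>t. \<bar>g t\<bar> \<le> M" and h: "continuous_on UNIV h" "\<And>t. \<bar>h t\<bar> \<le> M"
    and d: "\<And>t. \<bar>g t - h t\<bar> \<le> \<Delta>"
  shows "\<bar>gain g t - gain h t\<bar> \<le> exp M * \<Delta>"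
  unfolding gain_def
proof (rule integral_unit_diff_le[OF continuous_on_exp_segment[OF g(1), of _ t] continuous_on_exp_segment[OF h(1), of _ t]])
  fix s :: real assume s: "s \<in> {0..1}"
  define a where "a = integral {0..1} (\<lambda>r. g (t + s * r))"
  define b where "b = integral {0..1} (\<lambda>r. h (t + s * r))"
  have "\<bar>a - b\<bar> \<le> \<Delta>"
    unfolding a_def b_def by (rule integral_unit_diff_le[OF continuous_on_unit_shift[OF g(1), of _ t s] continuous_on_unit_shift[OF h(1), of _ t s]]) (rule d)
  moreover have "\<bar>s * a - s * b\<bar> = \<bar>s\<bar> * \<bar>a - b\<bar>"
    by (simp only: abs_mult right_diff_distrib[symmetric])
  moreover have "\<bar>s\<bar> * \<bar>a - b\<bar> \<le> \<bar>a - b\<bar>"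
    using s by (intro mult_left_le_one_le) auto
  ultimately have "exp M * \<bar>s * a - s * b\<bar> \<le> exp M * \<Delta>"
    by (intro mult_left_mono) auto
  moreover have "\<bar>s * a\<bar> \<le> M" "\<bar>s * b\<bar> \<le> M"
    using segment_bound[OF g s, of t] segment_bound[OF h s, of t] unfolding a_def b_def by blast+
  then have "\<bar>exp (s * a) - exp (s * b)\<bar> \<le> exp M * \<bar>s * a - s * b\<bar>"
    by (rule exp_lipschitz)
  ultimately show "\<bar>exp (s * integral {0..1} (\<lambda>r. g (t + s * r))) - exp (s * integral {0..1} (\<lambda>r. h (t + s * r)))\<bar>
      \<le> exp M * \<Delta>"
    unfolding a_def[symmetric] b_def[symmetric] by (rule order_trans[rotated])
qed

lemma continuous_on_gain:
  assumes "continuous_on UNIV g" "\<And>t. g (t + 1) = g t"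
  shows "continuous_on A (gain g)"
  using has_field_derivative_at_within[OF gain_has_derivative[OF assms]] by (rule DERIV_continuous_on)

lemma gain_pos:
  assumes "continuous_on UNIV g" "\<And>t. g (t + 1) = g t"
  shows "0 < gain g t"
proof -
  obtain M where M: "\<forall>t. \<bar>g t\<bar> \<le> M"
    using periodic_continuous_bounded[OF assms] by blast
  have "exp (- M) \<le> gain g t"
    by (rule gain_bounds) (use assms M in auto)
  then show ?thesis
    using exp_gt_zero[of "- M"] by linarith
qed

lemma integral_gain_bounds:
  assumes "continuous_on UNIV g" "\<And>t. g (t + 1) = g t" "\<And>t. \<bar>g t\<bar> \<le> M"
  shows "exp (- M) \<le> integral {0..1} (gain g)"
proof (rule integral_unit_bounds(1)[where d = "exp M"])
  show "continuous_on {0..1} (gain g)" by (rule continuous_on_gain) fact+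
  show "exp (- M) \<le> gain g s" "gain g s \<le> exp M" for s
    by (rule gain_bounds; fact)+
qed

lemma integral_gain_pos:
  assumes "continuous_on UNIV g" "\<And>t. g (t + 1) = g t"
  shows "0 < integral {0..1} (gain g)"
proof -
  obtain M where M: "\<forall>t. \<bar>g t\<bar> \<le> M"
    using periodic_continuous_bounded[OF assms] by blast
  have "exp (- M) \<le> integral {0..1} (gain g)"
    by (rule integral_gain_bounds) (use assms M in auto)
  then show ?thesis
    using exp_gt_zero[of "- M"] by linarith
qed

lemma integral_flow_speed:
  assumes "continuous_on UNIV g" "\<And>t. g (t + 1) = g t"
  shows "integral {0..1} (flow_speed g) = 1"
  using integral_gain_pos[OF assms] unfolding flow_speed_def divide_inverse
  by (subst integral_mult_left) auto

lemma flow_speed_has_derivative: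
  assumes "continuous_on UNIV g" "\<And>t. g (t + 1) = g t"
  shows "(flow_speed g has_real_derivative
    (exp (integral {0..1} g) - 1) / integral {0..1} (gain g) - g t * flow_speed g t) (at t)"
  using DERIV_cdivide[OF gain_has_derivative[OF assms], of "integral {0..1} (gain g)" t]
  unfolding flow_speed_def by (simp add: diff_divide_distrib)

lemma flow_speed_periodic:
  "(\<And>t. g (t + 1) = g t) \<Longrightarrow> flow_speed g (t + 1) = flow_speed g t"
  by (simp add: flow_speed_def gain_periodic)

lemma flow_speed_zero: "flow_speed (\<lambda>_. 0) t = 1"
proof -
  have "gain (\<lambda>_. 0) = (\<lambda>_. 1)" by (auto simp: gain_def)
  then show ?thesis by (simp add: flow_speed_def)
qed

lemma flow_speed_bound:
  assumes "continuous_on UNIV g" "\<And>t. g (t + 1) = g t" "\<And>t. \<bar>g t\<bar> \<le> M"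
  shows "\<bar>flow_speed g t\<bar> \<le> exp (2 * M)"
proof -
  have "flow_speed g t \<le> exp M / exp (- M)"
    unfolding flow_speed_def
    using integral_gain_bounds[OF assms] gain_bounds[OF assms(1,3), of t]
    by (intro frac_le) (auto intro: less_le_trans)
  also have "\<dots> = exp (2 * M)" by (simp flip: exp_diff)
  finally show ?thesis
    using gain_pos[OF assms(1,2), of t] integral_gain_pos[OF assms(1,2)] by (simp add: flow_speed_def)
qed

lemma flow_speed_lipschitz:
  assumes g: "continuous_on UNIV g" "\<And>t. g (t + 1) = g t" "\<And>t. \<bar>g t\<bar> \<le> M"
    and h: "continuous_on UNIV h" "\<And>t. h (t + 1) = h t" "\<And>t. \<bar>h t\<bar> \<le> M"
    and d: "\<And>t. \<bar>g t - h t\<bar> \<le> \<Delta>"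
  shows "\<bar>flow_speed g t - flow_speed h t\<bar> \<le> 2 * exp (4 * M) * \<Delta>"
proof -
  let ?n = "integral {0..1} (gain g)" and ?m = "integral {0..1} (gain h)"
  have n: "exp (- M) \<le> ?n" by (rule integral_gain_bounds[OF g])
  have n0: "0 < ?n" "0 < ?m"
    by (rule integral_gain_pos[OF g(1,2)], rule integral_gain_pos[OF h(1,2)])
  have M: "0 \<le> M" "0 \<le> \<Delta>"
    using abs_ge_zero[of "g 0"] g(3)[of 0] abs_ge_zero[of "g 0 - h 0"] d[of 0] by linarith+
  have N: "\<bar>gain g t - gain h t\<bar> \<le> exp M * \<Delta>" for t
    by (rule gain_lipschitz[OF g(1,3) h(1,3) d])
  have nm: "\<bar>?m - ?n\<bar> \<le> exp M * \<Delta>"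
    by (rule integral_unit_diff_le[OF continuous_on_gain[OF h(1,2)] continuous_on_gain[OF g(1,2)]])
      (use N in \<open>simp add: abs_minus_commute\<close>)
  \<comment> \<open>Split so that the second summand contains \<open>b / m\<close>, which is again a
    flow speed and hence at most \<open>exp (2 * M)\<close> in absolute value. The two summands then
    contribute \<open>exp (2 * M) * \<Delta>\<close> and
    \<open>exp (4 * M) * \<Delta>\<close>.\<close>
  have *: "a / n - b / m = (a - b) / n + b / m * ((m - n) / n)" if "0 < n" "0 < m" for a b n m :: real
    using that by (simp add: field_simps)
  have eq: "flow_speed g t - flow_speed h t = (gain g t - gain h t) / ?n + flow_speed h t * ((?m - ?n) / ?n)"
    unfolding flow_speed_def by (rule *[OF n0])
  have "\<bar>flow_speed g t - flow_speed h t\<bar> \<le> \<bar>gain g t - gain h t\<bar> / ?n + \<bar>flow_speed h t\<bar> * (\<bar>?m - ?n\<bar> / ?n)"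
    unfolding eq
    using n0 abs_triangle_ineq[of "(gain g t - gain h t) / ?n" "flow_speed h t * ((?m - ?n) / ?n)"]
    by (simp only: abs_mult abs_divide abs_of_pos)
  also have "\<dots> \<le> (exp M * \<Delta>) / exp (- M) + exp (2 * M) * ((exp M * \<Delta>) / exp (- M))"
    using n n0 M N[of t] nm flow_speed_bound[OF h, of t]
    by (intro add_mono mult_mono frac_le) simp_all
  also have "\<dots> = (exp (2 * M) + exp (4 * M)) * \<Delta>"
  proof -
    have "exp (2 * M) = exp M * exp M" "exp (4 * M) = exp M * exp M * (exp M * exp M)"
      by (simp_all flip: exp_add)
    then show ?thesis by (simp add: exp_minus field_simps)
  qed
  also have "\<dots> \<le> (2 * exp (4 * M)) * \<Delta>"
    using M by (intro mult_right_mono) auto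
  finally show ?thesis .
qed

section \<open>Smooth dependence of the periodic solution on its coefficient\<close>

lemma Ck_gain:
  fixes h :: "'q::topological_space \<times> real \<Rightarrow> real \<Rightarrow> real"
  assumes J: "open J" "convex J" and h: "Ck m J (Q \<times> UNIV) h"
  shows "Ck m J (Q \<times> UNIV) (\<lambda>z x. gain (\<lambda>t. h (fst z, t) x) (snd z))"
proof -
  let ?A = "(Q \<times> (UNIV :: real set)) \<times> {0..1::real}"
  \<comment> \<open>The parameter is \<open>(((q, t), s), r)\<close>: \<open>s\<close> and
    \<open>r\<close> are the variables of the outer and the inner integral in \<open>gain\<close>,
    and \<open>Ck_integral\<close> removes them from the inside out.\<close>
  have "Ck m J (?A \<times> {0..1}) (\<lambda>z x. h (fst (fst (fst z)), snd (fst (fst z)) + snd (fst z) * snd z) x)"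
    by (rule Ck_subst[OF _ _ h]) (auto intro!: continuous_intros)
  from Ck_integral[OF J this]
  have "Ck m J ?A (\<lambda>z x. exp (snd z * integral {0..1} (\<lambda>r. h (fst (fst z), snd (fst z) + snd z * r) x)))"
    by (intro Ck_compose[OF smooth_exp] Ck_mult Ck_const continuous_intros) simp
  from Ck_integral[OF J this] show ?thesis
    by (simp add: gain_def)
qed

lemma Ck_integral_gain:
  fixes h :: "'q::topological_space \<times> real \<Rightarrow> real \<Rightarrow> real"
  assumes J: "open J" "convex J" and h: "Ck m J (Q \<times> UNIV) h"
  shows "Ck m J Q (\<lambda>q x. integral {0..1} (gain (\<lambda>t. h (q, t) x)))"
proof -
  have "Ck m J (Q \<times> {0..1::real}) (\<lambda>z x. gain (\<lambda>t. h (fst z, t) x) (snd z))"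
    by (rule Ck_subst[OF _ _ Ck_gain[OF J h], of _ "\<lambda>z. z"]) auto
  from Ck_integral[OF J this] show ?thesis by (simp add: eta_contract_eq)
qed

lemma Ck_flow_speed:
  fixes h :: "'q::topological_space \<times> real \<Rightarrow> real \<Rightarrow> real"
  assumes J: "open J" "convex J" and h: "Ck m J (Q \<times> UNIV) h"
    and per: "\<And>q t x. q \<in> Q \<Longrightarrow> x \<in> J \<Longrightarrow> h (q, t + 1) x = h (q, t) x"
  shows "Ck m J (Q \<times> UNIV) (\<lambda>z x. flow_speed (\<lambda>t. h (fst z, t) x) (snd z))"
proof -
  have "Ck m J (Q \<times> (UNIV :: real set)) (\<lambda>z x. integral {0..1} (gain (\<lambda>t. h (fst z, t) x)))"
    by (rule Ck_subst[OF _ _ Ck_integral_gain[OF J h], of _ fst]) (auto intro!: continuous_intros)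
  moreover have "integral {0..1} (gain (\<lambda>t. h (q, t) x)) \<noteq> 0" if "q \<in> Q" "x \<in> J" for q x
  proof -
    have "continuous_on UNIV (\<lambda>t. h (q, t) x)"
      using that by (intro continuous_on_joint_compose[OF Ck_imp_continuous_on[OF h]])
        (auto intro!: continuous_intros)
    then show ?thesis using integral_gain_pos[of "\<lambda>t. h (q, t) x"] per that by force
  qed
  ultimately show ?thesis
    unfolding flow_speed_def divide_inverse
    by (intro Ck_mult Ck_gain J h Ck_inverse) auto
qed

section \<open>Picard iteration\<close>

text \<open>Banach's fixed point theorem for functions on \<open>A\<close>. Distances occur only as
  uniform bounds \<open>d\<close>, so no metric on a function space is set up: the increments of the
  iterates are at most \<open>(1 / 2) ^ n\<close>, their sum converges uniformly by the M-test, and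
  \<open>P\<close> only has to survive uniform limits.\<close>

lemma contraction_fixed_point:
  fixes T :: "('a \<Rightarrow> real) \<Rightarrow> 'a \<Rightarrow> real"
  assumes U0: "P U0" and step: "\<And>U. P U \<Longrightarrow> P (T U)"
    and contr: "\<And>U V d. P U \<Longrightarrow> P V \<Longrightarrow> \<forall>p\<in>A. \<bar>U p - V p\<bar> \<le> d \<Longrightarrow> \<forall>p\<in>A. \<bar>T U p - T V p\<bar> \<le> d / 2"
    and closed: "\<And>X V. (\<And>n::nat. P (X n)) \<Longrightarrow> uniform_limit A X V sequentially \<Longrightarrow> P V"
    and init: "\<forall>p\<in>A. \<bar>T U0 p - U0 p\<bar> \<le> 1"
  shows "\<exists>U. P U \<and> (\<forall>p\<in>A. T U p = U p)"
proof -
  define X where "X n = (T ^^ n) U0" for n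
  have PX: "P (X n)" for n
    by (induction n) (simp_all add: X_def U0 step)
  have d: "\<forall>p\<in>A. \<bar>X (Suc n) p - X n p\<bar> \<le> (1 / 2) ^ n" for n
  proof (induction n)
    case 0
    then show ?case using init by (simp add: X_def)
  next
    case (Suc n)
    from contr[OF PX[of "Suc n"] PX[of n] this] show ?case by (simp add: X_def)
  qed
  have tele: "(\<Sum>i<n. X (Suc i) p - X i p) = X n p - X 0 p" for n p
    by (rule sum_lessThan_telescope)
  have "uniform_limit A (\<lambda>n p. \<Sum>i<n. X (Suc i) p - X i p) (\<lambda>p. \<Sum>i. X (Suc i) p - X i p) sequentially"
    by (rule Weierstrass_m_test[where M = "\<lambda>n. (1 / 2) ^ n"])
      (use d in \<open>auto intro: summable_geometric\<close>)
  then have "uniform_limit A (\<lambda>n p. X n p - U0 p) (\<lambda>p. \<Sum>i. X (Suc i) p - X i p) sequentially"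
    unfolding tele by (simp add: X_def)
  then have "uniform_limit A (\<lambda>n p. (X n p - U0 p) + U0 p) (\<lambda>p. (\<Sum>i. X (Suc i) p - X i p) + U0 p) sequentially"
    by (intro uniform_limit_intros)
  moreover define V where "V = (\<lambda>p. (\<Sum>i. X (Suc i) p - X i p) + U0 p)"
  ultimately have V: "uniform_limit A X V sequentially" by (simp only: diff_add_cancel)
  have PV: "P V" by (rule closed[OF PX V])
  have "T V p = V p" if p: "p \<in> A" for p
  proof -
    have "\<bar>T V p - V p\<bar> \<le> e" if e: "e > 0" for e
    proof -
      obtain N where N: "\<forall>n\<ge>N. \<forall>p\<in>A. dist (X n p) (V p) < e / 2"
        using uniform_limitD[OF V half_gt_zero[OF e]] unfolding eventually_sequentially by (rule exE)
      have "\<forall>p\<in>A. \<bar>V p - X N p\<bar> \<le> e / 2"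
        using N by (auto simp: dist_real_def abs_minus_commute less_imp_le)
      from contr[OF PV PX[of N] this] have "\<bar>T V p - T (X N) p\<bar> \<le> e / 2 / 2" using p by blast
      moreover have "\<bar>X (Suc N) p - V p\<bar> < e / 2"
        using N p by (auto simp: dist_real_def)
      moreover have "X (Suc N) p = T (X N) p" by (simp add: X_def)
      ultimately show ?thesis using e by linarith
    qed
    then have "\<bar>T V p - V p\<bar> \<le> 0" by (rule field_le_epsilon) simp
    then show ?thesis by simp
  qed
  then show ?thesis using PV by blast
qed

text \<open>The vector field for the fibres belonging to \<open>\<epsilon> f\<close>:
  \<open>h\<close> will be \<open>f'\<close>, and \<open>e q\<close> is the factor \<epsilon> read
  off from the parameter. It is nonlocal, as its value at \<open>(q, t)\<close> depends on
  \<open>U (q, _) x\<close> over the whole circle.\<close>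

definition speed ::
    "('q \<Rightarrow> real) \<Rightarrow> (real \<Rightarrow> real) \<Rightarrow> ('q \<times> real \<Rightarrow> real \<Rightarrow> real) \<Rightarrow> 'q \<times> real \<Rightarrow> real \<Rightarrow> real" where
  "speed e h U z x = flow_speed (\<lambda>t. e (fst z) * h (U (fst z, t) x)) (snd z)"

text \<open>The integral from 0 to \<open>x\<close> is stretched to \<open>[0, 1]\<close>, which
  covers both signs of \<open>x\<close> and fits the lemmas on parametric integrals.\<close>

definition picard_step ::
    "('q \<Rightarrow> real) \<Rightarrow> (real \<Rightarrow> real) \<Rightarrow> ('q \<times> real \<Rightarrow> real) \<Rightarrow> ('q \<times> real \<Rightarrow> real \<Rightarrow> real) \<Rightarrow> 'q \<times> real \<Rightarrow> real \<Rightarrow> real" where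
  "picard_step e h v U z x = v z + x * integral {0..1} (\<lambda>s. speed e h U z (x * s))"

definition periodic_on :: "'q set \<Rightarrow> real set \<Rightarrow> ('q \<times> real \<Rightarrow> real \<Rightarrow> real) \<Rightarrow> bool" where
  "periodic_on Q J U \<longleftrightarrow> (\<forall>q\<in>Q. \<forall>t. \<forall>x\<in>J. U (q, t + 1) x = U (q, t) x)"

lemma Ck_coeff:
  fixes U :: "'q::topological_space \<times> real \<Rightarrow> real \<Rightarrow> real"
  assumes "Ck m J (Q \<times> UNIV) U" "continuous_on Q e" "smooth h"
  shows "Ck m J (Q \<times> UNIV) (\<lambda>z x. e (fst z) * h (U z x))"
proof -
  have "continuous_on (Q \<times> (UNIV :: real set)) (\<lambda>z. e (fst z))"
    by (rule continuous_on_compose2[OF assms(2)]) (auto intro!: continuous_intros)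
  from Ck_mult[OF Ck_const[OF this] Ck_compose[OF assms(3,1)]] show ?thesis .
qed

lemma Ck_speed:
  fixes U :: "'q::topological_space \<times> real \<Rightarrow> real \<Rightarrow> real"
  assumes "open J" "convex J" "Ck m J (Q \<times> UNIV) U" "periodic_on Q J U" "continuous_on Q e" "smooth h"
  shows "Ck m J (Q \<times> UNIV) (speed e h U)"
proof -
  have "Ck m J (Q \<times> UNIV) (\<lambda>z x. flow_speed (\<lambda>t. (\<lambda>z x. e (fst z) * h (U z x)) (fst z, t) x) (snd z))"
    by (rule Ck_flow_speed[OF assms(1,2) Ck_coeff[OF assms(3,5,6)]])
      (use assms(4) in \<open>auto simp: periodic_on_def\<close>)
  then show ?thesis by (simp add: speed_def[abs_def])
qed

lemma Ck_continuous_on_slice: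
  fixes U :: "'q::topological_space \<times> real \<Rightarrow> real \<Rightarrow> real"
  assumes "Ck m J (Q \<times> UNIV) U" "q \<in> Q" "x \<in> J"
  shows "continuous_on A (\<lambda>t. U (q, t) x)"
  by (rule continuous_on_joint_compose[OF Ck_imp_continuous_on[OF assms(1)]])
    (use assms in \<open>auto intro!: continuous_intros\<close>)

lemma Ck_continuous_on_arg:
  assumes "Ck m J Z U" "z \<in> Z"
  shows "continuous_on J (U z)"
  by (rule continuous_on_joint_compose[OF Ck_imp_continuous_on[OF assms(1)]])
    (use assms in \<open>auto intro!: continuous_intros\<close>)

lemma mult_unit_mem_ball:
  fixes x :: real
  assumes "x \<in> {-\<delta><..<\<delta>}" "s \<in> {0..1}"
  shows "x * s \<in> {-\<delta><..<\<delta>}"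
proof -
  have "\<bar>x\<bar> * \<bar>s\<bar> \<le> \<bar>x\<bar>"
    by (rule mult_left_le) (use assms(2) in auto)
  then have "\<bar>x * s\<bar> < \<delta>" using assms(1) by (auto simp: abs_mult)
  then show ?thesis by (auto simp: abs_less_iff)
qed

lemma continuous_on_ray:
  fixes w :: "real \<Rightarrow> real"
  assumes "continuous_on {-\<delta><..<\<delta>} w" "x \<in> {-\<delta><..<\<delta>}"
  shows "continuous_on {0..1} (\<lambda>s. w (x * s))"
proof (rule continuous_on_compose2[OF assms(1)])
  show "(\<lambda>s. x * s) ` {0..1} \<subseteq> {-\<delta><..<\<delta>}"
    using mult_unit_mem_ball[OF assms(2)] by blast
qed (intro continuous_intros)

lemma picard_step_continuous:
  fixes U :: "'q::topological_space \<times> real \<Rightarrow> real \<Rightarrow> real"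
  assumes "Ck 0 {-\<delta><..<\<delta>} (Q \<times> UNIV) U" "periodic_on Q {-\<delta><..<\<delta>} U" "continuous_on Q e" "smooth h"
    "continuous_on (Q \<times> UNIV) v"
  shows "Ck 0 {-\<delta><..<\<delta>} (Q \<times> UNIV) (picard_step e h v U)"
proof -
  let ?J = "{-\<delta><..<\<delta>}" and ?Z = "Q \<times> (UNIV :: real set)"
  have "Ck 0 ?J ?Z (speed e h U)"
    using assms by (intro Ck_speed) auto
  then have c: "continuous_on (?Z \<times> ?J) (\<lambda>(z, x). speed e h U z x)" by simp
  have "continuous_on ((?Z \<times> ?J) \<times> {0..1}) (\<lambda>p. speed e h U (fst (fst p)) (snd (fst p) * snd p))"
  proof (rule continuous_on_joint_compose[OF c])
    show "snd (fst p) * snd p \<in> ?J" if "p \<in> (?Z \<times> ?J) \<times> {0..1}" for p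
      by (rule mult_unit_mem_ball) (use that in auto)
  qed (auto intro!: continuous_intros)
  then have "continuous_on (?Z \<times> ?J) (\<lambda>p. integral {0..1} (\<lambda>s. speed e h U (fst p) (snd p * s)))"
    using integral_continuous_on_param[of "?Z \<times> ?J" 0 1 "\<lambda>p s. speed e h U (fst p) (snd p * s)"]
    by (simp add: split_beta)
  moreover have "continuous_on (?Z \<times> ?J) (\<lambda>p. v (fst p))"
    by (rule continuous_on_compose2[OF assms(5)]) (auto intro!: continuous_intros)
  ultimately have "continuous_on (?Z \<times> ?J)
      (\<lambda>p. v (fst p) + snd p * integral {0..1} (\<lambda>s. speed e h U (fst p) (snd p * s)))"
    by (intro continuous_on_add continuous_on_mult continuous_on_snd continuous_on_id)
  then show ?thesis by (simp add: picard_step_def split_beta)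
qed

lemma picard_step_periodic:
  assumes "periodic_on Q {-\<delta><..<\<delta>} U" "\<And>q t. q \<in> Q \<Longrightarrow> v (q, t + 1) = v (q, t)"
  shows "periodic_on Q {-\<delta><..<\<delta>} (picard_step e h v U)"
  unfolding periodic_on_def
proof (intro ballI allI)
  fix q t x assume q: "q \<in> Q" and x: "x \<in> {-\<delta><..<\<delta>}"
  have "speed e h U (q, t + 1) y = speed e h U (q, t) y" if "y \<in> {-\<delta><..<\<delta>}" for y
    unfolding speed_def fst_conv snd_conv
    by (rule flow_speed_periodic) (use assms(1) q that in \<open>auto simp: periodic_on_def\<close>)
  then have "integral {0..1} (\<lambda>s. speed e h U (q, t + 1) (x * s)) = integral {0..1} (\<lambda>s. speed e h U (q, t) (x * s))"
    by (intro integral_cong) (use mult_unit_mem_ball[OF x] in blast)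
  then show "picard_step e h v U (q, t + 1) x = picard_step e h v U (q, t) x"
    using assms(2)[OF q] by (simp add: picard_step_def)
qed

lemma picard_step_diff:
  fixes U V :: "'q::topological_space \<times> real \<Rightarrow> real \<Rightarrow> real"
  assumes "continuous_on {-\<delta><..<\<delta>} (speed e h U z)" "continuous_on {-\<delta><..<\<delta>} (speed e h V z)"
    and d: "\<And>y. y \<in> {-\<delta><..<\<delta>} \<Longrightarrow> \<bar>speed e h U z y - speed e h V z y\<bar> \<le> c"
    and x: "x \<in> {-\<delta><..<\<delta>}"
  shows "\<bar>picard_step e h v U z x - picard_step e h v V z x\<bar> \<le> \<delta> * c"
proof -
  define a where "a = integral {0..1} (\<lambda>s. speed e h U z (x * s))"
  define b where "b = integral {0..1} (\<lambda>s. speed e h V z (x * s))"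
  have "\<bar>a - b\<bar> \<le> c"
    unfolding a_def b_def
    by (rule integral_unit_diff_le[OF continuous_on_ray[OF assms(1) x] continuous_on_ray[OF assms(2) x]])
      (rule d[OF mult_unit_mem_ball[OF x]])
  then have "\<bar>x\<bar> * \<bar>a - b\<bar> \<le> \<delta> * c"
    by (intro mult_mono) (use x in auto)
  then show ?thesis
    by (simp add: picard_step_def a_def[symmetric] b_def[symmetric] abs_mult flip: right_diff_distrib)
qed

lemma picard_step_bound:
  fixes U :: "'q::topological_space \<times> real \<Rightarrow> real \<Rightarrow> real"
  assumes "continuous_on {-\<delta><..<\<delta>} (speed e h U z)"
    and d: "\<And>y. y \<in> {-\<delta><..<\<delta>} \<Longrightarrow> \<bar>speed e h U z y\<bar> \<le> c"
    and x: "x \<in> {-\<delta><..<\<delta>}"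
  shows "\<bar>picard_step e h v U z x - v z\<bar> \<le> \<delta> * c"
proof -
  have "\<bar>integral {0..1} (\<lambda>s. speed e h U z (x * s)) - integral {0..1} (\<lambda>s::real. 0 :: real)\<bar> \<le> c"
    by (rule integral_unit_diff_le[OF continuous_on_ray[OF assms(1) x] continuous_on_const])
      (use d[OF mult_unit_mem_ball[OF x]] in simp)
  then have "\<bar>x\<bar> * \<bar>integral {0..1} (\<lambda>s. speed e h U z (x * s))\<bar> \<le> \<delta> * c"
    by (intro mult_mono) (use x in auto)
  then show ?thesis
    by (simp add: picard_step_def abs_mult)
qed

lemma ray_integral_has_derivative:
  fixes w :: "real \<Rightarrow> real"
  assumes "continuous_on {-\<delta><..<\<delta>} w" "x \<in> {-\<delta><..<\<delta>}"
  shows "((\<lambda>x. x * integral {0..1} (\<lambda>s. w (x * s))) has_real_derivative w x) (at x)"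
proof -
  have "\<exists>A. \<forall>x::real. ereal (-\<delta>) < ereal x \<longrightarrow> ereal x < ereal \<delta> \<longrightarrow> (A has_vector_derivative w x) (at x)"
    using assms by (intro einterval_antiderivative)
      (auto simp: continuous_on_eq_continuous_at)
  then obtain A where "\<forall>x::real. ereal (-\<delta>) < ereal x \<longrightarrow> ereal x < ereal \<delta> \<longrightarrow> (A has_vector_derivative w x) (at x)"
    by (rule exE)
  then have "\<forall>x\<in>{-\<delta><..<\<delta>}. (A has_real_derivative w x) (at x)"
    by (simp add: has_real_derivative_iff_has_vector_derivative)
  then have A: "(A has_real_derivative w x) (at x)" if "x \<in> {-\<delta><..<\<delta>}" for x using that by (rule bspec)
  have eq: "A y - A 0 = y * integral {0..1} (\<lambda>s. w (y * s))" if y: "y \<in> {-\<delta><..<\<delta>}" for y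
    using integral_segment[where g = w and G = A and t = 0 and s = y] A[OF mult_unit_mem_ball[OF y]] by simp
  have "((\<lambda>x. A x - A 0) has_real_derivative w x) (at x)"
    using DERIV_diff[OF A[OF assms(2)] DERIV_const[of "A 0"]] by simp
  then show ?thesis
    by (rule has_field_derivative_transform_within_open[of _ _ _ "{-\<delta><..<\<delta>}"]) (use assms(2) eq in auto)
qed

lemma continuous_on_coeff:
  fixes U :: "'q::topological_space \<times> real \<Rightarrow> real \<Rightarrow> real"
  assumes "Ck m J (Q \<times> UNIV) U" "q \<in> Q" "x \<in> J" "smooth h"
  shows "continuous_on A (\<lambda>t. c * h (U (q, t) x))"
  using smooth_compose_continuous_on[OF assms(4) Ck_continuous_on_slice[OF assms(1-3)], where n = 0]
  by (intro continuous_intros) simp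

lemma speed_bound:
  fixes U :: "'q::topological_space \<times> real \<Rightarrow> real \<Rightarrow> real"
  assumes "Ck m J (Q \<times> UNIV) U" "periodic_on Q J U" "smooth h" "q \<in> Q" "x \<in> J"
    "\<And>t. \<bar>e q * h (U (q, t) x)\<bar> \<le> M"
  shows "\<bar>speed e h U (q, t) x\<bar> \<le> exp (2 * M)"
  unfolding speed_def fst_conv snd_conv
proof (rule flow_speed_bound[of "\<lambda>t. e q * h (U (q, t) x)"])
  show "continuous_on UNIV (\<lambda>t. e q * h (U (q, t) x))"
    by (rule continuous_on_coeff[OF assms(1,4,5,3)])
  show "e q * h (U (q, t + 1) x) = e q * h (U (q, t) x)" for t
    using assms(2,4,5) by (simp add: periodic_on_def)
qed (rule assms(6))

lemma speed_diff:
  fixes U V :: "'q::topological_space \<times> real \<Rightarrow> real \<Rightarrow> real"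
  assumes "Ck m J (Q \<times> UNIV) U" "periodic_on Q J U" "Ck m J (Q \<times> UNIV) V" "periodic_on Q J V"
    "smooth h" "q \<in> Q" "x \<in> J"
    "\<And>t. \<bar>e q * h (U (q, t) x)\<bar> \<le> M" "\<And>t. \<bar>e q * h (V (q, t) x)\<bar> \<le> M"
    "\<And>t. \<bar>e q * h (U (q, t) x) - e q * h (V (q, t) x)\<bar> \<le> d"
  shows "\<bar>speed e h U (q, t) x - speed e h V (q, t) x\<bar> \<le> 2 * exp (4 * M) * d"
  unfolding speed_def fst_conv snd_conv
proof (rule flow_speed_lipschitz[of "\<lambda>t. e q * h (U (q, t) x)" _ "\<lambda>t. e q * h (V (q, t) x)"])
  show "continuous_on UNIV (\<lambda>t. e q * h (U (q, t) x))"
    by (rule continuous_on_coeff[OF assms(1,6,7,5)])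
  show "continuous_on UNIV (\<lambda>t. e q * h (V (q, t) x))"
    by (rule continuous_on_coeff[OF assms(3,6,7,5)])
  show "e q * h (U (q, t + 1) x) = e q * h (U (q, t) x)" for t
    using assms by (simp add: periodic_on_def)
  show "e q * h (V (q, t + 1) x) = e q * h (V (q, t) x)" for t
    using assms by (simp add: periodic_on_def)
qed (rule assms(8), rule assms(9), rule assms(10))

lemma smooth_bounded_lipschitz:
  assumes "smooth h"
  obtains K where "0 \<le> K" "\<And>y. \<bar>y\<bar> \<le> R \<Longrightarrow> \<bar>h y\<bar> \<le> K"
    "\<And>y z. \<bar>y\<bar> \<le> R \<Longrightarrow> \<bar>z\<bar> \<le> R \<Longrightarrow> \<bar>h y - h z\<bar> \<le> K * \<bar>y - z\<bar>"
proof -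
  have b: "\<exists>K. \<forall>y\<in>{-R..R}. \<bar>(deriv ^^ n) h y\<bar> \<le> K" for n
  proof -
    have "compact ((deriv ^^ n) h ` {-R..R})"
      by (intro compact_continuous_image smooth_continuous_on assms) auto
    then have "bounded ((deriv ^^ n) h ` {-R..R})" by (rule compact_imp_bounded)
    then show ?thesis by (auto simp: bounded_real)
  qed
  obtain K0 where K0: "\<forall>y\<in>{-R..R}. \<bar>h y\<bar> \<le> K0" using b[of 0] by auto
  obtain K1 where K1: "\<forall>y\<in>{-R..R}. \<bar>deriv h y\<bar> \<le> K1" using b[of 1] by auto
  have lip: "\<bar>h y - h z\<bar> \<le> K1 * \<bar>y - z\<bar>" if "\<bar>y\<bar> \<le> R" "\<bar>z\<bar> \<le> R" for y z
  proof -
    have "norm (h y - h z) \<le> K1 * norm (y - z)"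
    proof (rule field_differentiable_bound[of "{-R..R}" h "deriv h"])
      show "(h has_real_derivative deriv h w) (at w within {-R..R})" for w
        using smooth_DERIV[OF assms, of 0 w] by (simp add: has_field_derivative_at_within)
    qed (use K1 that in auto)
    then show ?thesis by simp
  qed
  show ?thesis
  proof (rule that[of "max 0 (max K0 K1)"])
    show "\<bar>h y\<bar> \<le> max 0 (max K0 K1)" if "\<bar>y\<bar> \<le> R" for y
      using bspec[OF K0, of y] that by (auto simp: abs_le_iff le_max_iff_disj)
    show "\<bar>h y - h z\<bar> \<le> max 0 (max K0 K1) * \<bar>y - z\<bar>" if "\<bar>y\<bar> \<le> R" "\<bar>z\<bar> \<le> R" for y z
      by (rule order_trans[OF lip[OF that]]) (intro mult_right_mono; simp)
  qed simp
qed

lemma periodic_on_bounded: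
  fixes v :: "'q::topological_space \<times> real \<Rightarrow> real"
  assumes "compact Q" "continuous_on (Q \<times> UNIV) v" "\<And>q t. q \<in> Q \<Longrightarrow> v (q, t + 1) = v (q, t)"
  shows "\<exists>R. \<forall>q\<in>Q. \<forall>t. \<bar>v (q, t)\<bar> \<le> R"
proof -
  have "compact (v ` (Q \<times> {0..1}))"
    using assms by (intro compact_continuous_image compact_Times continuous_on_subset[OF assms(2)]) auto
  then obtain R where R: "\<forall>z\<in>Q \<times> {0..1}. \<bar>v z\<bar> \<le> R"
    using compact_imp_bounded by (force simp: bounded_real)
  have "\<bar>v (q, t)\<bar> \<le> R" if q: "q \<in> Q" for q t
  proof -
    have "v (q, frac t) = v (q, t)"
      by (rule periodic_frac[of "\<lambda>t. v (q, t)"]) (rule assms(3)[OF q])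
    then show ?thesis
      using bspec[OF R, of "(q, frac t)"] q frac_unit[of t] by simp
  qed
  then show ?thesis by blast
qed

lemma picard_fixed_point:
  fixes Q :: "'q::topological_space set"
  assumes Q: "compact Q" and h: "smooth h" and e: "continuous_on Q e"
    and v: "continuous_on (Q \<times> UNIV) v" "\<And>q t. q \<in> Q \<Longrightarrow> v (q, t + 1) = v (q, t)"
  shows "\<exists>\<delta>>0. \<exists>U. Ck 0 {-\<delta><..<\<delta>} (Q \<times> UNIV) U \<and> periodic_on Q {-\<delta><..<\<delta>} U \<and>
    (\<forall>z\<in>Q \<times> UNIV. \<forall>x\<in>{-\<delta><..<\<delta>}. picard_step e h v U z x = U z x)"
proof -
  let ?Z = "Q \<times> (UNIV :: real set)"
  obtain R where R: "\<forall>q\<in>Q. \<forall>t. \<bar>v (q, t)\<bar> \<le> R" using periodic_on_bounded[OF Q v] by blast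
  obtain K where K: "0 \<le> K" "\<And>y. \<bar>y\<bar> \<le> R + 1 \<Longrightarrow> \<bar>h y\<bar> \<le> K"
    "\<And>y z. \<bar>y\<bar> \<le> R + 1 \<Longrightarrow> \<bar>z\<bar> \<le> R + 1 \<Longrightarrow> \<bar>h y - h z\<bar> \<le> K * \<bar>y - z\<bar>"
    using smooth_bounded_lipschitz[OF h] by metis
  obtain E where E: "\<forall>q\<in>Q. \<bar>e q\<bar> \<le> E" "0 \<le> E"
  proof -
    have "bounded (e ` Q)" by (intro compact_imp_bounded compact_continuous_image Q e)
    then obtain E where "\<forall>q\<in>Q. \<bar>e q\<bar> \<le> E" by (auto simp: bounded_real)
    then have "\<forall>q\<in>Q. \<bar>e q\<bar> \<le> max 0 E" by (auto simp: le_max_iff_disj)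
    then show ?thesis using that[of "max 0 E"] by simp
  qed
  \<comment> \<open>While \<open>U\<close> stays within distance 1 of \<open>v\<close>, its values
    lie in \<open>[-R - 1, R + 1]\<close>, where \<open>K\<close> bounds \<open>h\<close> and is a
    Lipschitz constant for it. Then \<open>M\<close> bounds the coefficient,
    \<open>exp (2 * M)\<close> bounds the speed, and \<open>c\<close> is a Lipschitz constant of the
    speed in \<open>U\<close>. The choice of \<delta> keeps a step within distance 1 of
    \<open>v\<close> and makes it contract by 1/2.\<close>
  define M where "M = E * K"
  define c where "c = 2 * exp (4 * M) * (E * K)"
  have c0: "0 \<le> c" using E(2) K(1) by (simp add: c_def)
  define \<delta> where "\<delta> = 1 / (exp (2 * M) + 2 * c + 1)"
  have pos: "0 < exp (2 * M) + 2 * c + 1" using c0 exp_gt_zero[of "2 * M"] by linarith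
  then have \<delta>: "0 < \<delta>" "\<delta> * exp (2 * M) \<le> 1" "\<delta> * c \<le> 1 / 2"
    using c0 exp_gt_zero[of "2 * M"] by (auto simp: \<delta>_def field_simps)
  let ?J = "{-\<delta><..<\<delta>}"
  \<comment> \<open>\<open>uniform_limit\<close> speaks of functions of a single argument, hence the
    uncurried \<open>W\<close>. Of regularity the invariant \<open>P\<close> asks only continuity,
    because smoothness in \<open>x\<close> would not survive uniform limits.\<close>
  define cur :: "(('q \<times> real) \<times> real \<Rightarrow> real) \<Rightarrow> 'q \<times> real \<Rightarrow> real \<Rightarrow> real"
    where "cur W = (\<lambda>z x. W (z, x))" for W
  define T where "T W = (\<lambda>(z, x). picard_step e h v (cur W) z x)" for W
  define P where "P W \<longleftrightarrow> Ck 0 ?J ?Z (cur W) \<and> periodic_on Q ?J (cur W) \<and>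
      (\<forall>z\<in>?Z. \<forall>x\<in>?J. \<bar>cur W z x - v z\<bar> \<le> 1)" for W
  have curT: "cur (T W) = picard_step e h v (cur W)" for W by (simp add: cur_def T_def)
  have near: "\<bar>cur W (q, t) x\<bar> \<le> R + 1" if "P W" "q \<in> Q" "x \<in> ?J" for W q t x
  proof -
    have "\<bar>cur W (q, t) x - v (q, t)\<bar> \<le> 1" "\<bar>v (q, t)\<bar> \<le> R"
      using that R unfolding P_def by blast+
    then show ?thesis by linarith
  qed
  have coeff: "\<bar>e q * h (cur W (q, t) x)\<bar> \<le> M" if "P W" "q \<in> Q" "x \<in> ?J" for W q t x
    unfolding abs_mult M_def
    by (intro mult_mono K(2) near that) (use E that in auto)
  have sc: "continuous_on ?J (speed e h (cur W) z)" if "P W" "z \<in> ?Z" for W z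
    by (rule Ck_continuous_on_arg[OF Ck_speed[of ?J 0]]) (use that e h in \<open>auto simp: P_def\<close>)
  have "\<exists>W. P W \<and> (\<forall>p\<in>?Z \<times> ?J. T W p = W p)"
  proof (rule contraction_fixed_point[of P "\<lambda>(z, x). v z"])
    have "Ck 0 ?J ?Z (\<lambda>z x. v z)" using v(1) by (rule Ck_const)
    then show P0: "P (\<lambda>(z, x). v z)"
      using v(2) by (auto simp: P_def cur_def periodic_on_def)
    have Tb: "\<bar>cur (T W) z x - v z\<bar> \<le> 1" if W: "P W" and z: "z \<in> ?Z" and x: "x \<in> ?J" for W z x
    proof -
      obtain q t where qt: "z = (q, t)" "q \<in> Q" using z by auto
      have "\<bar>picard_step e h v (cur W) z x - v z\<bar> \<le> \<delta> * exp (2 * M)"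
      proof (rule picard_step_bound[OF sc[OF W z] _ x])
        show "\<bar>speed e h (cur W) z y\<bar> \<le> exp (2 * M)" if "y \<in> ?J" for y
          unfolding qt(1)
        proof (rule speed_bound[of 0 ?J Q])
          show "Ck 0 ?J ?Z (cur W)" "periodic_on Q ?J (cur W)" using W unfolding P_def by blast+
        qed (fact h qt(2) that | rule coeff[OF W qt(2) that])+
      qed
      then show ?thesis using \<delta> by (simp add: curT)
    qed
    show "P (T W)" if W: "P W" for W
      unfolding P_def
    proof (intro conjI ballI)
      show "Ck 0 ?J ?Z (cur (T W))"
        unfolding curT by (rule picard_step_continuous) (use W e h v in \<open>auto simp: P_def\<close>)
      show "periodic_on Q ?J (cur (T W))"
        unfolding curT by (rule picard_step_periodic) (use W v in \<open>auto simp: P_def\<close>)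
    qed (rule Tb[OF W])
    show "\<forall>p\<in>?Z \<times> ?J. \<bar>T (\<lambda>(z, x). v z) p - (case p of (z, x) \<Rightarrow> v z)\<bar> \<le> 1"
      using Tb[OF P0] by (auto simp: cur_def)
    show "\<forall>p\<in>?Z \<times> ?J. \<bar>T W p - T V p\<bar> \<le> d / 2"
      if W: "P W" and V: "P V" and d: "\<forall>p\<in>?Z \<times> ?J. \<bar>W p - V p\<bar> \<le> d" for W V d
    proof
      fix p assume "p \<in> ?Z \<times> ?J"
      then obtain q t x where p: "p = ((q, t), x)" "q \<in> Q" "x \<in> ?J" by auto
      then have z: "(q, t) \<in> ?Z" by simp
      have "0 \<le> d" using d abs_ge_zero[of "W p - V p"] \<open>p \<in> ?Z \<times> ?J\<close> by (metis order_trans)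
      have sd: "\<bar>speed e h (cur W) (q, t) y - speed e h (cur V) (q, t) y\<bar> \<le> 2 * exp (4 * M) * (E * (K * d))"
        if y: "y \<in> ?J" for y
      proof (rule speed_diff[of 0 ?J Q])
        show "Ck 0 ?J ?Z (cur W)" "periodic_on Q ?J (cur W)" "Ck 0 ?J ?Z (cur V)" "periodic_on Q ?J (cur V)"
          using W V unfolding P_def by blast+
        show "\<bar>e q * h (cur W (q, t) y)\<bar> \<le> M" "\<bar>e q * h (cur V (q, t) y)\<bar> \<le> M" for t
          by (rule coeff[OF W p(2) y], rule coeff[OF V p(2) y])
        show "\<bar>e q * h (cur W (q, t) y) - e q * h (cur V (q, t) y)\<bar> \<le> E * (K * d)" for t
        proof -
          have "\<bar>cur W (q, t) y - cur V (q, t) y\<bar> \<le> d"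
            using bspec[OF d, of "((q, t), y)"] p y by (simp add: cur_def)
          then have "K * \<bar>cur W (q, t) y - cur V (q, t) y\<bar> \<le> K * d" using K(1) by (rule mult_left_mono)
          moreover have "\<bar>h (cur W (q, t) y) - h (cur V (q, t) y)\<bar> \<le> K * \<bar>cur W (q, t) y - cur V (q, t) y\<bar>"
            by (intro K(3) near W V p y)
          ultimately have "\<bar>h (cur W (q, t) y) - h (cur V (q, t) y)\<bar> \<le> K * d" by linarith
          then have "\<bar>e q\<bar> * \<bar>h (cur W (q, t) y) - h (cur V (q, t) y)\<bar> \<le> E * (K * d)"
            using E p by (intro mult_mono) auto
          then show ?thesis by (simp only: abs_mult right_diff_distrib[symmetric])
        qed
      qed (fact h p(2) y)+
      have "\<bar>picard_step e h v (cur W) (q, t) x - picard_step e h v (cur V) (q, t) x\<bar>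
          \<le> \<delta> * (2 * exp (4 * M) * (E * (K * d)))"
        by (rule picard_step_diff[OF sc[OF W z] sc[OF V z] sd p(3)])
      also have "\<dots> = \<delta> * c * d" by (simp add: c_def)
      also have "\<dots> \<le> 1 / 2 * d" using \<delta>(3) \<open>0 \<le> d\<close> by (rule mult_right_mono)
      finally show "\<bar>T W p - T V p\<bar> \<le> d / 2" by (simp add: T_def p)
    qed
    show "P V" if X: "\<And>n::nat. P (X n)" and lim: "uniform_limit (?Z \<times> ?J) X V sequentially" for X V
    proof -
      have pw: "(\<lambda>n. cur (X n) z x) \<longlonglongrightarrow> cur V z x" if "z \<in> ?Z" "x \<in> ?J" for z x
        using tendsto_uniform_limitI[OF lim, of "(z, x)"] that by (simp add: cur_def)
      have "continuous_on (?Z \<times> ?J) V"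
        by (rule uniform_limit_theorem[OF _ lim])
          (use X in \<open>auto simp: P_def cur_def split_beta\<close>)
      then have "Ck 0 ?J ?Z (cur V)" by (simp add: cur_def split_beta)
      moreover have "cur V (q, t + 1) x = cur V (q, t) x" if "q \<in> Q" "x \<in> ?J" for q t x
      proof (rule LIMSEQ_unique)
        show "(\<lambda>n. cur (X n) (q, t) x) \<longlonglongrightarrow> cur V (q, t) x" by (rule pw) (use that in auto)
        have "(\<lambda>n. cur (X n) (q, t + 1) x) \<longlonglongrightarrow> cur V (q, t + 1) x" by (rule pw) (use that in auto)
        then show "(\<lambda>n. cur (X n) (q, t) x) \<longlonglongrightarrow> cur V (q, t + 1) x"
          using X that by (simp add: P_def periodic_on_def)
      qed
      moreover have "\<bar>cur V z x - v z\<bar> \<le> 1" if z: "z \<in> ?Z" "x \<in> ?J" for z x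
      proof (rule LIMSEQ_le_const2)
        show "(\<lambda>n. \<bar>cur (X n) z x - v z\<bar>) \<longlonglongrightarrow> \<bar>cur V z x - v z\<bar>"
          by (intro tendsto_intros pw z)
        show "\<exists>N. \<forall>n\<ge>N. \<bar>cur (X n) z x - v z\<bar> \<le> 1"
          using X z unfolding P_def by blast
      qed
      ultimately show ?thesis by (simp add: P_def periodic_on_def)
    qed
  qed
  then obtain W where W: "P W" "\<forall>p\<in>?Z \<times> ?J. T W p = W p" by blast
  have "picard_step e h v (cur W) z x = cur W z x" if "z \<in> ?Z" "x \<in> ?J" for z x
    using bspec[OF W(2), of "(z, x)"] that by (simp add: T_def cur_def)
  then show ?thesis using W(1) \<delta>(1) unfolding P_def by blast
qed

text \<open>Bootstrapping: the speed is given by explicit integrals, so it inherits class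
  \<open>Ck m\<close> from \<open>U\<close>; being the \<open>x\<close>-derivative of
  \<open>U\<close>, it lifts \<open>U\<close> to class \<open>Ck (Suc m)\<close>. The interval is
  that of the contraction, the same for every \<open>m\<close> and every parameter in the compact
  \<open>Q\<close>.\<close>

lemma parametric_flow:
  fixes Q :: "'q::topological_space set"
  assumes Q: "compact Q" and h: "smooth h" and e: "continuous_on Q e"
    and v: "continuous_on (Q \<times> UNIV) v" "\<And>q t. q \<in> Q \<Longrightarrow> v (q, t + 1) = v (q, t)"
  shows "\<exists>\<delta>>0. \<exists>U. (\<forall>m. Ck m {-\<delta><..<\<delta>} (Q \<times> UNIV) U) \<and> periodic_on Q {-\<delta><..<\<delta>} U \<and>
    (\<forall>z\<in>Q \<times> UNIV. U z 0 = v z) \<and>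
    (\<forall>z\<in>Q \<times> UNIV. \<forall>x\<in>{-\<delta><..<\<delta>}. (U z has_real_derivative speed e h U z x) (at x))"
proof -
  let ?Z = "Q \<times> (UNIV :: real set)"
  obtain \<delta> U where \<delta>: "0 < \<delta>" and U: "Ck 0 {-\<delta><..<\<delta>} ?Z U" "periodic_on Q {-\<delta><..<\<delta>} U"
    and fp: "\<forall>z\<in>?Z. \<forall>x\<in>{-\<delta><..<\<delta>}. picard_step e h v U z x = U z x"
    using picard_fixed_point[OF assms] by blast
  let ?J = "{-\<delta><..<\<delta>}"
  have sp: "Ck m ?J ?Z (speed e h U)" if "Ck m ?J ?Z U" for m
    using that U e h by (intro Ck_speed) auto
  have D: "(U z has_real_derivative speed e h U z x) (at x)" if z: "z \<in> ?Z" and x: "x \<in> ?J" for z x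
  proof (rule has_field_derivative_transform_within_open[of _ _ _ ?J])
    have "((\<lambda>x. v z + x * integral {0..1} (\<lambda>s. speed e h U z (x * s))) has_real_derivative 0 + speed e h U z x) (at x)"
      by (intro DERIV_add DERIV_const ray_integral_has_derivative[OF _ x] Ck_continuous_on_arg[OF sp[OF U(1)] z])
    then show "(picard_step e h v U z has_real_derivative speed e h U z x) (at x)"
      by (simp add: picard_step_def[abs_def])
  qed (use z x fp in auto)
  have "Ck m ?J ?Z U" for m
  proof (induction m)
    case (Suc m)
    then show ?case
      unfolding Ck.simps using Ck_imp_continuous_on[OF U(1)] D sp[OF Suc]
      by (intro conjI exI[of _ "speed e h U"] ballI)
  qed (rule U)
  moreover have "U z 0 = v z" if "z \<in> ?Z" for z
    using bspec[OF bspec[OF fp that], of 0] \<delta> by (simp add: picard_step_def)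
  ultimately show ?thesis using U(2) D \<delta> by blast
qed

section \<open>Weak derivatives on the circle\<close>

lemma continuous_circle_integrable:
  fixes u :: "real \<Rightarrow> 'a::euclidean_space"
  assumes "continuous_on {0..1} u"
  shows "integrable circle_measure u" "circle_int u = integral {0..1} u"
proof -
  show 1: "integrable circle_measure u" using assms by (rule continuous_imp_integrable_real)
  show "circle_int u = integral {0..1} u"
    by (rule lebesgue_integral_eq_integral[OF 1]) simp
qed

lemma circle_int_const: "circle_int (\<lambda>t. c :: real) = c"
  by (subst continuous_circle_integrable(2)) auto

lemma C1I:
  assumes "periodic u" "\<And>t. (u has_real_derivative u' t) (at t)" "continuous_on UNIV u'"
  shows "u \<in> C1" "deriv u = u'"
proof -
  show d: "deriv u = u'" using assms(2) by (auto intro: DERIV_imp_deriv)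
  show "u \<in> C1"
    unfolding C1_def using assms d real_differentiable_def by blast
qed

lemma C1_has_derivative: "u \<in> C1 \<Longrightarrow> (u has_real_derivative deriv u t) (at t)"
  by (simp add: C1_def DERIV_deriv_iff_real_differentiable)

lemma C1_continuous_on: "u \<in> C1 \<Longrightarrow> continuous_on A u"
  by (rule DERIV_continuous_on) (rule has_field_derivative_at_within[OF C1_has_derivative])

lemma C1_deriv_continuous_on: "u \<in> C1 \<Longrightarrow> continuous_on A (deriv u)"
  by (rule continuous_on_subset[of UNIV]) (simp_all add: C1_def)

lemma C1_periodic: "u \<in> C1 \<Longrightarrow> u (t + 1) = u t"
  by (simp add: C1_def periodic_def)

lemma C1_deriv_periodic:
  assumes "u \<in> C1" shows "deriv u (t + 1) = deriv u t"
proof -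
  have "(\<lambda>x. u (x + 1)) = u" using C1_periodic[OF assms] by auto
  then show ?thesis
    using deriv_funpow_shift[of 1 u 1] by (simp add: fun_eq_iff)
qed

lemma integral_deriv_unit:
  fixes u u' :: "real \<Rightarrow> real"
  assumes "\<And>t. (u has_real_derivative u' t) (at t)"
  shows "integral {0..1} u' = u 1 - u 0"
  using integral_segment[where g = u' and G = u and t = 0 and s = 1] assms by simp

lemma C1_const: "(\<lambda>t. c) \<in> C1"
  by (rule C1I[where u' = "\<lambda>t. 0"]) (auto simp: periodic_def)

lemma C1_weak_deriv:
  assumes u: "u \<in> C1" shows "weak_deriv u (deriv u)"
  unfolding weak_deriv_def
proof
  fix \<eta> assume e: "\<eta> \<in> C1"
  have c: "continuous_on {0..1} (\<lambda>t. u t * deriv \<eta> t)" "continuous_on {0..1} (\<lambda>t. deriv u t * \<eta> t)"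
    by (intro continuous_intros C1_continuous_on C1_deriv_continuous_on u e)+
  have "((\<lambda>t. u t * \<eta> t) has_real_derivative u t * deriv \<eta> t + deriv u t * \<eta> t) (at t)" for t
    using DERIV_mult'[OF C1_has_derivative[OF u] C1_has_derivative[OF e]] .
  from integral_deriv_unit[OF this] have "integral {0..1} (\<lambda>t. u t * deriv \<eta> t + deriv u t * \<eta> t) = 0"
    using C1_periodic[OF u, of 0] C1_periodic[OF e, of 0] by simp
  then have "integral {0..1} (\<lambda>t. u t * deriv \<eta> t) + integral {0..1} (\<lambda>t. deriv u t * \<eta> t) = 0"
    by (simp add: integral_add[OF integrable_continuous_real[OF c(1)] integrable_continuous_real[OF c(2)]])
  then show "circle_int (\<lambda>t. u t * deriv \<eta> t) = - circle_int (\<lambda>t. deriv u t * \<eta> t)"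
    by (simp add: continuous_circle_integrable[OF c(1)] continuous_circle_integrable[OF c(2)])
qed

lemma continuous_L2:
  assumes "continuous_on UNIV g" "periodic g" shows "g \<in> L2"
proof -
  have c: "continuous_on {0..1} g" using assms(1) by (rule continuous_on_subset) simp
  then have "integrable circle_measure (\<lambda>t. (g t)\<^sup>2)"
    by (intro continuous_circle_integrable continuous_intros)
  then show ?thesis
    using assms(2) continuous_circle_integrable(1)[OF c] by (simp add: L2_def borel_measurable_integrable)
qed

lemma C1_subset_B1:
  assumes "u \<in> C1" shows "u \<in> B1 B"
proof (cases B)
  case Sobolev
  have "periodic u" "periodic (deriv u)"
    using C1_periodic[OF assms] C1_deriv_periodic[OF assms] by (auto simp: periodic_def)
  then have "u \<in> L2" "deriv u \<in> L2"
    by (auto intro: continuous_L2 C1_continuous_on C1_deriv_continuous_on assms)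
  then show ?thesis
    using Sobolev C1_weak_deriv[OF assms] C1_continuous_on[OF assms] by (auto simp: H1_def)
qed (use assms in simp)

lemma B1_continuous_on: "u \<in> B1 B \<Longrightarrow> continuous_on A u"
  by (cases B) (auto simp: H1_def intro: C1_continuous_on continuous_on_subset)

lemma B1_periodic: "u \<in> B1 B \<Longrightarrow> u (t + 1) = u t"
  by (cases B) (auto simp: H1_def L2_def periodic_def C1_periodic)

section \<open>Functions orthogonal to all continuously differentiable ones\<close>

lemma finite_measure_circle: "finite_measure circle_measure"
  by (rule finite_measureI) (simp add: emeasure_restrict_space space_restrict_space)

lemma L2_integrable:
  assumes "g \<in> L2" shows "integrable circle_measure g"
proof (rule Bochner_Integration.integrable_bound)
  show "integrable circle_measure (\<lambda>t. 1 + (g t)\<^sup>2)"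
    using assms finite_measure.integrable_const[OF finite_measure_circle] by (auto simp: L2_def)
  have "\<bar>y\<bar> \<le> 1 + y\<^sup>2" for y :: real
    using zero_le_power2[of "\<bar>y\<bar> - 1"] by (simp add: power2_diff)
  then show "AE t in circle_measure. norm (g t) \<le> norm (1 + (g t)\<^sup>2)"
    by (intro AE_I2) (simp add: abs_of_nonneg)
qed (use assms in \<open>simp add: L2_def\<close>)

text \<open>The half-lines are stable under intersection and generate the Borel sets, so the
  integral of \<open>g\<close> vanishes over every Borel set. The induction passes to complements
  because the total integral is zero.\<close>

lemma AE_zero_lborel:
  fixes g :: "real \<Rightarrow> real"
  assumes g: "integrable lborel g" and tot: "integral\<^sup>L lborel g = 0"
    and half: "\<And>b. set_lebesgue_integral lborel {..<b} g = 0"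
  shows "AE t in lborel. g t = 0"
proof (rule sigma_finite_measure.density_zero[OF _ g])
  show "sigma_finite_measure (lborel :: real measure)" by (rule lborel.sigma_finite_measure_axioms)
  have si: "set_integrable lborel A g" if "A \<in> sets lborel" for A
    unfolding set_integrable_def using integrable_mult_indicator[OF that g] .
  have sets_eq: "sets (lborel :: real measure) = sigma_sets UNIV (range lessThan)"
    by (simp add: borel_Iio)
  fix A :: "real set" assume "A \<in> sets lborel"
  then have mem: "A \<in> sigma_sets UNIV (range lessThan)" by (simp only: sets_eq)
  have istab: "Int_stable (range (lessThan :: real \<Rightarrow> _))"
    unfolding Int_stable_def
  proof (intro ballI, elim imageE)
    fix A B and a b :: real assume "A = {..<a}" "B = {..<b}"
    then have "A \<inter> B = {..<min a b}" by auto
    then show "A \<inter> B \<in> range lessThan" by simp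
  qed
  have "range lessThan \<subseteq> Pow (UNIV :: real set)" by simp
  from istab this mem show "set_lebesgue_integral lborel A g = 0"
  proof (induction rule: sigma_sets_induct_disjoint)
    case (basic A)
    then show ?case using half by auto
  next
    case empty
    show ?case by (simp add: set_lebesgue_integral_def)
  next
    case (compl A)
    then have A: "A \<in> sets lborel" by (simp only: sets_eq)
    have eq: "indicator (UNIV - A) t *\<^sub>R g t = g t - indicator A t *\<^sub>R g t" for t
      by (auto simp: indicator_def)
    show ?case
      using compl.IH tot g si[OF A] unfolding set_lebesgue_integral_def set_integrable_def eq
      by simp
  next
    case (union A)
    then have A: "A i \<in> sets lborel" for i by (auto simp only: sets_eq)
    have "set_lebesgue_integral lborel (\<Union>i. A i) g = (\<Sum>i. set_lebesgue_integral lborel (A i) g)"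
      using A union.hyps(1) si by (intro lebesgue_integral_countable_add) (auto simp: disjoint_family_on_def)
    then show ?case using union.IH by simp
  qed
qed

text \<open>Half-lines generate the Borel sets but not the Lebesgue sets. Therefore \<open>g\<close>
  is extended by 0 and replaced by a Borel function \<open>k\<close> that equals it almost
  everywhere.\<close>

lemma AE_zero_circle:
  fixes g :: "real \<Rightarrow> real"
  assumes g: "integrable circle_measure g"
    and half: "\<And>b. circle_int (\<lambda>t. indicator {..<b} t * g t) = 0"
  shows "AE t in circle_measure. g t = 0"
proof -
  have "{0..1} \<inter> space lebesgue \<in> sets (lebesgue :: real measure)" by simp
  note restr = integrable_restrict_space[OF this] integral_restrict_space[OF this]
  let ?h = "\<lambda>t. indicator {0..1} t * g t"
  have h: "integrable lebesgue ?h" using g by (simp add: restr)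
  then have "?h \<in> borel_measurable (completion lborel)" by (rule borel_measurable_integrable)
  from completion_ex_borel_measurable_real[OF this] obtain k where
    k: "k \<in> borel_measurable lborel" "AE t in lborel. ?h t = k t" by blast
  have kA: "AE t in lebesgue. k t = ?h t" using k(2) by (intro AE_completion) (auto elim: eventually_mono)
  have km: "k \<in> borel_measurable (completion lborel)"
    using k(1) by (rule measurable_completion)
  have hm: "?h \<in> borel_measurable (completion lborel)" by (rule borel_measurable_integrable[OF h])
  have "integrable lebesgue k" using h km kA by (subst integrable_cong_AE[OF km hm]) auto
  then have ki: "integrable lborel k" using integrable_completion[OF k(1)] by simp
  have kb: "set_lebesgue_integral lborel {..<b} k = 0" for b
  proof -
    have "set_lebesgue_integral lborel {..<b} k = (LINT t|lebesgue. indicator {..<b} t *\<^sub>R k t)"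
      unfolding set_lebesgue_integral_def using k(1)
      by (intro integral_completion[symmetric]) simp
    also have "\<dots> = (LINT t|lebesgue. indicator {..<b} t * ?h t)"
    proof (rule integral_cong_AE)
      have im: "(indicator {..<b} :: real \<Rightarrow> real) \<in> borel_measurable lebesgue"
        by (intro borel_measurable_indicator) simp
      show "(\<lambda>t. indicator {..<b} t *\<^sub>R k t) \<in> borel_measurable lebesgue"
        by (intro borel_measurable_scaleR im km)
      show "(\<lambda>t. indicator {..<b} t * ?h t) \<in> borel_measurable lebesgue"
        by (intro borel_measurable_times[OF im hm])
      show "AE t in lebesgue. indicator {..<b} t *\<^sub>R k t = indicator {..<b} t * ?h t"
        using kA by eventually_elim simp
    qed
    also have "\<dots> = circle_int (\<lambda>t. indicator {..<b} t * g t)"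
      by (simp add: restr mult.left_commute)
    finally show ?thesis using half by simp
  qed
  have "integral\<^sup>L lborel k = integral\<^sup>L lebesgue k" using integral_completion[OF k(1)] by simp
  also have "\<dots> = integral\<^sup>L lebesgue ?h" using km hm kA by (rule integral_cong_AE)
  also have "\<dots> = circle_int g" by (simp add: restr)
  \<comment> \<open>The half-line \<open>{..<2}\<close> contains \<open>[0, 1]\<close>, so the total
    integral is a case of \<open>half\<close>.\<close>
  also have "\<dots> = circle_int (\<lambda>t. indicator {..<2} t * g t)"
    by (rule Bochner_Integration.integral_cong) (auto simp: space_restrict_space)
  finally have "integral\<^sup>L lborel k = 0" using half by simp
  from AE_zero_lborel[OF ki this kb] have "AE t in lborel. k t = 0" .
  then have "AE t in lborel. ?h t = 0" using k(2) by eventually_elim simp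
  then have "AE t in lebesgue. ?h t = 0" by (rule AE_completion)
  then have "AE t in lebesgue. t \<in> {0..1} \<longrightarrow> g t = 0" by eventually_elim auto
  then show ?thesis by (subst AE_restrict_space_iff) auto
qed

lemma has_derivative_max_square:
  "((\<lambda>y. (max 0 y)\<^sup>2) has_real_derivative 2 * max 0 y) (at (y::real))"
proof (cases y "0::real" rule: linorder_cases)
  case less
  have "((\<lambda>y::real. 0 :: real) has_real_derivative 2 * max 0 y) (at y)" using less by simp
  then show ?thesis
    by (rule has_field_derivative_transform_within_open[of _ _ _ "{..<0}"]) (use less in auto)
next
  case greater
  then have "((\<lambda>y. y\<^sup>2) has_real_derivative 2 * max 0 y) (at y)"
    by (auto intro!: derivative_eq_intros)
  then show ?thesis
    by (rule has_field_derivative_transform_within_open[of _ _ _ "{0<..}"]) (use greater in auto)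
next
  case equal
  have "(\<lambda>h::real. max 0 h) \<midarrow>0\<rightarrow> max 0 0" by (intro tendsto_intros)
  moreover have "((max 0 (0 + h))\<^sup>2 - (max 0 0)\<^sup>2) / h = max 0 h" for h :: real
    by (cases "h \<le> 0") (simp_all add: max_def power2_eq_square)
  ultimately have "((\<lambda>y. (max 0 y)\<^sup>2) has_real_derivative max 0 0) (at (0::real))"
    unfolding DERIV_def by (simp only:)
  then show ?thesis using equal by simp
qed

lemma C1_bump_sequence:
  assumes b: "0 < b" "b \<le> 1"
  shows "\<exists>\<eta>. (\<forall>n. \<eta> n \<in> C1) \<and> (\<forall>n t. \<bar>\<eta> n t\<bar> \<le> 1) \<and>
    (\<forall>t\<in>{0..1}. (\<lambda>n. \<eta> n t) \<longlonglongrightarrow> indicator {0<..<b} t)"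
proof -
  \<comment> \<open>Both factors change sign under \<open>t \<mapsto> t + 1\<close>, and on \<open>[0, 1]\<close> the product is positive
    exactly on \<open>(0, b)\<close>.\<close>
  define p where "p t = sin (pi * t) * sin (pi * (b - t))" for t
  define p' where "p' t = pi * cos (pi * t) * sin (pi * (b - t)) - pi * sin (pi * t) * cos (pi * (b - t))" for t
  have p: "(p has_real_derivative p' t) (at t)" for t
    unfolding p_def[abs_def] p'_def by (auto intro!: derivative_eq_intros simp: algebra_simps)
  have pc: "continuous_on UNIV p" "continuous_on UNIV p'"
    unfolding p_def[abs_def] p'_def[abs_def] by (intro continuous_intros)+
  have per: "p (t + 1) = p t" for t
  proof -
    have "sin (pi * (t + 1)) = - sin (pi * t)" by (simp add: distrib_left)
    moreover have "sin (pi * (b - (t + 1))) = - sin (pi * (b - t))"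
      using sin_periodic_pi[of "pi * (b - (t + 1))"] by (simp add: algebra_simps)
    ultimately show ?thesis by (simp add: p_def)
  qed
  have sgn: "0 < p t \<longleftrightarrow> t \<in> {0<..<b}" if t: "t \<in> {0..1}" for t
  proof
    assume t': "t \<in> {0<..<b}"
    have "0 < sin (pi * t)" using t t' b by (intro sin_gt_zero) (auto simp: mult_less_cancel_left1)
    moreover have "0 < sin (pi * (b - t))" using t t' b by (intro sin_gt_zero) (auto simp: mult_less_cancel_left1)
    ultimately show "0 < p t" by (simp add: p_def)
  next
    assume pos: "0 < p t"
    have 1: "0 \<le> sin (pi * t)" using t by (intro sin_ge_zero) (auto simp: mult_le_cancel_left1)
    have "t \<noteq> 0" using pos by (auto simp: p_def)
    moreover have "t < b"
    proof (rule ccontr)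
      assume "\<not> t < b"
      then have "0 \<le> sin (pi * (t - b))"
        using t b by (intro sin_ge_zero) (auto simp: mult_le_cancel_left1)
      moreover have "sin (pi * (b - t)) = - sin (pi * (t - b))"
        by (simp add: right_diff_distrib flip: sin_minus)
      ultimately show False
        using pos mult_nonneg_nonneg[OF 1, of "sin (pi * (t - b))"] by (simp add: p_def)
    qed
    ultimately show "t \<in> {0<..<b}" using t by auto
  qed
  define m where "m t = (max 0 (p t))\<^sup>2" for t
  have m: "(m has_real_derivative 2 * max 0 (p t) * p' t) (at t)" for t
    unfolding m_def[abs_def] by (rule DERIV_chain2[OF has_derivative_max_square p])
  have mc: "continuous_on UNIV m" by (rule DERIV_continuous_on) (rule m)
  have m0: "0 \<le> m t" for t by (simp add: m_def)
  \<comment> \<open>\<open>\<eta> n = n m / (1 + n m)\<close> lies in \<open>[0, 1)\<close>, is 0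
    where \<open>m\<close> is 0 and tends to 1 elsewhere. Squaring the positive part of
    \<open>p\<close> is what makes \<open>m\<close> continuously differentiable.\<close>
  define \<eta> where "\<eta> n t = 1 - inverse (1 + real n * m t)" for n t
  have pos: "0 < 1 + real n * m t" for n t using m0[of t] by (simp add: add_pos_nonneg)
  have "\<eta> n \<in> C1" for n
  proof (rule C1I)
    show "periodic (\<eta> n)" by (simp add: periodic_def \<eta>_def m_def per)
    have "((\<lambda>t. 1 + real n * m t) has_real_derivative real n * (2 * max 0 (p t) * p' t)) (at t)" for t
      using DERIV_add[OF DERIV_const[of 1] DERIV_cmult[OF m]] by simp
    from DERIV_diff[OF DERIV_const[of 1] DERIV_inverse'[OF this]]
    show "(\<eta> n has_real_derivative
        inverse (1 + real n * m t) * (real n * (2 * max 0 (p t) * p' t)) * inverse (1 + real n * m t)) (at t)" for t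
      using pos[of n t] by (simp add: \<eta>_def[abs_def])
    have "1 + real n * m t \<noteq> 0" for t using pos[of n t] by linarith
    then show "continuous_on UNIV (\<lambda>t. inverse (1 + real n * m t) * (real n * (2 * max 0 (p t) * p' t)) * inverse (1 + real n * m t))"
      by (intro continuous_intros mc pc ballI)
  qed
  moreover have "\<bar>\<eta> n t\<bar> \<le> 1" for n t
  proof -
    have "inverse (1 + real n * m t) \<le> 1" using m0[of t] by (simp add: inverse_le_1_iff)
    moreover have "0 < inverse (1 + real n * m t)" using pos[of n t] by simp
    ultimately show ?thesis by (simp add: \<eta>_def)
  qed
  moreover have "(\<lambda>n. \<eta> n t) \<longlonglongrightarrow> indicator {0<..<b} t" if t: "t \<in> {0..1}" for t
  proof (cases "0 < p t")
    case True
    then have "0 < m t" by (simp add: m_def)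
    have "filterlim (\<lambda>n. 1 + real n * m t) at_infinity sequentially"
      using \<open>0 < m t\<close>
      by (intro filterlim_at_top_imp_at_infinity filterlim_tendsto_add_at_top[OF tendsto_const]
          filterlim_at_top_mult_tendsto_pos[OF tendsto_const] filterlim_real_sequentially) auto
    then have "(\<lambda>n. inverse (1 + real n * m t)) \<longlonglongrightarrow> 0"
      by (rule tendsto_inverse_0[THEN filterlim_compose])
    from tendsto_diff[OF tendsto_const[of 1] this] show ?thesis
      using True sgn[OF t] by (simp add: \<eta>_def)
  next
    case False
    then have "m t = 0" by (simp add: m_def)
    then show ?thesis using False sgn[OF t] by (simp add: \<eta>_def)
  qed
  ultimately show ?thesis by blast
qed

text \<open>Indicators of \<open>{0<..<b}\<close> are bounded pointwise limits of C1 functions on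
  \<open>[0, 1]\<close>, so dominated convergence extends the orthogonality to them. For
  \<open>b > 1\<close> the constant test function 1 takes their place.\<close>

lemma C1_orthogonal_AE_zero:
  assumes g: "g \<in> L2" and orth: "\<And>\<eta>. \<eta> \<in> C1 \<Longrightarrow> circle_int (\<lambda>t. g t * \<eta> t) = 0"
  shows "AE t in circle_measure. g t = 0"
proof (rule AE_zero_circle)
  show gi: "integrable circle_measure g" using g by (rule L2_integrable)
  have gm: "g \<in> borel_measurable circle_measure" using g by (simp add: L2_def)
  fix b :: real
  consider "b \<le> 0" | "0 < b" "b \<le> 1" | "1 < b" by linarith
  then show "circle_int (\<lambda>t. indicator {..<b} t * g t) = 0"
  proof cases
    case 1
    then have "circle_int (\<lambda>t. indicator {..<b} t * g t) = circle_int (\<lambda>t. 0)"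
      by (intro Bochner_Integration.integral_cong refl) (simp add: space_restrict_space)
    then show ?thesis by simp
  next
    case 2
    obtain \<eta> where e: "\<forall>n. \<eta> n \<in> C1" "\<forall>n t. \<bar>\<eta> n t\<bar> \<le> 1"
      "\<forall>t\<in>{0..1}. (\<lambda>n. \<eta> n t) \<longlonglongrightarrow> indicator {0<..<b} t"
      using C1_bump_sequence[OF 2] by blast
    have em: "\<eta> n \<in> borel_measurable circle_measure" for n
      by (rule borel_measurable_integrable[OF continuous_circle_integrable(1)[OF C1_continuous_on]])
        (use e(1) in blast)
    have im: "(indicator {0<..<b} :: real \<Rightarrow> real) \<in> borel_measurable circle_measure"
      by (intro measurable_restrict_space1 borel_measurable_indicator) simp
    have "(\<lambda>n. circle_int (\<lambda>t. g t * \<eta> n t)) \<longlonglongrightarrow> circle_int (\<lambda>t. g t * indicator {0<..<b} t)"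
    proof (rule integral_dominated_convergence[where w = "\<lambda>t. norm (g t)"])
      show "(\<lambda>t. g t * indicator {0<..<b} t) \<in> borel_measurable circle_measure"
        by (intro borel_measurable_times gm im)
      show "(\<lambda>t. g t * \<eta> n t) \<in> borel_measurable circle_measure" for n
        by (intro borel_measurable_times gm em)
      show "integrable circle_measure (\<lambda>t. norm (g t))" using gi by (rule integrable_norm)
      show "AE t in circle_measure. (\<lambda>n. g t * \<eta> n t) \<longlonglongrightarrow> g t * indicator {0<..<b} t"
        by (intro AE_I2 tendsto_mult tendsto_const bspec[OF e(3)]) (simp add: space_restrict_space)
      show "AE t in circle_measure. norm (g t * \<eta> n t) \<le> norm (g t)" for n
      proof (rule AE_I2)
        fix t
        have "\<bar>g t\<bar> * \<bar>\<eta> n t\<bar> \<le> \<bar>g t\<bar>" by (rule mult_left_le) (use e(2) in auto)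
        then show "norm (g t * \<eta> n t) \<le> norm (g t)" by (simp add: abs_mult)
      qed
    qed
    moreover have "circle_int (\<lambda>t. g t * \<eta> n t) = 0" for n
      by (rule orth) (use e(1) in blast)
    ultimately have "(\<lambda>n. 0) \<longlonglongrightarrow> circle_int (\<lambda>t. g t * indicator {0<..<b} t)"
      by (simp only:)
    from LIMSEQ_unique[OF this tendsto_const] have "circle_int (\<lambda>t. g t * indicator {0<..<b} t) = 0" .
    moreover have "circle_int (\<lambda>t. indicator {..<b} t * g t) = circle_int (\<lambda>t. g t * indicator {0<..<b} t)"
    proof (rule integral_cong_AE)
      show "(\<lambda>t. indicator {..<b} t * g t) \<in> borel_measurable circle_measure"
        by (intro borel_measurable_times gm measurable_restrict_space1 borel_measurable_indicator) simp
      show "(\<lambda>t. g t * indicator {0<..<b} t) \<in> borel_measurable circle_measure"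
        by (intro borel_measurable_times gm im)
      \<comment> \<open>On \<open>[0, 1]\<close> the indicators of \<open>{..<b}\<close> and
        \<open>{0<..<b}\<close> differ at 0 only.\<close>
      have "AE t in lborel. t \<noteq> (0::real)" by (rule AE_lborel_singleton)
      then have "AE t in lebesgue. t \<noteq> (0::real)" by (rule AE_completion)
      then have "AE t in circle_measure. t \<noteq> 0" by (subst AE_restrict_space_iff) (auto elim: eventually_mono)
      then show "AE t in circle_measure. indicator {..<b} t * g t = g t * indicator {0<..<b} t"
        using AE_space[of circle_measure]
        by eventually_elim (auto simp: space_restrict_space indicator_def)
    qed
    ultimately show ?thesis by simp
  next
    case 3
    then have "circle_int (\<lambda>t. indicator {..<b} t * g t) = circle_int (\<lambda>t. g t * 1)"
      by (intro Bochner_Integration.integral_cong refl) (simp add: space_restrict_space)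
    also have "\<dots> = 0" by (rule orth[OF C1_const])
    finally show ?thesis .
  qed
qed

section \<open>Uniqueness for the operator\<close>

lemma C1_antiderivative:
  assumes g: "continuous_on UNIV g" "\<And>t. g (t + 1) = g t" "circle_int g = 0"
  shows "\<exists>G\<in>C1. deriv G = g"
proof -
  obtain G where "\<forall>x. (G has_real_derivative g x) (at x)"
    using continuous_has_antiderivative[OF g(1)] by (rule exE)
  then have G: "(G has_real_derivative g x) (at x)" for x by (rule spec)
  have "continuous_on {0..1} g" using g(1) by (rule continuous_on_subset) simp
  then have "integral {0..1} g = 0" using g(3) continuous_circle_integrable(2)[of g] by simp
  then have "periodic G" using antiderivative_shift[OF G g(2)] unfolding periodic_def by simp
  from C1I[OF this G g(1)] show ?thesis by blast
qed

lemma integral_square_eq_0: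
  fixes z :: "real \<Rightarrow> real"
  assumes "continuous_on {0..1} z" "integral {0..1} (\<lambda>t. (z t)\<^sup>2) = 0" "t \<in> {0..1}"
  shows "z t = 0"
proof -
  have "continuous_on {0..1} (\<lambda>t. (z t)\<^sup>2)" using assms(1) by (intro continuous_intros)
  from integral_eq_0_iff[OF this] assms show ?thesis by simp
qed

text \<open>The argument of du Bois-Reymond: if \<open>A' = g\<close>, then \<open>z = u - A\<close>
  is orthogonal to the derivatives of all test functions. A test function with derivative
  \<open>z - c\<close>, where \<open>c\<close> is the average of \<open>z\<close>, shows that the
  integral of \<open>(z - c)^2\<close> is zero.\<close>

lemma weak_deriv_imp_C1:
  assumes u: "continuous_on UNIV u" "\<And>t. u (t + 1) = u t"
    and g: "continuous_on UNIV g" "\<And>t. g (t + 1) = g t" and w: "weak_deriv u g"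
  shows "u \<in> C1" "deriv u = g"
proof -
  \<comment> \<open>Testing against the constant 1 shows that \<open>g\<close> has average 0, so
    that its antiderivative is periodic.\<close>
  have "circle_int (\<lambda>t. u t * deriv (\<lambda>t. 1) t) = - circle_int (\<lambda>t. g t * 1)"
    using w C1_const[of 1] unfolding weak_deriv_def by (rule bspec)
  then have "circle_int g = 0" by simp
  then obtain A where A: "A \<in> C1" "deriv A = g" using C1_antiderivative[OF g] by blast
  define z where "z t = u t - A t" for t
  define c where "c = circle_int z"
  have zc: "continuous_on B z" for B
    unfolding z_def by (intro continuous_intros C1_continuous_on A continuous_on_subset[OF u(1)]) simp
  have zp: "z (t + 1) = z t" for t by (simp add: z_def u(2) C1_periodic[OF A(1)])
  have zcc: "continuous_on B (\<lambda>t. z t - c)" for B by (intro continuous_intros zc)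
  have "circle_int (\<lambda>t. z t - c) = integral {0..1} (\<lambda>t. z t - c)"
    by (rule continuous_circle_integrable(2)[OF zcc])
  also have "\<dots> = integral {0..1} z - c"
    by (subst Henstock_Kurzweil_Integration.integral_diff) (auto intro: integrable_continuous_real[OF zc])
  also have "\<dots> = 0" by (simp add: c_def continuous_circle_integrable(2)[OF zc])
  finally have avg: "circle_int (\<lambda>t. z t - c) = 0" .
  obtain \<eta> where e: "\<eta> \<in> C1" "deriv \<eta> = (\<lambda>t. z t - c)"
    using C1_antiderivative[OF zcc _ avg] zp by auto
  have ug: "circle_int (\<lambda>t. u t * (z t - c)) = - circle_int (\<lambda>t. g t * \<eta> t)"
    using bspec[OF w[unfolded weak_deriv_def] e(1)] by (simp add: e(2))
  have Ag: "circle_int (\<lambda>t. A t * (z t - c)) = - circle_int (\<lambda>t. g t * \<eta> t)"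
    using bspec[OF C1_weak_deriv[OF A(1), unfolded weak_deriv_def] e(1)] by (simp add: e(2) A(2))
  have uc: "continuous_on {0..1} u" using u(1) by (rule continuous_on_subset) simp
  have i: "integrable circle_measure (\<lambda>t. u t * (z t - c))" "integrable circle_measure (\<lambda>t. A t * (z t - c))"
    "integrable circle_measure (\<lambda>t. c * (z t - c))"
    by (intro continuous_circle_integrable continuous_intros zc uc C1_continuous_on A)+
  have "circle_int (\<lambda>t. (z t - c)\<^sup>2) =
      circle_int (\<lambda>t. u t * (z t - c) - A t * (z t - c) - c * (z t - c))"
    by (simp add: z_def power2_eq_square algebra_simps)
  also have "\<dots> = circle_int (\<lambda>t. u t * (z t - c)) - circle_int (\<lambda>t. A t * (z t - c)) - c * circle_int (\<lambda>t. z t - c)"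
    using i by simp
  finally have "circle_int (\<lambda>t. (z t - c)\<^sup>2) = 0"
    using ug Ag avg by simp
  moreover have "circle_int (\<lambda>t. (z t - c)\<^sup>2) = integral {0..1} (\<lambda>t. (z t - c)\<^sup>2)"
    by (intro continuous_circle_integrable(2) continuous_intros zc)
  ultimately have "z t - c = 0" if "t \<in> {0..1}" for t
    using integral_square_eq_0[OF zcc _ that] by simp
  then have "z (frac t) = c" for t using frac_unit[of t] by simp
  then have "z t = c" for t using periodic_frac[of z, OF zp] by simp
  then have ueq: "u = (\<lambda>t. A t + c)" by (auto simp: z_def fun_eq_iff algebra_simps)
  have "periodic u" using u(2) by (simp add: periodic_def)
  moreover have "(u has_real_derivative g t) (at t)" for t
    unfolding ueq using DERIV_add[OF C1_has_derivative[OF A(1), of t] DERIV_const[of c]] by (simp add: A(2))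
  ultimately show "u \<in> C1" "deriv u = g" using g(1) by (rule C1I)+
qed

text \<open>Let \<open>h t\<close> be the mean of \<open>f'\<close> over the segment from
  \<open>v t\<close> to \<open>u t\<close>. Then \<open>w = u - v\<close> satisfies
  \<open>w' + h w = d\<close>, and the derivative of \<open>exp H * w\<close> is
  \<open>exp H * d\<close>. Equal averages give a zero \<open>t0\<close> of \<open>w\<close>, and
  \<open>t0 + 1\<close> is another one, which forces \<open>d = 0\<close> and then
  \<open>w = 0\<close>. The constant \<open>d\<close> has to be allowed, since \<open>Psi\<close>
  determines \<open>F\<close> only up to a constant.\<close>

lemma C1_solution_unique:
  assumes f: "smooth f" and u: "u \<in> C1" "v \<in> C1"
    and eq: "\<And>t. deriv u t + f (u t) = deriv v t + f (v t) + d" and avg: "circle_int u = circle_int v"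
  shows "u = v"
proof -
  define w where "w t = u t - v t" for t
  have wD: "(w has_real_derivative deriv u t - deriv v t) (at t)" for t
    unfolding w_def[abs_def] by (rule DERIV_diff[OF C1_has_derivative[OF u(1)] C1_has_derivative[OF u(2)]])
  have uc: "continuous_on A u" "continuous_on A v" for A by (rule C1_continuous_on; fact)+
  have wc: "continuous_on A w" for A unfolding w_def by (intro continuous_intros uc)
  have wp: "w (t + 1) = w t" for t by (simp add: w_def C1_periodic u)
  define h where "h t = integral {0..1} (\<lambda>s. deriv f (v t + w t * s))" for t
  have fd: "(f has_real_derivative deriv f x) (at x)" for x using smooth_DERIV[OF f, of 0 x] by simp
  have hw: "w t * h t = f (u t) - f (v t)" for t
    using integral_segment[where g = "deriv f" and G = f and t = "v t" and s = "w t", OF fd]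
    by (simp add: h_def w_def)
  have "continuous_on (UNIV \<times> cbox 0 1) (\<lambda>(t, s). deriv f (v t + w t * s))"
  proof -
    have "continuous_on (UNIV \<times> cbox 0 1) (\<lambda>p. v (fst p) + w (fst p) * snd p)"
      by (intro continuous_intros continuous_on_compose2[OF uc(2)[of UNIV]] continuous_on_compose2[OF wc[of UNIV]]) auto
    from smooth_compose_continuous_on[OF f this, of 1] show ?thesis by (simp add: split_beta)
  qed
  from integral_continuous_on_param[OF this] have hc: "continuous_on UNIV h"
    by (simp add: h_def[abs_def])
  obtain H where "\<forall>x. (H has_real_derivative h x) (at x)"
    using continuous_has_antiderivative[OF hc] by (rule exE)
  then have H: "(H has_real_derivative h x) (at x)" for x by (rule spec)
  define E where "E t = exp (H t) * w t" for t
  have ED: "(E has_real_derivative exp (H t) * d) (at t)" for t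
  proof -
    have "(E has_real_derivative exp (H t) * (deriv u t - deriv v t) + exp (H t) * h t * w t) (at t)"
      unfolding E_def[abs_def] by (rule DERIV_mult'[OF DERIV_chain2[OF DERIV_exp H] wD])
    moreover have "exp (H t) * (deriv u t - deriv v t) + exp (H t) * h t * w t
        = exp (H t) * (deriv u t - deriv v t + w t * h t)"
      by (simp add: algebra_simps)
    moreover have "deriv u t - deriv v t + w t * h t = d" using eq[of t] hw[of t] by simp
    ultimately show ?thesis by simp
  qed
  obtain W where "\<forall>x. (W has_real_derivative w x) (at x)"
    using continuous_has_antiderivative[OF wc] by (rule exE)
  then have W: "(W has_real_derivative w x) (at x)" for x by (rule spec)
  have "integral {0..1} u = integral {0..1} v"
    using avg by (simp add: continuous_circle_integrable(2)[OF uc(1)] continuous_circle_integrable(2)[OF uc(2)])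
  then have "integral {0..1} w = 0"
    by (simp add: w_def[abs_def] integral_diff integrable_continuous_real uc)
  then have "W 1 = W 0" using integral_deriv_unit[of W w, OF W] by simp
  moreover obtain t0 where "W 1 - W 0 = (1 - 0) * w t0"
    using MVT2[of 0 1 W w] W by auto
  ultimately have t0: "w t0 = 0" by simp
  have E0: "E (t0 + 1) = 0" "E t0 = 0" using t0 wp[of t0] by (simp_all add: E_def)
  obtain s where "E (t0 + 1) - E t0 = (t0 + 1 - t0) * (exp (H s) * d)"
    using MVT2[of t0 "t0 + 1" E "\<lambda>t. exp (H t) * d"] ED by auto
  then have "d = 0" using E0 by simp
  then have "(E has_real_derivative 0) (at t)" for t using ED[of t] by simp
  then have "E t = E t0" for t using DERIV_isconst_all[of E t t0] by blast
  then have "w t = 0" for t using E0 by (simp add: E_def)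
  then show "u = v" by (auto simp: w_def)
qed

lemma D_Sobolev:
  assumes "u \<in> H1"
  shows "D Sobolev u \<in> L2" "weak_deriv u (D Sobolev u)"
  using someI_ex[of "\<lambda>g. g \<in> L2 \<and> weak_deriv u g"] assms by (auto simp: H1_def)

lemma D_integrable:
  assumes "u \<in> B1 B" shows "integrable circle_measure (D B u)"
proof (cases B)
  case Sobolev
  then show ?thesis using L2_integrable[OF D_Sobolev(1), of u] assms by (simp del: D.simps)
next
  case Classical
  then show ?thesis using assms by (auto intro: continuous_circle_integrable C1_deriv_continuous_on)
qed

text \<open>\<open>D Sobolev\<close> picks an unspecified weak derivative; this is what ties it,
  almost everywhere, to \<open>deriv\<close> on C1 functions. The difference of two weak derivatives
  is in \<open>L2\<close> and orthogonal to every C1 function.\<close>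

lemma weak_deriv_unique:
  assumes "weak_deriv u g" "weak_deriv u h" "g \<in> L2" "h \<in> L2"
  shows "AE t in circle_measure. g t = h t"
proof -
  have m: "g \<in> borel_measurable circle_measure" "h \<in> borel_measurable circle_measure"
    using assms by (auto simp: L2_def)
  have "integrable circle_measure (\<lambda>t. (g t - h t)\<^sup>2)"
  proof (rule Bochner_Integration.integrable_bound)
    show "integrable circle_measure (\<lambda>t. 2 * (g t)\<^sup>2 + 2 * (h t)\<^sup>2)"
      using assms by (auto simp: L2_def)
    show "(\<lambda>t. (g t - h t)\<^sup>2) \<in> borel_measurable circle_measure"
      using m by measurable
    have "(a - b)\<^sup>2 \<le> 2 * a\<^sup>2 + 2 * b\<^sup>2" for a b :: real
      using zero_le_power2[of "a + b"] by (simp add: power2_sum power2_diff)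
    then show "AE t in circle_measure. norm ((g t - h t)\<^sup>2) \<le> norm (2 * (g t)\<^sup>2 + 2 * (h t)\<^sup>2)"
      by (intro AE_I2) (simp add: abs_of_nonneg)
  qed
  then have "(\<lambda>t. g t - h t) \<in> L2"
    using assms m unfolding L2_def periodic_def by auto
  moreover have "circle_int (\<lambda>t. (g t - h t) * \<eta> t) = 0" if e: "\<eta> \<in> C1" for \<eta>
  proof -
    obtain M where M: "\<forall>t. \<bar>\<eta> t\<bar> \<le> M"
      using periodic_continuous_bounded[OF C1_continuous_on[OF e] C1_periodic[OF e]] by blast
    have em: "\<eta> \<in> borel_measurable circle_measure"
      by (rule borel_measurable_integrable[OF continuous_circle_integrable(1)[OF C1_continuous_on[OF e]]])
    have int: "integrable circle_measure (\<lambda>t. k t * \<eta> t)" if "k \<in> L2" for k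
    proof (rule Bochner_Integration.integrable_bound)
      show "integrable circle_measure (\<lambda>t. M * k t)" using L2_integrable[OF that] by simp
      show "(\<lambda>t. k t * \<eta> t) \<in> borel_measurable circle_measure"
        using that em by (auto simp: L2_def)
      have "\<bar>M\<bar> = M" using M abs_ge_zero[of "\<eta> 0"] by (meson abs_of_nonneg order_trans)
      then show "AE t in circle_measure. norm (k t * \<eta> t) \<le> norm (M * k t)"
        using M by (intro AE_I2) (simp add: abs_mult mult.commute mult_right_mono)
    qed
    have "circle_int (\<lambda>t. g t * \<eta> t) = circle_int (\<lambda>t. h t * \<eta> t)"
      using bspec[OF assms(1)[unfolded weak_deriv_def] e] bspec[OF assms(2)[unfolded weak_deriv_def] e] by simp
    then show ?thesis
      using int[OF assms(3)] int[OF assms(4)] by (simp add: left_diff_distrib)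
  qed
  ultimately have "AE t in circle_measure. g t - h t = 0" by (rule C1_orthogonal_AE_zero)
  then show ?thesis by simp
qed

lemma D_C1_AE:
  assumes "u \<in> C1" shows "AE t in circle_measure. D B u t = deriv u t"
proof (cases B)
  case Sobolev
  have u: "u \<in> H1" using C1_subset_B1[OF assms, of Sobolev] by simp
  have "periodic (deriv u)" using C1_deriv_periodic[OF assms] by (simp add: periodic_def)
  then have "deriv u \<in> L2" by (rule continuous_L2[OF C1_deriv_continuous_on[OF assms]])
  then show ?thesis
    using weak_deriv_unique[OF D_Sobolev(2)[OF u] C1_weak_deriv[OF assms] D_Sobolev(1)[OF u]] Sobolev by simp
qed simp

section \<open>The map \<open>Psi\<close> and the uniqueness of its preimages\<close>

lemma B0_eq_imp_AE: "B0_eq B v w \<Longrightarrow> AE t in circle_measure. v t = w t"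
  by (cases B) auto

lemma B0_eq_sym: "B0_eq B v w \<Longrightarrow> B0_eq B w v"
  by (cases B) (auto elim: eventually_mono)

lemma B0_eq_trans: "B0_eq B u v \<Longrightarrow> B0_eq B v w \<Longrightarrow> B0_eq B u w"
proof (cases B)
  case Sobolev
  assume "B0_eq B u v" "B0_eq B v w"
  then have "AE t in circle_measure. u t = v t" "AE t in circle_measure. v t = w t"
    using Sobolev by auto
  then have "AE t in circle_measure. u t = w t" by eventually_elim simp
  then show ?thesis using Sobolev by simp
qed auto

lemma F_integrable:
  assumes "smooth f" "u \<in> B1 B"
  shows "integrable circle_measure (F B f u)"
proof -
  have "continuous_on {0..1} (\<lambda>t. f (u t))"
    using smooth_compose_continuous_on[OF assms(1) B1_continuous_on[OF assms(2)], where n = 0] by simp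
  from continuous_circle_integrable(1)[OF this] D_integrable[OF assms(2)] show ?thesis
    unfolding F_def by (rule Bochner_Integration.integrable_add[rotated])
qed

lemma circle_int_add_const:
  fixes g :: "real \<Rightarrow> real"
  assumes "integrable circle_measure g"
  shows "circle_int (\<lambda>t. g t + c) = circle_int g + c"
proof -
  have "integrable circle_measure (\<lambda>t. c)"
    by (rule continuous_circle_integrable) simp
  with assms have "circle_int (\<lambda>t. g t + c) = circle_int g + circle_int (\<lambda>t. c)"
    by (rule Bochner_Integration.integral_add)
  then show ?thesis by (simp only: circle_int_const)
qed

lemma circle_int_Psi:
  assumes "smooth f" "u \<in> B1 B"
  shows "circle_int (Psi B f u) = circle_int u"
proof -
  have "circle_int (\<lambda>t. F B f u t + (circle_int u - circle_int (F B f u))) = circle_int u"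
    by (subst circle_int_add_const[OF F_integrable[OF assms]]) simp
  then show ?thesis by (simp add: Psi_def[abs_def] algebra_simps)
qed

lemma F_C1_eq:
  assumes "u \<in> C1"
  shows "B0_eq B (F B f u) (\<lambda>t. deriv u t + f (u t))"
proof (cases B)
  case Sobolev
  have "AE t in circle_measure. F Sobolev f u t = deriv u t + f (u t)"
    using D_C1_AE[OF assms, of Sobolev] unfolding F_def by eventually_elim simp
  then show ?thesis using Sobolev by simp
qed (simp add: F_def)

lemma circle_int_F_C1:
  assumes "smooth f" "u \<in> C1"
  shows "circle_int (F B f u) = circle_int (\<lambda>t. deriv u t + f (u t))"
proof (rule integral_cong_AE)
  have c: "continuous_on {0..1} (\<lambda>t. f (u t))"
    using smooth_compose_continuous_on[OF assms(1) C1_continuous_on[OF assms(2)], where n = 0] by simp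
  show "F B f u \<in> borel_measurable circle_measure"
    by (rule borel_measurable_integrable[OF F_integrable[OF assms(1) C1_subset_B1[OF assms(2)]]])
  show "(\<lambda>t. deriv u t + f (u t)) \<in> borel_measurable circle_measure"
    by (intro borel_measurable_integrable continuous_circle_integrable continuous_intros C1_deriv_continuous_on assms c)
qed (rule B0_eq_imp_AE[OF F_C1_eq[OF assms(2)]])

lemma Psi_C1_eq:
  assumes "smooth f" "u \<in> C1"
  shows "B0_eq B (Psi B f u)
    (\<lambda>t. deriv u t + f (u t) - circle_int (\<lambda>t. deriv u t + f (u t)) + circle_int u)"
proof (cases B)
  case Sobolev
  have "AE t in circle_measure. Psi Sobolev f u t =
      deriv u t + f (u t) - circle_int (\<lambda>t. deriv u t + f (u t)) + circle_int u"
    using B0_eq_imp_AE[OF F_C1_eq[OF assms(2), of Sobolev f]]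
    unfolding Psi_def circle_int_F_C1[OF assms] by eventually_elim simp
  then show ?thesis using Sobolev by simp
qed (simp add: Psi_def circle_int_F_C1[OF assms] F_def)

text \<open>Comparison with a C1 function is enough, because every preimage that occurs is exhibited
  as a C1 function. In the Sobolev case the equation expresses the weak derivative of
  \<open>u\<close> almost everywhere by the continuous function \<open>g\<close>, so
  \<open>u\<close> is C1 as well and the classical argument applies.\<close>

lemma Psi_unique:
  assumes f: "smooth f" and u: "u \<in> B1 B" and v: "v \<in> C1"
    and eq: "B0_eq B (Psi B f u) (Psi B f v)"
  shows "u = v"
proof -
  have vB: "v \<in> B1 B" by (rule C1_subset_B1[OF v])
  have "circle_int (Psi B f u) = circle_int (Psi B f v)"
  proof (rule integral_cong_AE)
    have m: "Psi B f w \<in> borel_measurable circle_measure" if "w \<in> B1 B" for w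
      unfolding Psi_def
      by (intro borel_measurable_add borel_measurable_diff borel_measurable_const
          borel_measurable_integrable F_integrable f that)
    show "Psi B f u \<in> borel_measurable circle_measure" "Psi B f v \<in> borel_measurable circle_measure"
      by (rule m[OF u], rule m[OF vB])
  qed (rule B0_eq_imp_AE[OF eq])
  then have avg: "circle_int u = circle_int v" by (simp only: circle_int_Psi[OF f u] circle_int_Psi[OF f vB])
  \<comment> \<open>The averages subtracted in \<open>Psi\<close> are not known to agree;
    \<open>d\<close> is their difference, which \<open>C1_solution_unique\<close> tolerates.\<close>
  define d where "d = circle_int (F B f u) - circle_int (F B f v)"
  have "u \<in> C1 \<and> (\<forall>t. deriv u t + f (u t) = deriv v t + f (v t) + d)"
  proof (cases B)
    case Classical
    then have "Psi B f u t = Psi B f v t" for t using eq by simp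
    then show ?thesis using u Classical avg by (auto simp: Psi_def F_def d_def algebra_simps)
  next
    case Sobolev
    have uH: "u \<in> H1" using u Sobolev by simp
    note Du = D_Sobolev[OF uH]
    define g where "g t = deriv v t + f (v t) + d - f (u t)" for t
    have "AE t in circle_measure. D Sobolev u t = g t"
      using B0_eq_imp_AE[OF eq] D_C1_AE[OF v, of B] unfolding Psi_def F_def[of _ _ u] F_def[of _ _ v] avg
      by eventually_elim (simp add: g_def d_def Sobolev F_def[abs_def] algebra_simps)
    then have ae: "AE t in circle_measure. D Sobolev u t = g t" .
    have fc: "continuous_on UNIV (\<lambda>t. f (w t))" if "w \<in> B1 B" for w
      using smooth_compose_continuous_on[OF f B1_continuous_on[OF that], where n = 0] by simp
    have gc: "continuous_on UNIV g"
      unfolding g_def[abs_def] by (intro continuous_intros C1_deriv_continuous_on v fc u vB)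
    have gp: "g (t + 1) = g t" for t
      by (simp add: g_def C1_deriv_periodic[OF v] C1_periodic[OF v] B1_periodic[OF u])
    have gm: "g \<in> borel_measurable circle_measure"
      by (intro borel_measurable_integrable continuous_circle_integrable continuous_on_subset[OF gc]) simp
    have "weak_deriv u g"
      unfolding weak_deriv_def
    proof
      fix \<eta> assume e: "\<eta> \<in> C1"
      have em: "\<eta> \<in> borel_measurable circle_measure"
        by (rule borel_measurable_integrable[OF continuous_circle_integrable(1)[OF C1_continuous_on[OF e]]])
      have "circle_int (\<lambda>t. D Sobolev u t * \<eta> t) = circle_int (\<lambda>t. g t * \<eta> t)"
      proof (rule integral_cong_AE)
        show "(\<lambda>t. D Sobolev u t * \<eta> t) \<in> borel_measurable circle_measure"
          by (intro borel_measurable_times em borel_measurable_integrable[OF L2_integrable[OF Du(1)]])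
        show "(\<lambda>t. g t * \<eta> t) \<in> borel_measurable circle_measure"
          by (intro borel_measurable_times em gm)
        show "AE t in circle_measure. D Sobolev u t * \<eta> t = g t * \<eta> t"
          using ae by eventually_elim simp
      qed
      then show "circle_int (\<lambda>t. u t * deriv \<eta> t) = - circle_int (\<lambda>t. g t * \<eta> t)"
        using bspec[OF Du(2)[unfolded weak_deriv_def] e] by simp
    qed
    from weak_deriv_imp_C1[OF B1_continuous_on[OF u] B1_periodic[OF u] gc gp this]
    show ?thesis by (simp add: g_def)
  qed
  then show "u = v" using C1_solution_unique[OF f _ v _ avg] by blast
qed

text \<open>Subtracting averages removes the constant \<open>c x\<close>, and the average of
  \<open>u x\<close> contributes \<open>x\<close>, so \<open>Psi\<close> maps \<open>u x\<close> to
  \<open>Psi B f (u 0) + x\<close> up to \<open>B0_eq\<close>. Uniqueness then evaluates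
  \<open>Psi_inv\<close> along this line.\<close>

lemma phi_along_curve:
  assumes f: "smooth f" and J: "0 \<in> J" and u: "\<And>x. x \<in> J \<Longrightarrow> u x \<in> C1"
    and eq: "\<And>x t. x \<in> J \<Longrightarrow> deriv (u x) t + f (u x t) = deriv (u 0) t + f (u 0 t) + c x"
    and avg: "\<And>x. x \<in> J \<Longrightarrow> circle_int (u x) = circle_int (u 0) + x"
    and x: "x \<in> J"
  shows "phi B f (tilde (Psi B f (u 0))) (circle_int (Psi B f (u 0)) + x) = circle_int (\<lambda>t. deriv (u 0) t + f (u 0 t)) + c x"
proof -
  let ?g = "\<lambda>t. deriv (u 0) t + f (u 0 t)"
  let ?v = "\<lambda>t. tilde (Psi B f (u 0)) t + (circle_int (Psi B f (u 0)) + x)"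
  have u0: "u 0 \<in> C1" by (rule u[OF J])
  have ux: "u x \<in> C1" by (rule u[OF x])
  have "continuous_on {0..1} (\<lambda>t. f (u 0 t))"
    using smooth_compose_continuous_on[OF f C1_continuous_on[OF u0], where n = 0] by simp
  then have gi: "integrable circle_measure ?g"
    by (intro continuous_circle_integrable continuous_intros C1_deriv_continuous_on u0)
  have gx: "circle_int (\<lambda>t. deriv (u x) t + f (u x t)) = circle_int ?g + c x"
    unfolding eq[OF x] by (rule circle_int_add_const[OF gi])
  have "B0_eq B (Psi B f (u x)) (\<lambda>t. Psi B f (u 0) t + x)"
  proof (cases B)
    case Classical
    then show ?thesis
      using eq[OF x] avg[OF x] circle_int_add_const[OF gi, of "c x"]
      by (simp add: Psi_def circle_int_F_C1[OF f u0] circle_int_F_C1[OF f ux] F_def fun_eq_iff)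
  next
    case Sobolev
    have "AE t in circle_measure. Psi B f (u x) t = Psi B f (u 0) t + x"
      using B0_eq_imp_AE[OF Psi_C1_eq[OF f u0, of B]] B0_eq_imp_AE[OF Psi_C1_eq[OF f ux, of B]]
      unfolding avg[OF x] eq[OF x] circle_int_add_const[OF gi] by eventually_elim simp
    then show ?thesis using Sobolev by simp
  qed
  moreover have "?v = (\<lambda>t. Psi B f (u 0) t + x)"
    by (simp add: tilde_def)
  ultimately have 1: "B0_eq B (Psi B f (u x)) ?v"
    by simp
  have "Psi_inv B f ?v = u x"
    unfolding Psi_inv_def
  proof (rule the_equality)
    show "u x \<in> B1 B \<and> B0_eq B (Psi B f (u x)) ?v"
      using 1 C1_subset_B1[OF ux] by blast
  next
    fix v assume v: "v \<in> B1 B \<and> B0_eq B (Psi B f v) ?v"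
    then show "v = u x"
      using B0_eq_trans[OF _ B0_eq_sym[OF 1]] by (intro Psi_unique[OF f _ ux]) blast+
  qed
  then show ?thesis
    by (simp only: phi_def circle_int_F_C1[OF f ux] gx)
qed

section \<open>Convex hulls and densities\<close>

text \<open>Without interior points \<open>K\<close> lies in a hyperplane, and \<open>a\<close> or
  \<open>- a\<close> is chosen by the sign of its offset. Otherwise 0 is separated from the
  interior, and \<open>K\<close> lies in the closure of its interior.\<close>

lemma not_interior_supporting:
  fixes K :: "'a::euclidean_space set"
  assumes K: "convex K" "0 \<notin> interior K"
  shows "\<exists>a. a \<noteq> 0 \<and> (\<forall>y\<in>K. 0 \<le> a \<bullet> y)"
proof (cases "interior K = {}")
  case True
  obtain a b where ab: "a \<noteq> 0" "K \<subseteq> {x. a \<bullet> x = b}"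
    using empty_interior_subset_hyperplane[OF K(1) True] by blast
  show ?thesis
  proof (cases "0 \<le> b")
    case True
    then show ?thesis using ab by (intro exI[of _ a]) auto
  next
    case False
    then show ?thesis using ab by (intro exI[of _ "- a"]) auto
  qed
next
  case False
  obtain a where a: "a \<noteq> 0" "\<forall>x\<in>interior K. 0 \<le> a \<bullet> x"
    using separating_hyperplane_set_0[OF convex_interior[OF K(1)] K(2)] by blast
  have "closure (interior K) \<subseteq> {x. 0 \<le> a \<bullet> x}"
    using a(2) by (intro closure_minimal closed_Collect_le continuous_intros) auto
  then have "K \<subseteq> {x. 0 \<le> a \<bullet> x}"
    using convex_closure_interior[OF K(1) False] closure_subset[of K] by simp
  then show ?thesis using a(1) by blast
qed

lemma gamma_hat_continuous_on:
  assumes "smooth f" "continuous_on A v"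
  shows "continuous_on A (\<lambda>t. gamma_hat f (v t) :: real ^ 'k::{finite, linorder})"
  unfolding gamma_hat_def by (intro continuous_on_vec_lambda smooth_compose_continuous_on assms)

lemma integral_inner_unit:
  fixes g :: "real \<Rightarrow> 'a::euclidean_space"
  assumes "continuous_on {0..1} g"
  shows "integral {0..1} (\<lambda>t. a \<bullet> g t) = a \<bullet> integral {0..1} g"
  using integral_linear[OF integrable_continuous_real[OF assms] bounded_linear_inner_right[of a]]
  by (simp add: o_def)

lemma zero_integral_imp_interior_hull:
  fixes f v :: "real \<Rightarrow> real"
  assumes f: "smooth f" and good: "good TYPE('k::{finite, linorder}) f" and v: "continuous_on {0..1} v"
    and zero: "integral {0..1} (\<lambda>t. gamma_hat f (v t) :: real ^ 'k::{finite, linorder}) = 0"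
  shows "(0 :: real ^ 'k::{finite, linorder}) \<in> interior (convex hull (range (gamma_hat f)))"
proof (rule ccontr)
  let ?g = "gamma_hat f :: real \<Rightarrow> real ^ 'k::{finite, linorder}"
  assume "0 \<notin> interior (convex hull (range ?g))"
  then obtain a where a: "a \<noteq> 0" "\<forall>y\<in>convex hull (range ?g). 0 \<le> a \<bullet> y"
    using not_interior_supporting[OF convex_convex_hull] by blast
  have nonneg: "0 \<le> a \<bullet> ?g x" for x using a(2) by (simp add: hull_inc)
  have gc: "continuous_on {0..1} (\<lambda>t. ?g (v t))" by (rule gamma_hat_continuous_on[OF f v])
  have c: "continuous_on {0..1} (\<lambda>t. a \<bullet> ?g (v t))" by (intro continuous_intros gc)
  have "integral {0..1} (\<lambda>t. a \<bullet> ?g (v t)) = 0"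
    using integral_inner_unit[OF gc] zero by simp
  then have z: "a \<bullet> ?g (v t) = 0" if "t \<in> {0..1}" for t
    using integral_eq_0_iff[OF c] nonneg that by simp
  \<comment> \<open>If \<open>v\<close> took two values, its range would contain an open interval by
    connectedness, and the curve would map that interval into the hyperplane orthogonal to
    \<open>a\<close>; goodness forbids this.\<close>
  have const: "v s = v t" if "s \<in> {0..1}" "t \<in> {0..1}" "v s \<le> v t" for s t
  proof (rule ccontr)
    assume "v s \<noteq> v t"
    then have ne: "{v s<..<v t} \<noteq> {}" using that by simp
    have "connected (v ` {0..1})" by (rule connected_continuous_image[OF v]) simp
    then have "{v s<..<v t} \<subseteq> v ` {0..1}"
      by (rule connected_contains_Ioo) (use that in auto)
    then have "?g ` {v s<..<v t} \<subseteq> {y. a \<bullet> y = 0}" using z by fastforce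
    moreover have "open {v s<..<v t}" "is_interval {v s<..<v t}"
      by (simp_all add: is_interval_oo)
    ultimately show False using good ne a(1) unfolding good_def by blast
  qed
  \<comment> \<open>There remains a constant \<open>v\<close>. Its integral is a point of the curve,
    which is nonzero by the other half of goodness.\<close>
  have "v t = v 0" if "t \<in> {0..1}" for t
    using const[of t 0] const[of 0 t] that by (cases "v t \<le> v 0") simp_all
  then have "integral {0..1} (\<lambda>t. ?g (v t)) = integral {0..1} (\<lambda>t::real. ?g (v 0))"
    by (intro integral_cong arg_cong[of _ _ ?g])
  then have "?g (v 0) = 0" using zero by simp
  then show False using good unfolding good_def by blast
qed

section \<open>Integrals against positive densities\<close>

definition circle_density :: "(real \<Rightarrow> real) \<Rightarrow> bool" where
  "circle_density \<rho> \<longleftrightarrow> continuous_on UNIV \<rho> \<and> (\<forall>t. \<rho> (t + 1) = \<rho> t) \<and> (\<forall>t. 0 < \<rho> t) \<and> integral {0..1} \<rho> = 1"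

lemma continuous_on_unit: "continuous_on UNIV g \<Longrightarrow> continuous_on {0..1::real} g"
  by (rule continuous_on_subset[OF _ subset_UNIV])

lemma circle_density_normalize:
  assumes "continuous_on UNIV \<sigma>" "\<And>t. \<sigma> (t + 1) = \<sigma> t" "\<And>t. 0 < \<sigma> t"
  shows "0 < integral {0..1} \<sigma>" "circle_density (\<lambda>t. inverse (integral {0..1} \<sigma>) * \<sigma> t)"
proof -
  have "integral {0..1} \<sigma> \<noteq> 0"
    using integral_eq_0_iff[OF continuous_on_unit[OF assms(1)]] assms(3) by (metis atLeastAtMost_iff less_eq_real_def less_irrefl zero_le_one zero_less_one)
  moreover have "0 \<le> integral {0..1} \<sigma>"
    using integral_unit_bounds(1)[OF continuous_on_unit[OF assms(1)], of 0 "integral {0..1} \<sigma>"]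
      Henstock_Kurzweil_Integration.integral_nonneg[OF integrable_continuous_real[OF continuous_on_unit[OF assms(1)]]] assms(3)
    by (simp add: less_imp_le)
  ultimately show pos: "0 < integral {0..1} \<sigma>" by simp
  show "circle_density (\<lambda>t. inverse (integral {0..1} \<sigma>) * \<sigma> t)"
    unfolding circle_density_def
  proof (intro conjI allI)
    show "continuous_on UNIV (\<lambda>t. inverse (integral {0..1} \<sigma>) * \<sigma> t)"
      by (intro continuous_intros assms(1))
    show "integral {0..1} (\<lambda>t. inverse (integral {0..1} \<sigma>) * \<sigma> t) = 1"
      by (subst integral_mult_right) (use pos in simp)
  qed (use pos assms in auto)
qed

text \<open>Test against the densities proportional to \<open>max 0 (- g) + e\<close> for small \<open>e > 0\<close>.\<close>

lemma nonneg_if_nonneg_against_densities: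
  fixes g :: "real \<Rightarrow> real"
  assumes g: "continuous_on UNIV g" "\<And>t. g (t + 1) = g t"
    and pos: "\<And>\<rho>. circle_density \<rho> \<Longrightarrow> 0 \<le> integral {0..1} (\<lambda>t. g t * \<rho> t)"
  shows "0 \<le> g s"
proof -
  define n where "n t = max 0 (- g t)" for t
  have nc: "continuous_on UNIV n" unfolding n_def by (intro continuous_intros g)
  have nc': "continuous_on {0..1} (\<lambda>t. (n t)\<^sup>2)" by (intro continuous_intros continuous_on_unit nc)
  have gc': "continuous_on {0..1} g" by (rule continuous_on_unit[OF g(1)])
  have key: "integral {0..1} (\<lambda>t. (n t)\<^sup>2) \<le> e * integral {0..1} g" if e: "0 < e" for e
  proof -
    define \<sigma> where "\<sigma> t = n t + e" for t
    have s: "continuous_on UNIV \<sigma>" "\<sigma> (t + 1) = \<sigma> t" "0 < \<sigma> t" for t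
      using e unfolding \<sigma>_def by (intro continuous_intros nc, simp_all add: n_def g(2) add_nonneg_pos)
    note \<sigma> = circle_density_normalize[OF s]
    have "0 \<le> integral {0..1} (\<lambda>t. g t * (inverse (integral {0..1} \<sigma>) * \<sigma> t))" by (rule pos[OF \<sigma>(2)])
    also have "(\<lambda>t. g t * (inverse (integral {0..1} \<sigma>) * \<sigma> t)) = (\<lambda>t. inverse (integral {0..1} \<sigma>) * (g t * \<sigma> t))"
      by (simp add: fun_eq_iff)
    also have "integral {0..1} \<dots> = inverse (integral {0..1} \<sigma>) * integral {0..1} (\<lambda>t. g t * \<sigma> t)"
      by (rule integral_mult_right)
    finally have "0 \<le> integral {0..1} (\<lambda>t. g t * \<sigma> t)" using \<sigma>(1) by (simp add: zero_le_mult_iff)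
    also have "(\<lambda>t. g t * \<sigma> t) = (\<lambda>t. e * g t - (n t)\<^sup>2)"
      by (auto simp: fun_eq_iff \<sigma>_def n_def max_def power2_eq_square algebra_simps)
    also have "integral {0..1} \<dots> = integral {0..1} (\<lambda>t. e * g t) - integral {0..1} (\<lambda>t. (n t)\<^sup>2)"
      by (intro Henstock_Kurzweil_Integration.integral_diff integrable_continuous_real nc' continuous_intros gc')
    also have "integral {0..1} (\<lambda>t. e * g t) = e * integral {0..1} g" by (rule integral_mult_right)
    finally show ?thesis by simp
  qed
  have "integral {0..1} (\<lambda>t. (n t)\<^sup>2) \<le> 0 + e" if e: "0 < e" for e
  proof -
    define k where "k = \<bar>integral {0..1} g\<bar>"
    have "integral {0..1} (\<lambda>t. (n t)\<^sup>2) \<le> e / (1 + k) * integral {0..1} g"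
      by (rule key) (use e in \<open>simp add: k_def add_pos_nonneg\<close>)
    also have "\<dots> \<le> e / (1 + k) * (1 + k)"
      using e by (intro mult_left_mono) (auto simp: k_def)
    also have "\<dots> = e" by (simp add: k_def add_pos_nonneg[THEN less_imp_neq, symmetric])
    finally show ?thesis by simp
  qed
  then have "integral {0..1} (\<lambda>t. (n t)\<^sup>2) \<le> 0" by (rule field_le_epsilon)
  moreover have "0 \<le> integral {0..1} (\<lambda>t. (n t)\<^sup>2)"
    by (intro Henstock_Kurzweil_Integration.integral_nonneg integrable_continuous_real nc') simp
  ultimately have "integral {0..1} (\<lambda>t. (n t)\<^sup>2) = 0" by simp
  from integral_square_eq_0[OF continuous_on_unit[OF nc] this frac_unit] have "n (frac s) = 0" .
  then have "0 \<le> g (frac s)" by (simp add: n_def max_def split: if_splits)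
  then show ?thesis using periodic_frac[of g, OF g(2)] by simp
qed

lemma convex_density_integrals:
  fixes w :: "real \<Rightarrow> 'a::euclidean_space"
  assumes w: "continuous_on UNIV w"
  shows "convex {integral {0..1} (\<lambda>t. \<rho> t *\<^sub>R w t) | \<rho>. circle_density \<rho>}" (is "convex ?K")
  unfolding convex_def
proof (intro ballI allI impI)
  fix x y and a b :: real
  assume "x \<in> ?K" "y \<in> ?K"
    and ab: "0 \<le> a" "0 \<le> b" "a + b = 1"
  then obtain \<rho> \<sigma> where r: "circle_density \<rho>" "x = integral {0..1} (\<lambda>t. \<rho> t *\<^sub>R w t)"
    and s: "circle_density \<sigma>" "y = integral {0..1} (\<lambda>t. \<sigma> t *\<^sub>R w t)" by blast
  have rc: "continuous_on {0..1} \<rho>" and sc: "continuous_on {0..1} \<sigma>" and wc: "continuous_on {0..1} w"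
    using r s w by (auto simp: circle_density_def intro: continuous_on_unit)
  have "circle_density (\<lambda>t. a * \<rho> t + b * \<sigma> t)"
    unfolding circle_density_def
  proof (intro conjI allI)
    show "continuous_on UNIV (\<lambda>t. a * \<rho> t + b * \<sigma> t)"
      using r s by (intro continuous_intros) (auto simp: circle_density_def)
    show "0 < a * \<rho> t + b * \<sigma> t" for t
      using ab r(1) s(1) by (cases "a = 0") (auto simp: circle_density_def add_pos_nonneg less_imp_le)
    have "integral {0..1} (\<lambda>t. a * \<rho> t + b * \<sigma> t) = integral {0..1} (\<lambda>t. a * \<rho> t) + integral {0..1} (\<lambda>t. b * \<sigma> t)"
      by (intro Henstock_Kurzweil_Integration.integral_add integrable_continuous_real continuous_intros rc sc)
    then show "integral {0..1} (\<lambda>t. a * \<rho> t + b * \<sigma> t) = 1"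
      using r(1) s(1) ab(3) by (simp add: circle_density_def)
  qed (use r s in \<open>auto simp: circle_density_def\<close>)
  moreover have "a *\<^sub>R x + b *\<^sub>R y = integral {0..1} (\<lambda>t. (a * \<rho> t + b * \<sigma> t) *\<^sub>R w t)"
  proof -
    have "integral {0..1} (\<lambda>t. (a * \<rho> t + b * \<sigma> t) *\<^sub>R w t)
        = integral {0..1} (\<lambda>t. a *\<^sub>R (\<rho> t *\<^sub>R w t) + b *\<^sub>R (\<sigma> t *\<^sub>R w t))"
      by (simp add: scaleR_add_left)
    also have "\<dots> = integral {0..1} (\<lambda>t. a *\<^sub>R (\<rho> t *\<^sub>R w t)) + integral {0..1} (\<lambda>t. b *\<^sub>R (\<sigma> t *\<^sub>R w t))"
      by (intro Henstock_Kurzweil_Integration.integral_add integrable_continuous_real continuous_intros rc sc wc)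
    also have "\<dots> = a *\<^sub>R x + b *\<^sub>R y" by (simp only: integral_cmul r(2) s(2))
    finally show ?thesis by simp
  qed
  ultimately show "a *\<^sub>R x + b *\<^sub>R y \<in> ?K"
    by (intro CollectI exI[of _ "\<lambda>t. a * \<rho> t + b * \<sigma> t"] conjI)
qed

text \<open>The wave sweeps out \<open>[-n, n]\<close>, and for growing \<open>n\<close> these
  ranges exhaust the real line.\<close>

definition wave :: "nat \<Rightarrow> real \<Rightarrow> real" where
  "wave n t = real n * sin (2 * pi * t)"

lemma wave_has_derivative: "(wave n has_real_derivative real n * (2 * pi * cos (2 * pi * t))) (at t)"
  unfolding wave_def[abs_def] by (auto intro!: derivative_eq_intros)

lemma wave_periodic: "wave n (t + 1) = wave n t"
  by (simp add: wave_def distrib_left sin_periodic)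

lemma wave_continuous_on: "continuous_on A (wave n)"
  unfolding wave_def[abs_def] by (intro continuous_intros)

lemma wave_surj:
  assumes "\<bar>x\<bar> \<le> real n" shows "\<exists>t. wave n t = x"
proof (cases "n = 0")
  case True
  then show ?thesis using assms by (auto simp: wave_def)
next
  case False
  then have "wave n (arcsin (x / real n) / (2 * pi)) = x"
    using assms by (simp add: wave_def sin_arcsin field_simps abs_le_iff)
  then show ?thesis by blast
qed

text \<open>If every \<open>n\<close> failed, there would be unit vectors \<open>a n\<close> with
  \<open>a n \<bullet> w x \<ge> 0\<close> for \<open>x\<close> in \<open>[-n, n]\<close>, since
  nonnegativity against all densities is pointwise nonnegativity. A limit of a subsequence on the
  compact unit sphere confines the whole curve, hence its convex hull, to a half-space bounded by a
  hyperplane through 0.\<close>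

lemma interior_density_integrals:
  fixes w :: "real \<Rightarrow> 'a::euclidean_space"
  assumes w: "continuous_on UNIV w" and int: "0 \<in> interior (convex hull (range w))"
  shows "\<exists>n. 0 \<in> interior {integral {0..1} (\<lambda>t. \<rho> t *\<^sub>R w (wave n t)) | \<rho>. circle_density \<rho>}"
proof (rule ccontr)
  let ?K = "\<lambda>n. {integral {0..1} (\<lambda>t. \<rho> t *\<^sub>R w (wave n t)) | \<rho>. circle_density \<rho>}"
  assume no: "\<not> ?thesis"
  have wc: "continuous_on A (\<lambda>t. w (wave n t))" for A n
    by (rule continuous_on_compose2[OF w wave_continuous_on]) simp
  have "\<exists>a. norm a = 1 \<and> (\<forall>x. \<bar>x\<bar> \<le> real n \<longrightarrow> 0 \<le> a \<bullet> w x)" for n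
  proof -
    obtain a where a: "a \<noteq> 0" "\<forall>y\<in>?K n. 0 \<le> a \<bullet> y"
      using not_interior_supporting[OF convex_density_integrals[OF wc]] no by blast
    have "0 \<le> a \<bullet> w (wave n s)" for s
    proof (rule nonneg_if_nonneg_against_densities[of "\<lambda>t. a \<bullet> w (wave n t)"])
      show "continuous_on UNIV (\<lambda>t. a \<bullet> w (wave n t))" by (intro continuous_intros wc)
      show "a \<bullet> w (wave n (t + 1)) = a \<bullet> w (wave n t)" for t by (simp add: wave_periodic)
      show "0 \<le> integral {0..1} (\<lambda>t. a \<bullet> w (wave n t) * \<rho> t)" if "circle_density \<rho>" for \<rho>
      proof -
        have "continuous_on {0..1} (\<lambda>t. \<rho> t *\<^sub>R w (wave n t))"
          using that by (intro continuous_intros wc continuous_on_unit) (simp add: circle_density_def)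
        from integral_inner_unit[OF this, of a]
        have "integral {0..1} (\<lambda>t. a \<bullet> w (wave n t) * \<rho> t) = a \<bullet> integral {0..1} (\<lambda>t. \<rho> t *\<^sub>R w (wave n t))"
          by (simp add: mult.commute)
        then show ?thesis using a(2) that by auto
      qed
    qed
    then have "0 \<le> a \<bullet> w x" if "\<bar>x\<bar> \<le> real n" for x using wave_surj[OF that] by force
    then have "0 \<le> (inverse (norm a) *\<^sub>R a) \<bullet> w x" if "\<bar>x\<bar> \<le> real n" for x
      using that by simp
    then show ?thesis using a(1) by (intro exI[of _ "inverse (norm a) *\<^sub>R a"]) simp
  qed
  then have "\<forall>n. \<exists>a. norm a = 1 \<and> (\<forall>x. \<bar>x\<bar> \<le> real n \<longrightarrow> 0 \<le> a \<bullet> w x)" by blast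
  then obtain a where a: "\<forall>n. norm (a n) = 1 \<and> (\<forall>x. \<bar>x\<bar> \<le> real n \<longrightarrow> 0 \<le> a n \<bullet> w x)"
    using choice[of "\<lambda>n a. norm a = 1 \<and> (\<forall>x. \<bar>x\<bar> \<le> real n \<longrightarrow> 0 \<le> a \<bullet> w x)"] by blast
  have "seq_compact (sphere (0::'a) 1)" using compact_sphere compact_imp_seq_compact by blast
  moreover have "\<forall>n. a n \<in> sphere 0 1" using a by simp
  ultimately have "\<exists>l\<in>sphere (0::'a) 1. \<exists>r. strict_mono r \<and> (a \<circ> r) \<longlonglongrightarrow> l"
    unfolding seq_compact_def by (elim allE[of _ a]) (rule mp)
  then obtain l r where l: "l \<in> sphere (0::'a) 1" "strict_mono r" "(a \<circ> r) \<longlonglongrightarrow> l"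
    by blast
  have lw: "0 \<le> l \<bullet> w x" for x
  proof (rule tendsto_lowerbound)
    show "(\<lambda>n. (a \<circ> r) n \<bullet> w x) \<longlonglongrightarrow> l \<bullet> w x" by (intro tendsto_intros l(3))
    obtain N where N: "\<bar>x\<bar> \<le> real N" using real_arch_simple by blast
    have "0 \<le> (a \<circ> r) n \<bullet> w x" if "N \<le> n" for n
    proof -
      have "\<bar>x\<bar> \<le> real (r n)" using seq_suble[OF l(2), of n] that N by linarith
      then show ?thesis using a by simp
    qed
    then show "\<forall>\<^sub>F n in sequentially. 0 \<le> (a \<circ> r) n \<bullet> w x"
      unfolding eventually_sequentially by blast
  qed simp
  have "convex hull (range w) \<subseteq> {y. 0 \<le> l \<bullet> y}"
    using lw by (intro hull_minimal) (auto simp: convex_halfspace_ge)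
  moreover obtain e where e: "0 < e" "ball 0 e \<subseteq> convex hull (range w)"
    using int unfolding mem_interior by blast
  have l1: "norm l = 1" using l(1) by simp
  then have "- (e / 2) *\<^sub>R l \<in> ball 0 e" using e(1) by simp
  ultimately have "0 \<le> l \<bullet> (- (e / 2) *\<^sub>R l)" using e(2) by blast
  then show False using e(1) l1 by (simp add: dot_square_norm)
qed

text \<open>The bound \<open>m\<close> makes every \<open>\<Theta> p\<close> grow at least linearly,
  hence bijective on the line. Joint continuity of the inverse is read off from the order:
  \<open>a < \<theta> p t\<close> means \<open>\<Theta> p a < t\<close>, which is an open condition
  on \<open>(p, t)\<close>.\<close>

lemma inverse_family:
  fixes \<Theta> :: "'p::topological_space \<Rightarrow> real \<Rightarrow> real"
  assumes cont: "continuous_on (P \<times> UNIV) (\<lambda>(p, s). \<Theta> p s)"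
    and deriv: "\<And>p s. p \<in> P \<Longrightarrow> (\<Theta> p has_real_derivative \<rho> p s) (at s)"
    and m: "0 < m" "\<And>p s. p \<in> P \<Longrightarrow> m \<le> \<rho> p s"
  shows "\<exists>\<theta>. continuous_on (P \<times> UNIV) (\<lambda>(p, t). \<theta> p t) \<and>
    (\<forall>p\<in>P. \<forall>t. \<Theta> p (\<theta> p t) = t \<and> \<theta> p (\<Theta> p t) = t \<and>
      (\<theta> p has_real_derivative inverse (\<rho> p (\<theta> p t))) (at t))"
proof -
  have growth: "m * (b - a) \<le> \<Theta> p b - \<Theta> p a" if p: "p \<in> P" and ab: "a \<le> b" for p a b
  proof (cases "a = b")
    case False
    then obtain z where "\<Theta> p b - \<Theta> p a = (b - a) * \<rho> p z"
      using MVT2[of a b "\<Theta> p" "\<rho> p"] deriv[OF p] ab by auto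
    then show ?thesis
      using mult_right_mono[OF m(2)[OF p, of z], of "b - a"] ab by (simp add: mult.commute)
  qed simp
  have strict: "\<Theta> p a < \<Theta> p b" if "p \<in> P" "a < b" for p a b
  proof -
    have "0 < m * (b - a)" using m(1) that by simp
    then show ?thesis using growth[of p a b] that by linarith
  qed
  have cs: "continuous_on A (\<Theta> p)" if "p \<in> P" for A p
    by (rule DERIV_continuous_on) (rule has_field_derivative_at_within[OF deriv[OF that]])
  have surj: "\<exists>s. \<Theta> p s = t" if p: "p \<in> P" for p t
  proof -
    define d where "d = \<bar>t - \<Theta> p 0\<bar> / m"
    have d: "0 \<le> d" "m * d = \<bar>t - \<Theta> p 0\<bar>" using m(1) by (simp_all add: d_def)
    have "\<Theta> p (- d) \<le> t" "t \<le> \<Theta> p d"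
      using growth[OF p, of "- d" 0] growth[OF p, of 0 d] d by auto
    then show ?thesis using IVT'[of "\<Theta> p" "- d" t d] d cs[OF p] by auto
  qed
  have uniq: "s = s'" if "p \<in> P" "\<Theta> p s = \<Theta> p s'" for p s s'
    using strict[of p s s'] strict[of p s' s] that by (cases s s' rule: linorder_cases) auto
  define \<theta> where "\<theta> p t = (SOME s. \<Theta> p s = t)" for p t
  have TT: "\<Theta> p (\<theta> p t) = t" if "p \<in> P" for p t
    unfolding \<theta>_def by (rule someI_ex[OF surj[OF that]])
  have inv: "\<theta> p (\<Theta> p s) = s" if "p \<in> P" for p s
    by (rule uniq[OF that]) (rule TT[OF that])
  have gt: "a < \<theta> p t" if "p \<in> P" "\<Theta> p a < t" for p a t
  proof (rule ccontr)
    assume "\<not> a < \<theta> p t"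
    then have "\<Theta> p (\<theta> p t) \<le> \<Theta> p a"
      using strict[OF that(1), of "\<theta> p t" a] by (cases "\<theta> p t = a") auto
    then show False using that TT by simp
  qed
  have lt: "\<theta> p t < a" if "p \<in> P" "t < \<Theta> p a" for p a t
  proof (rule ccontr)
    assume "\<not> \<theta> p t < a"
    then have "\<Theta> p a \<le> \<Theta> p (\<theta> p t)"
      using strict[OF that(1), of a "\<theta> p t"] by (cases "\<theta> p t = a") auto
    then show False using that TT by simp
  qed
  have \<theta>c: "continuous_on (P \<times> UNIV) (\<lambda>(p, t). \<theta> p t)"
    unfolding continuous_on_def
  proof
    fix z :: "'p \<times> real" assume z: "z \<in> P \<times> UNIV"
    have lim: "((\<lambda>z. \<Theta> (fst z) a - snd z) \<longlongrightarrow> \<Theta> (fst z) a - snd z) (at z within P \<times> UNIV)" for a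
    proof -
      have "continuous_on (P \<times> UNIV) (\<lambda>z :: 'p \<times> real. \<Theta> (fst z) a - snd z)"
        by (intro continuous_on_diff continuous_on_joint_compose[OF cont]) (auto intro!: continuous_intros)
      then show ?thesis using z unfolding continuous_on_def by blast
    qed
    have inP: "\<forall>\<^sub>F z in at z within P \<times> UNIV. fst z \<in> P"
      unfolding eventually_at_filter by (rule always_eventually) auto
    show "((\<lambda>(p, t). \<theta> p t) \<longlongrightarrow> (case z of (p, t) \<Rightarrow> \<theta> p t)) (at z within P \<times> UNIV)"
    proof (rule order_tendstoI)
      fix a assume "a < (case z of (p, t) \<Rightarrow> \<theta> p t)"
      then have "\<Theta> (fst z) a - snd z < 0"
        using strict[of "fst z" a "\<theta> (fst z) (snd z)"] z TT[of "fst z" "snd z"] by (auto simp: split_beta)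
      from order_tendstoD(2)[OF lim this] inP
      show "\<forall>\<^sub>F z in at z within P \<times> UNIV. a < (case z of (p, t) \<Rightarrow> \<theta> p t)"
        by eventually_elim (auto simp: split_beta intro: gt)
    next
      fix a assume "(case z of (p, t) \<Rightarrow> \<theta> p t) < a"
      then have "0 < \<Theta> (fst z) a - snd z"
        using strict[of "fst z" "\<theta> (fst z) (snd z)" a] z TT[of "fst z" "snd z"] by (auto simp: split_beta)
      from order_tendstoD(1)[OF lim this] inP
      show "\<forall>\<^sub>F z in at z within P \<times> UNIV. (case z of (p, t) \<Rightarrow> \<theta> p t) < a"
        by eventually_elim (auto simp: split_beta intro: lt)
    qed
  qed
  have "(\<theta> p has_real_derivative inverse (\<rho> p (\<theta> p t))) (at t)" if p: "p \<in> P" for p t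
  proof (rule DERIV_inverse_function[of "\<Theta> p" _ _ _ "t - 1" "t + 1"])
    show "\<rho> p (\<theta> p t) \<noteq> 0" using m(1) m(2)[OF p, of "\<theta> p t"] by linarith
    have "continuous_on UNIV (\<theta> p)"
      by (rule continuous_on_joint_compose[OF \<theta>c]) (use p in \<open>auto intro!: continuous_intros\<close>)
    then show "isCont (\<theta> p) t" by (simp add: continuous_on_eq_continuous_at)
  qed (use deriv[OF p] TT[OF p] in auto)
  then show ?thesis using \<theta>c TT inv by blast
qed

text \<open>If \<open>K' = g \<rho>\<close>, then \<open>K\<close> composed with \<theta> is an
  antiderivative of \<open>g\<close> composed with \<theta>, and by periodicity an increment of
  \<open>K\<close> over one period does not depend on where the period starts.\<close>

lemma integral_reparametrize:
  fixes g \<theta> \<rho> :: "real \<Rightarrow> real"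
  assumes g: "continuous_on UNIV g" "\<And>t. g (t + 1) = g t"
    and \<rho>: "continuous_on UNIV \<rho>" "\<And>t. \<rho> (t + 1) = \<rho> t" "\<And>t. 0 < \<rho> t"
    and \<theta>: "\<And>t. (\<theta> has_real_derivative inverse (\<rho> (\<theta> t))) (at t)" "\<theta> 1 = \<theta> 0 + 1"
  shows "integral {0..1} (\<lambda>t. g (\<theta> t)) = integral {0..1} (\<lambda>s. g s * \<rho> s)"
proof -
  have "continuous_on UNIV (\<lambda>s. g s * \<rho> s)" by (intro continuous_intros g \<rho>)
  from continuous_has_antiderivative[OF this]
  obtain K where "\<forall>x. (K has_real_derivative g x * \<rho> x) (at x)" by (rule exE)
  then have K: "(K has_real_derivative g x * \<rho> x) (at x)" for x by (rule spec)
  have "((\<lambda>t. K (\<theta> t)) has_real_derivative g (\<theta> t)) (at t)" for t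
  proof -
    have "\<rho> (\<theta> t) \<noteq> 0" using \<rho>(3)[of "\<theta> t"] by simp
    then have "g (\<theta> t) * \<rho> (\<theta> t) * inverse (\<rho> (\<theta> t)) = g (\<theta> t)" by simp
    then show ?thesis using DERIV_chain2[OF K \<theta>(1), of t] by (simp only:)
  qed
  then have "integral {0..1} (\<lambda>t. g (\<theta> t)) = K (\<theta> 1) - K (\<theta> 0)"
    by (rule integral_deriv_unit)
  also have "\<dots> = integral {0..1} (\<lambda>s. g s * \<rho> s)"
    using antiderivative_shift[OF K, of "\<theta> 0"] g(2) \<rho>(2) by (simp add: \<theta>(2))
  finally show ?thesis .
qed

text \<open>\<open>\<rho>0\<close> realizes the vector 0 and \<open>rb b\<close> realizes
  \<open>s *\<^sub>R b\<close> for a small \<open>s\<close>. The quotient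
  \<open>h b = (rb b - \<rho>0) / s\<close> has total mass 0 and integral \<open>b\<close> against
  \<open>W\<close>, so adding the \<open>h b\<close> with the coordinates of \<open>p\<close> as
  coefficients keeps the mass and moves the integral to \<open>p\<close>.\<close>

lemma affine_density_family:
  fixes W :: "real \<Rightarrow> 'a::euclidean_space"
  assumes W: "continuous_on UNIV W"
    and int: "0 \<in> interior {integral {0..1} (\<lambda>t. \<rho> t *\<^sub>R W t) | \<rho>. circle_density \<rho>}"
  shows "\<exists>\<rho>0 h. \<exists>r>0. \<exists>m>0. continuous_on UNIV \<rho>0 \<and> (\<forall>b\<in>Basis. continuous_on UNIV (h b)) \<and>
    (\<forall>p\<in>cball 0 r. circle_density (\<lambda>t. \<rho>0 t + (\<Sum>b\<in>Basis. (p \<bullet> b) * h b t)) \<and>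
      (\<forall>t. m \<le> \<rho>0 t + (\<Sum>b\<in>Basis. (p \<bullet> b) * h b t)) \<and>
      integral {0..1} (\<lambda>t. (\<rho>0 t + (\<Sum>b\<in>Basis. (p \<bullet> b) * h b t)) *\<^sub>R W t) = p)"
proof -
  let ?K = "{integral {0..1} (\<lambda>t. \<rho> t *\<^sub>R W t) | \<rho>. circle_density \<rho>}"
  obtain s where s: "0 < s" "cball 0 s \<subseteq> ?K" using int unfolding mem_interior_cball by blast
  have ex: "\<exists>\<rho>. circle_density \<rho> \<and> integral {0..1} (\<lambda>t. \<rho> t *\<^sub>R W t) = y" if "norm y \<le> s" for y
  proof -
    have "y \<in> ?K" using s(2) that by auto
    then show ?thesis by blast
  qed
  obtain \<rho>0 where r0: "circle_density \<rho>0" "integral {0..1} (\<lambda>t. \<rho>0 t *\<^sub>R W t) = 0"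
    using ex[of 0] s(1) by auto
  have "\<forall>b\<in>Basis. \<exists>\<rho>. circle_density \<rho> \<and> integral {0..1} (\<lambda>t. \<rho> t *\<^sub>R W t) = s *\<^sub>R b"
    using ex s(1) by simp
  from bchoice[OF this] obtain rb where
    rb: "\<And>b. b \<in> Basis \<Longrightarrow> circle_density (rb b)" "\<And>b. b \<in> Basis \<Longrightarrow> integral {0..1} (\<lambda>t. rb b t *\<^sub>R W t) = s *\<^sub>R b"
    by blast
  define h where "h b t = (rb b t - \<rho>0 t) / s" for b t
  let ?s = "\<lambda>p t. \<rho>0 t + (\<Sum>b\<in>Basis. (p \<bullet> b) * h b t)"
  have r0c: "continuous_on A \<rho>0" for A
    by (rule continuous_on_subset[of UNIV]) (use r0 in \<open>simp_all add: circle_density_def\<close>)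
  have rbc: "continuous_on A (rb b)" if "b \<in> Basis" for A b
    by (rule continuous_on_subset[of UNIV]) (use rb(1)[OF that] in \<open>simp_all add: circle_density_def\<close>)
  have hc: "continuous_on A (h b)" if "b \<in> Basis" for A b
    unfolding h_def[abs_def] divide_inverse
    by (intro continuous_on_mult continuous_on_diff rbc[OF that] r0c continuous_on_const)
  have Wc: "continuous_on {0..1} W" by (rule continuous_on_unit[OF W])
  have hp: "h b (t + 1) = h b t" if "b \<in> Basis" for b t
    using rb(1)[OF that] r0(1) by (simp add: h_def circle_density_def)
  have h0: "integral {0..1} (h b) = 0" if b: "b \<in> Basis" for b
  proof -
    have "integral {0..1} (\<lambda>t. rb b t - \<rho>0 t) = integral {0..1} (rb b) - integral {0..1} \<rho>0"
      by (intro Henstock_Kurzweil_Integration.integral_diff integrable_continuous_real rbc[OF b] r0c)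
    then show ?thesis
      using rb(1)[OF b] r0(1) by (simp add: h_def[abs_def] circle_density_def)
  qed
  have hW: "integral {0..1} (\<lambda>t. h b t *\<^sub>R W t) = b" if b: "b \<in> Basis" for b
  proof -
    have "integral {0..1} (\<lambda>t. h b t *\<^sub>R W t) = integral {0..1} (\<lambda>t. inverse s *\<^sub>R (rb b t *\<^sub>R W t - \<rho>0 t *\<^sub>R W t))"
      by (simp only: h_def divide_inverse scaleR_diff_left[symmetric] scaleR_scaleR mult.commute)
    also have "\<dots> = inverse s *\<^sub>R integral {0..1} (\<lambda>t. rb b t *\<^sub>R W t - \<rho>0 t *\<^sub>R W t)"
      by (rule integral_cmul)
    also have "integral {0..1} (\<lambda>t. rb b t *\<^sub>R W t - \<rho>0 t *\<^sub>R W t) = s *\<^sub>R b - 0"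
      unfolding rb(2)[OF b, symmetric] r0(2)[symmetric]
      by (intro Henstock_Kurzweil_Integration.integral_diff integrable_continuous_real continuous_intros rbc[OF b] r0c Wc)
    finally show ?thesis using s(1) by simp
  qed
  obtain m0 where m0: "0 < m0" "\<And>t. m0 \<le> \<rho>0 t"
  proof -
    obtain x where x: "x \<in> {0..1}" "\<forall>t\<in>{0..1}. \<rho>0 x \<le> \<rho>0 t"
      using continuous_attains_inf[of "{0..1}" \<rho>0] r0c[of "{0..1}"] by auto
    have "\<rho>0 x \<le> \<rho>0 t" for t
    proof -
      have "\<rho>0 (frac t) = \<rho>0 t" by (rule periodic_frac) (use r0(1) in \<open>simp add: circle_density_def\<close>)
      then show ?thesis using bspec[OF x(2) frac_unit[of t]] by simp
    qed
    moreover have "0 < \<rho>0 x" using r0(1) by (simp add: circle_density_def)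
    ultimately show ?thesis using that by blast
  qed
  have "\<exists>M. \<forall>t. \<bar>\<Sum>b\<in>Basis. \<bar>h b t\<bar>\<bar> \<le> M"
    by (rule periodic_continuous_bounded) (auto intro!: continuous_intros hc simp: hp)
  then obtain M where M: "\<forall>t. \<bar>\<Sum>b\<in>Basis. \<bar>h b t\<bar>\<bar> \<le> M" by blast
  have M0: "0 \<le> M" using M abs_ge_zero order_trans by blast
  \<comment> \<open>\<open>M\<close> bounds the sum of the \<open>\<bar>h b t\<bar>\<close>. For
    \<open>norm p \<le> r\<close> the perturbation is thus at most
    \<open>r * M \<le> m0 / 2\<close>, and the density stays above \<open>m0 / 2\<close>.\<close>
  define r where "r = m0 / (2 * (M + 1))"
  have r: "0 < r" "r * M \<le> m0 / 2"
    using m0(1) M0 by (auto simp: r_def field_simps)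
  have all: "\<forall>p\<in>cball 0 r. circle_density (\<lambda>t. ?s p t) \<and>
      (\<forall>t. m0 / 2 \<le> ?s p t) \<and>
      integral {0..1} (\<lambda>t. ?s p t *\<^sub>R W t) = p"
  proof
    fix p :: 'a assume p: "p \<in> cball 0 r"
    have low: "m0 / 2 \<le> ?s p t" for t
    proof -
      have "\<bar>\<Sum>b\<in>Basis. (p \<bullet> b) * h b t\<bar> \<le> (\<Sum>b\<in>Basis. \<bar>(p \<bullet> b) * h b t\<bar>)" by (rule sum_abs)
      also have "\<dots> \<le> (\<Sum>b\<in>Basis. r * \<bar>h b t\<bar>)"
      proof (rule sum_mono)
        fix b :: 'a assume b: "b \<in> Basis"
        have "\<bar>p \<bullet> b\<bar> \<le> r" using Basis_le_norm[OF b, of p] p by simp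
        then show "\<bar>(p \<bullet> b) * h b t\<bar> \<le> r * \<bar>h b t\<bar>" by (simp add: abs_mult mult_right_mono)
      qed
      also have "\<dots> = r * (\<Sum>b\<in>Basis. \<bar>h b t\<bar>)" by (simp add: sum_distrib_left)
      also have "\<dots> \<le> r * M" using M r(1) by (intro mult_left_mono) (auto simp: abs_le_iff)
      finally show ?thesis using r(2) m0(2)[of t] by (simp add: abs_le_iff)
    qed
    have sc: "continuous_on A (\<lambda>t. ?s p t)" for A
      by (intro continuous_intros r0c hc)
    have i1: "integral {0..1} (\<lambda>t. ?s p t) = 1"
    proof -
      have "integral {0..1} (\<lambda>t. ?s p t)
          = integral {0..1} \<rho>0 + integral {0..1} (\<lambda>t. \<Sum>b\<in>Basis. (p \<bullet> b) * h b t)"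
        by (intro Henstock_Kurzweil_Integration.integral_add integrable_continuous_real continuous_intros r0c hc)
      also have "integral {0..1} (\<lambda>t. \<Sum>b\<in>Basis. (p \<bullet> b) * h b t) = (\<Sum>b\<in>Basis. integral {0..1} (\<lambda>t. (p \<bullet> b) * h b t))"
        by (intro Henstock_Kurzweil_Integration.integral_sum integrable_continuous_real continuous_intros hc) simp
      also have "\<dots> = 0" using h0 by simp
      finally show ?thesis using r0(1) by (simp add: circle_density_def)
    qed
    have "integral {0..1} (\<lambda>t. ?s p t *\<^sub>R W t)
        = integral {0..1} (\<lambda>t. \<rho>0 t *\<^sub>R W t + (\<Sum>b\<in>Basis. (p \<bullet> b) *\<^sub>R (h b t *\<^sub>R W t)))"
      by (simp add: scaleR_add_left scaleR_sum_left)
    also have "\<dots> = integral {0..1} (\<lambda>t. \<rho>0 t *\<^sub>R W t) + integral {0..1} (\<lambda>t. \<Sum>b\<in>Basis. (p \<bullet> b) *\<^sub>R (h b t *\<^sub>R W t))"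
      by (intro Henstock_Kurzweil_Integration.integral_add integrable_continuous_real continuous_intros r0c hc Wc)
    also have "integral {0..1} (\<lambda>t. \<Sum>b\<in>Basis. (p \<bullet> b) *\<^sub>R (h b t *\<^sub>R W t))
        = (\<Sum>b\<in>Basis. integral {0..1} (\<lambda>t. (p \<bullet> b) *\<^sub>R (h b t *\<^sub>R W t)))"
      by (intro Henstock_Kurzweil_Integration.integral_sum integrable_continuous_real continuous_intros hc Wc) simp
    also have "\<dots> = (\<Sum>b\<in>Basis. (p \<bullet> b) *\<^sub>R b)"
      by (intro sum.cong refl) (simp only: integral_cmul hW)
    also have "\<dots> = p" by (rule euclidean_representation)
    finally have i2: "integral {0..1} (\<lambda>t. ?s p t *\<^sub>R W t) = p"
      by (simp add: r0(2))
    have "circle_density (\<lambda>t. ?s p t)"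
      unfolding circle_density_def
    proof (intro conjI allI sc i1)
      show "\<rho>0 (t + 1) + (\<Sum>b\<in>Basis. (p \<bullet> b) * h b (t + 1)) = ?s p t" for t
        using r0(1) hp by (simp add: circle_density_def)
      show "0 < ?s p t" for t
        using low[of t] m0(1) by linarith
    qed
    with low i2 show "circle_density (\<lambda>t. ?s p t) \<and>
      (\<forall>t. m0 / 2 \<le> ?s p t) \<and>
      integral {0..1} (\<lambda>t. ?s p t *\<^sub>R W t) = p"
      by (intro conjI allI)
  qed
  have hcb: "\<forall>b\<in>Basis. continuous_on UNIV (h b)" using hc by (rule ballI)
  show ?thesis
    by (rule exI[of _ \<rho>0], rule exI[of _ h], rule exI[of _ r], rule conjI[OF r(1)], rule exI[of _ "m0 / 2"])
      (intro conjI half_gt_zero m0(1) r0c hcb all)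
qed

text \<open>\<open>v (p, _)\<close> runs through the wave so as to spend the share
  \<open>\<rho> p s ds\<close> of its time at \<open>wave n s\<close>: the wave is composed with the
  inverse of an antiderivative \<open>\<Theta> p\<close> of \<open>\<rho> p\<close>. As the mass is
  1, \<open>\<Theta> p (t + 1) = \<Theta> p t + 1\<close>, so the inverse commutes with the period
  shift and the composition stays periodic.\<close>

lemma realizing_family:
  fixes w :: "real \<Rightarrow> 'a::euclidean_space"
  assumes w: "continuous_on UNIV w" and int: "0 \<in> interior (convex hull (range w))"
  shows "\<exists>r>0. \<exists>v. continuous_on (cball 0 r \<times> UNIV) v \<and>
    (\<forall>p\<in>cball 0 r. (\<lambda>t. v (p, t)) \<in> C1 \<and> integral {0..1} (\<lambda>t. w (v (p, t))) = p)"
proof -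
  obtain n where n: "0 \<in> interior {integral {0..1} (\<lambda>t. \<rho> t *\<^sub>R w (wave n t)) | \<rho>. circle_density \<rho>}"
    using interior_density_integrals[OF w int] by blast
  have Wc: "continuous_on A (\<lambda>t. w (wave n t))" for A
    by (rule continuous_on_compose2[OF w wave_continuous_on]) simp
  obtain \<rho>0 h r m where r: "0 < r" and m: "0 < m" and r0c: "continuous_on UNIV \<rho>0"
    and hc: "\<forall>b\<in>Basis. continuous_on UNIV (h b)"
    and fam: "\<forall>p\<in>cball 0 r. circle_density (\<lambda>t. \<rho>0 t + (\<Sum>b\<in>Basis. (p \<bullet> b) * h b t)) \<and>
      (\<forall>t. m \<le> \<rho>0 t + (\<Sum>b\<in>Basis. (p \<bullet> b) * h b t)) \<and>
      integral {0..1} (\<lambda>t. (\<rho>0 t + (\<Sum>b\<in>Basis. (p \<bullet> b) * h b t)) *\<^sub>R w (wave n t)) = p"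
    using affine_density_family[OF Wc n] by blast
  define \<rho> where "\<rho> p t = \<rho>0 t + (\<Sum>b\<in>Basis. (p \<bullet> b) * h b t)" for p t
  have dens: "circle_density (\<rho> p)" and low: "m \<le> \<rho> p t"
    and rint: "integral {0..1} (\<lambda>t. \<rho> p t *\<^sub>R w (wave n t)) = p" if "p \<in> cball 0 r" for p t
    using bspec[OF fam that] by (auto simp: \<rho>_def[abs_def])
  obtain R0 where "\<forall>x. (R0 has_real_derivative \<rho>0 x) (at x)"
    using continuous_has_antiderivative[OF r0c] by (rule exE)
  then have R0: "(R0 has_real_derivative \<rho>0 x) (at x)" for x by (rule spec)
  have "\<forall>b\<in>Basis. \<exists>H. \<forall>x. (H has_real_derivative h b x) (at x)"
    using hc by (intro ballI continuous_has_antiderivative) blast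
  from bchoice[OF this] obtain H where "\<forall>b\<in>Basis. \<forall>x. (H b has_real_derivative h b x) (at x)" by (rule exE)
  then have H: "(H b has_real_derivative h b x) (at x)" if "b \<in> Basis" for b x using that by blast
  \<comment> \<open>Antiderivatives are chosen once for \<open>\<rho>0\<close> and for each
    \<open>h b\<close>. This makes \<Theta> affine in \<open>p\<close>, which gives joint
    continuity.\<close>
  define \<Theta> where "\<Theta> p t = R0 t + (\<Sum>b\<in>Basis. (p \<bullet> b) * H b t)" for p t
  have TD: "(\<Theta> p has_real_derivative \<rho> p t) (at t)" for p t
    unfolding \<Theta>_def[abs_def] \<rho>_def by (intro DERIV_add DERIV_sum DERIV_cmult R0 H)
  have R0c: "continuous_on UNIV R0" by (rule DERIV_continuous_on) (rule R0)
  have Hc: "continuous_on UNIV (H b)" if "b \<in> Basis" for b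
    by (rule DERIV_continuous_on) (rule H[OF that])
  have Tc: "continuous_on (cball 0 r \<times> UNIV) (\<lambda>(p, t). \<Theta> p t)"
    unfolding \<Theta>_def split_beta
    by (intro continuous_on_add continuous_on_sum continuous_on_mult continuous_on_inner
        continuous_on_fst continuous_on_id continuous_on_const
        continuous_on_compose2[OF R0c continuous_on_snd[OF continuous_on_id]]
        continuous_on_compose2[OF Hc continuous_on_snd[OF continuous_on_id]]) auto
  obtain \<theta> where \<theta>c: "continuous_on (cball 0 r \<times> UNIV) (\<lambda>(p, t). \<theta> p t)"
    and \<theta>: "\<forall>p\<in>cball 0 r. \<forall>t. \<Theta> p (\<theta> p t) = t \<and> \<theta> p (\<Theta> p t) = t \<and>
      (\<theta> p has_real_derivative inverse (\<rho> p (\<theta> p t))) (at t)"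
    using inverse_family[OF Tc TD m low] by blast
  have shift: "\<theta> p (t + 1) = \<theta> p t + 1" if p: "p \<in> cball 0 r" for p t
  proof -
    have "\<Theta> p (\<theta> p t + 1) = \<Theta> p (\<theta> p t) + integral {0..1} (\<rho> p)"
      by (rule antiderivative_shift[OF TD]) (use dens[OF p] in \<open>simp add: circle_density_def\<close>)
    then have "\<Theta> p (\<theta> p t + 1) = t + 1"
      using dens[OF p] bspec[OF \<theta> p] by (simp add: circle_density_def)
    then show ?thesis using bspec[OF \<theta> p] by metis
  qed
  define v where "v z = wave n (\<theta> (fst z) (snd z))" for z
  have "continuous_on (cball 0 r \<times> UNIV) v"
    unfolding v_def[abs_def]
    by (rule continuous_on_compose2[OF wave_continuous_on[of UNIV]]) (use \<theta>c in \<open>simp_all add: split_beta\<close>)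
  moreover have "(\<lambda>t. v (p, t)) \<in> C1" if p: "p \<in> cball 0 r" for p
  proof (rule C1I)
    show "periodic (\<lambda>t. v (p, t))"
      by (simp add: periodic_def v_def shift[OF p] wave_periodic)
    have \<theta>D: "(\<theta> p has_real_derivative inverse (\<rho> p (\<theta> p t))) (at t)" for t
      using bspec[OF \<theta> p] by blast
    show "((\<lambda>t. v (p, t)) has_real_derivative
        real n * (2 * pi * cos (2 * pi * \<theta> p t)) * inverse (\<rho> p (\<theta> p t))) (at t)" for t
      unfolding v_def fst_conv snd_conv by (rule DERIV_chain2[OF wave_has_derivative \<theta>D])
    have pc: "continuous_on UNIV (\<theta> p)" by (rule DERIV_continuous_on) (rule \<theta>D)
    have "continuous_on UNIV (\<rho> p)" using dens[OF p] by (simp add: circle_density_def)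
    then have "continuous_on UNIV (\<lambda>t. \<rho> p (\<theta> p t))"
      by (rule continuous_on_compose2[OF _ pc]) simp
    moreover have "\<rho> p (\<theta> p t) \<noteq> 0" for t using low[OF p, of "\<theta> p t"] m by linarith
    ultimately show "continuous_on UNIV (\<lambda>t. real n * (2 * pi * cos (2 * pi * \<theta> p t)) * inverse (\<rho> p (\<theta> p t)))"
      by (intro continuous_intros pc ballI)
  qed
  moreover have "integral {0..1} (\<lambda>t. w (v (p, t))) = p" if p: "p \<in> cball 0 r" for p
  proof (rule euclidean_eqI)
    fix b :: 'a assume "b \<in> Basis"
    have \<theta>D: "(\<theta> p has_real_derivative inverse (\<rho> p (\<theta> p t))) (at t)" for t
      using bspec[OF \<theta> p] by blast
    have pc: "continuous_on {0..1} (\<theta> p)"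
      by (rule DERIV_continuous_on) (rule has_field_derivative_at_within[OF \<theta>D])
    have wv: "continuous_on {0..1} (\<lambda>t. w (v (p, t)))"
      unfolding v_def fst_conv snd_conv by (rule continuous_on_compose2[OF Wc[of UNIV] pc]) simp
    have "b \<bullet> integral {0..1} (\<lambda>t. w (v (p, t))) = integral {0..1} (\<lambda>t. b \<bullet> w (v (p, t)))"
      by (rule integral_inner_unit[OF wv, symmetric])
    also have "\<dots> = integral {0..1} (\<lambda>t. (\<lambda>s. b \<bullet> w (wave n s)) (\<theta> p t))"
      by (simp add: v_def)
    also have "\<dots> = integral {0..1} (\<lambda>s. (b \<bullet> w (wave n s)) * \<rho> p s)"
    proof (rule integral_reparametrize)
      show "continuous_on UNIV (\<lambda>s. b \<bullet> w (wave n s))" by (intro continuous_intros Wc)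
      show "\<theta> p 1 = \<theta> p 0 + 1" using shift[OF p, of 0] by simp
      show "b \<bullet> w (wave n (t + 1)) = b \<bullet> w (wave n t)" for t by (simp add: wave_periodic)
    qed (use dens[OF p] \<theta>D in \<open>simp_all add: circle_density_def\<close>)
    also have "\<dots> = integral {0..1} (\<lambda>s. b \<bullet> (\<rho> p s *\<^sub>R w (wave n s)))"
      by (simp add: mult.commute)
    also have "\<dots> = b \<bullet> integral {0..1} (\<lambda>s. \<rho> p s *\<^sub>R w (wave n s))"
      using dens[OF p] by (intro integral_inner_unit continuous_intros Wc continuous_on_unit)
        (simp add: circle_density_def)
    also have "\<dots> = b \<bullet> p" by (simp only: rint[OF p])
    finally show "integral {0..1} (\<lambda>t. w (v (p, t))) \<bullet> b = p \<bullet> b" by (simp only: inner_commute)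
  qed
  ultimately show ?thesis using r by blast
qed

section \<open>Vanishing derivatives along the fibres\<close>

lemma deriv_funpow_integral_shift:
  fixes g v :: "real \<Rightarrow> real"
  assumes g: "smooth g" and v: "continuous_on {0..1} v"
  shows "(deriv ^^ n) (\<lambda>x. integral {0..1} (\<lambda>t. g (v t + x))) = (\<lambda>x. integral {0..1} (\<lambda>t. (deriv ^^ n) g (v t + x)))"
proof (induction n)
  case (Suc n)
  have "((\<lambda>x. integral {0..1} (\<lambda>t. (deriv ^^ n) g (v t + x))) has_real_derivative
      integral {0..1} (\<lambda>t. (deriv ^^ Suc n) g (v t + x))) (at x)" for x
  proof (rule parametric_integral_has_derivative[of UNIV])
    show "((\<lambda>x. (deriv ^^ n) g (v r + x)) has_real_derivative (deriv ^^ Suc n) g (v r + x)) (at x)" for x r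
    proof -
      have "((\<lambda>x. (deriv ^^ n) g (x + v r)) has_real_derivative (deriv ^^ Suc n) g (x + v r)) (at x)"
        using smooth_DERIV[OF g, of n "x + v r"] by (simp only: DERIV_shift)
      then show ?thesis by (simp only: add.commute)
    qed
    show "continuous_on {0..1} (\<lambda>t. (deriv ^^ n) g (v t + x))" for x
      by (intro smooth_compose_continuous_on[OF g] continuous_intros v)
    have "continuous_on (UNIV \<times> {0..1}) (\<lambda>p. v (snd p) + fst p)"
      by (intro continuous_intros continuous_on_compose2[OF v]) auto
    from smooth_compose_continuous_on[OF g this, of "Suc n"]
    show "continuous_on (UNIV \<times> {0..1}) (\<lambda>(x, r). (deriv ^^ Suc n) g (v r + x))"
      by (simp add: split_beta)
  qed auto
  then have "deriv (\<lambda>x. integral {0..1} (\<lambda>t. (deriv ^^ n) g (v t + x)))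
      = (\<lambda>x. integral {0..1} (\<lambda>t. (deriv ^^ Suc n) g (v t + x)))"
    by (intro ext DERIV_imp_deriv)
  then show ?case by (simp add: Suc)
qed simp

lemma integral_scaled_period:
  fixes g :: "real \<Rightarrow> real"
  assumes g: "continuous_on UNIV g" "\<And>t. g (t + 1) = g t" and N: "0 < N"
  shows "integral {0..1} (\<lambda>t. g (real N * t)) = integral {0..1} g"
proof -
  obtain G where "\<forall>x. (G has_real_derivative g x) (at x)"
    using continuous_has_antiderivative[OF g(1)] by (rule exE)
  then have G: "(G has_real_derivative g x) (at x)" for x by (rule spec)
  have "G (real n) = G 0 + real n * integral {0..1} g" for n
  proof (induction n)
    case (Suc n)
    have "G (real (Suc n)) = G (real n + 1)" by (simp add: add.commute)
    also have "\<dots> = G (real n) + integral {0..1} g" by (rule antiderivative_shift[OF G g(2)])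
    finally show ?case using Suc by (simp add: algebra_simps)
  qed simp
  moreover have "real N * integral {0..1} (\<lambda>r. g (0 + real N * r)) = G (0 + real N) - G 0"
    by (rule integral_segment) (rule G)
  ultimately have "real N * integral {0..1} (\<lambda>r. g (real N * r)) = real N * integral {0..1} g" by simp
  then show ?thesis using N by simp
qed

text \<open>Components are indexed by \<open>'k\<close> and not by numbers; this finds, for each
  order \<open>n < k\<close>, the component that carries it.\<close>

lemma rank_surj:
  assumes "n < CARD('k::{finite, linorder})"
  shows "\<exists>i::'k. card {..i} = Suc n"
proof -
  have "strict_mono (\<lambda>i::'k. card {..i})"
    by (intro strict_monoI psubset_card_mono) auto
  then have "inj (\<lambda>i::'k. card {..i})" by (rule strict_mono_imp_inj_on)
  then have "card (range (\<lambda>i::'k. card {..i})) = CARD('k)" by (rule card_image)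
  moreover have "range (\<lambda>i::'k. card {..i}) \<subseteq> {1..CARD('k)}"
    by (auto simp: Suc_le_eq card_gt_0_iff intro: card_mono[OF finite subset_UNIV])
  ultimately have "range (\<lambda>i::'k. card {..i}) = {1..CARD('k)}"
    by (intro card_subset_eq) auto
  moreover have "Suc n \<in> {1..CARD('k)}" using assms by simp
  ultimately show ?thesis by (metis rangeE)
qed

text \<open>\<open>U\<close> is given by its evolution in \<open>x\<close>, while an equation in
  \<open>t\<close> is wanted. The linear equation for the speed supplies its
  \<open>t\<close>-derivative, and integrating this along \<open>x\<close> yields the
  \<open>t\<close>-derivative of \<open>U\<close>. The average of \<open>U\<close> moves at rate 1,
  since the speed has average 1.\<close>

lemma flow_solves_equation:
  fixes Q :: "'q::topological_space set" and U :: "'q \<times> real \<Rightarrow> real \<Rightarrow> real"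
  assumes f: "smooth f" and e: "continuous_on Q e" and q: "q \<in> Q" and \<delta>: "0 < \<delta>"
    and U: "\<And>m. Ck m {-\<delta><..<\<delta>} (Q \<times> UNIV) U" and per: "periodic_on Q {-\<delta><..<\<delta>} U"
    and UD: "\<And>t x. x \<in> {-\<delta><..<\<delta>} \<Longrightarrow> (U (q, t) has_real_derivative speed e (deriv f) U (q, t) x) (at x)"
    and v: "v \<in> C1" "\<And>t. U (q, t) 0 = v t"
    and van: "\<And>n. n < k \<Longrightarrow> (deriv ^^ n) (\<lambda>x. integral {0..1} (\<lambda>t. deriv f (U (q, t) x))) 0 = 0"
  shows "\<exists>c c'. (\<forall>x\<in>{-\<delta><..<\<delta>}. (c has_real_derivative c' x) (at x)) \<and> c 0 = 0 \<and>
    vanishes k {-\<delta><..<\<delta>} 0 c' \<and>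
    (\<forall>x\<in>{-\<delta><..<\<delta>}. \<forall>t. ((\<lambda>t. U (q, t) x) has_real_derivative
      deriv v t + e q * f (v t) + c x - e q * f (U (q, t) x)) (at t)) \<and>
    (\<forall>x\<in>{-\<delta><..<\<delta>}. integral {0..1} (\<lambda>t. U (q, t) x) = integral {0..1} v + x)"
proof -
  let ?J = "{-\<delta><..<\<delta>}" and ?Z = "Q \<times> (UNIV :: real set)"
  let ?h = "\<lambda>z x. e (fst z) * deriv f (U z x)"
  let ?w = "speed e (deriv f) U"
  have J: "open ?J" "convex ?J" "0 \<in> ?J" using \<delta> by auto
  have sf': "smooth (deriv f)" by (rule smooth_deriv[OF f])
  have hC: "Ck m ?J ?Z ?h" for m by (rule Ck_coeff[OF U e sf'])
  have wC: "Ck m ?J ?Z ?w" for m by (rule Ck_speed[OF J(1,2) U per e sf'])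
  have hper: "?h (q, t + 1) x = ?h (q, t) x" if "x \<in> ?J" for t x
    using per q that by (simp add: periodic_on_def)
  have hcont: "continuous_on A (\<lambda>t. ?h (q, t) x)" if "x \<in> ?J" for A x
    by (rule Ck_continuous_on_slice[OF hC q that])
  have w_eq: "?w (q, t) x = flow_speed (\<lambda>t. ?h (q, t) x) t" for t x by (simp add: speed_def)
  define I where "I q x = integral {0..1} (\<lambda>t. deriv f (U (q, t) x))" for q x
  define G where "G q x = integral {0..1} (gain (\<lambda>t. ?h (q, t) x))" for q x
  have IC: "Ck m ?J Q I" for m
  proof -
    have "Ck m ?J (Q \<times> {0..1}) (\<lambda>z x. deriv f (U z x))"
      by (rule Ck_subst[OF continuous_on_id _ Ck_compose[OF sf' U]]) auto
    from Ck_integral[OF J(1,2) this] show ?thesis by (simp add: I_def[abs_def])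
  qed
  have GC: "Ck m ?J Q G" for m
    using Ck_integral_gain[OF J(1,2) hC] by (simp add: G_def[abs_def])
  have Gpos: "0 < G q x" if "x \<in> ?J" for x
    unfolding G_def by (rule integral_gain_pos[OF hcont[OF that] hper[OF that]])
  \<comment> \<open>The parameter set is cut down to \<open>{q}\<close>, as positivity of
    \<open>G\<close> has been established for this \<open>q\<close> only.\<close>
  have qC: "Ck m ?J {q} g" if "Ck m ?J Q g" for m g
    by (rule Ck_subst[OF continuous_on_id _ that]) (use q in auto)
  \<comment> \<open>The constant on the right of the linear equation with coefficient
    \<open>e q * f' (U (q, _) x)\<close>. Its numerator vanishes to the order of \<open>I q\<close>,
    and its denominator is positive and smooth in \<open>x\<close>.\<close>
  define c' where "c' x = (exp (I q x * e q) - 1) * inverse (G q x)" for x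
  have iG: "Ck m ?J {q} (\<lambda>q x. inverse (G q x))" for m
    by (rule Ck_inverse[OF _ qC[OF GC]]) (use Gpos in force)
  have eC: "Ck m ?J {q} (\<lambda>q x. e q)" for m by (rule Ck_const) simp
  have "vanishes k ?J 0 (I q)"
    by (rule Ck_imp_vanishes[OF J(1,3) q IC]) (use van in \<open>simp add: I_def[abs_def]\<close>)
  from vanishes_mult[OF this singletonI eC] have "vanishes k ?J 0 (\<lambda>x. I q x * e q)" .
  from vanishes_exp_minus_1[of _ _ _ "\<lambda>q x. I q x * e q", OF this singletonI Ck_mult[OF qC[OF IC] eC]]
  have "vanishes k ?J 0 (\<lambda>x. exp (I q x * e q) - 1)" .
  from vanishes_mult[OF this singletonI iG] have van': "vanishes k ?J 0 c'"
    by (simp add: c'_def[abs_def])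
  have c'c: "continuous_on ?J c'"
  proof -
    have "continuous_on ?J (I q)" by (rule Ck_continuous_on_arg[OF IC[of 0] q])
    moreover have "continuous_on ?J (G q)" by (rule Ck_continuous_on_arg[OF GC[of 0] q])
    ultimately show ?thesis
      unfolding c'_def[abs_def] using Gpos by (intro continuous_intros) force+
  qed
  define c where "c x = x * integral {0..1} (\<lambda>s. c' (x * s))" for x
  have cD: "(c has_real_derivative c' x) (at x)" if "x \<in> ?J" for x
    unfolding c_def[abs_def] by (rule ray_integral_has_derivative[OF c'c that])
  have c0: "c 0 = 0" by (simp add: c_def)
  define w' where "w' t x = c' x - ?h (q, t) x * ?w (q, t) x" for t x
  have wD: "((\<lambda>t. ?w (q, t) x) has_real_derivative w' t x) (at t)" if x: "x \<in> ?J" for t x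
  proof -
    have "integral {0..1} (\<lambda>t. ?h (q, t) x) = e q * I q x"
      unfolding I_def fst_conv by (rule integral_mult_right)
    then have "c' x = (exp (integral {0..1} (\<lambda>t. ?h (q, t) x)) - 1) / integral {0..1} (gain (\<lambda>t. ?h (q, t) x))"
      by (simp only: c'_def G_def divide_inverse mult.commute[of "e q"])
    then show ?thesis
      using flow_speed_has_derivative[OF hcont[OF x] hper[OF x], of t] by (simp add: w'_def w_eq)
  qed
  have Useg: "U (q, t) x = v t + x * integral {0..1} (\<lambda>s. ?w (q, t) (x * s))" if x: "x \<in> ?J" for t x
    using integral_segment[where g = "?w (q, t)" and G = "U (q, t)" and t = 0 and s = x]
      UD[OF mult_unit_mem_ball[OF x]] v(2) by simp
  \<comment> \<open>\<open>w' t\<close> is also the \<open>x\<close>-derivative of \<open>c - e q * f (U (q, t))\<close>, so its integral is explicit.\<close>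
  have Yseg: "x * integral {0..1} (\<lambda>s. w' t (x * s)) = c x - e q * f (U (q, t) x) + e q * f (v t)"
    if x: "x \<in> ?J" for t x
  proof -
    have fD: "(f has_real_derivative deriv f y) (at y)" for y using smooth_DERIV[OF f, of 0 y] by simp
    have "((\<lambda>y. c y - e q * f (U (q, t) y)) has_real_derivative w' t y) (at y)" if y: "y \<in> ?J" for y
      using DERIV_diff[OF cD[OF y] DERIV_cmult[OF DERIV_chain2[OF fD UD[OF y]], of "e q"]]
      by (simp add: w'_def mult.assoc)
    then show ?thesis
      using integral_segment[where g = "w' t" and G = "\<lambda>y. c y - e q * f (U (q, t) y)" and t = 0 and s = x]
        mult_unit_mem_ball[OF x] v(2) c0 by simp
  qed
  have w'c: "continuous_on (UNIV \<times> ?J) (\<lambda>p. w' (fst p) (snd p))"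
    unfolding w'_def
    by (intro continuous_on_diff continuous_on_mult[of _ "\<lambda>p. ?h (q, fst p) (snd p)"]
        continuous_on_compose2[OF c'c continuous_on_snd[OF continuous_on_id]]
        continuous_on_joint_compose[OF Ck_imp_continuous_on[OF hC[of 0]]]
        continuous_on_joint_compose[OF Ck_imp_continuous_on[OF wC[of 0]]])
      (use q in \<open>auto intro!: continuous_intros\<close>)
  have UT: "((\<lambda>t. U (q, t) x) has_real_derivative
      deriv v t + e q * f (v t) + c x - e q * f (U (q, t) x)) (at t)" if x: "x \<in> ?J" for t x
  proof -
    have xs: "x * s \<in> ?J" if "s \<in> {0..1}" for s by (rule mult_unit_mem_ball[OF x that])
    have "((\<lambda>t. integral {0..1} (\<lambda>s. ?w (q, t) (x * s))) has_real_derivative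
        integral {0..1} (\<lambda>s. w' t (x * s))) (at t)"
    proof (rule parametric_integral_has_derivative[of UNIV])
      show "((\<lambda>t. ?w (q, t) (x * s)) has_real_derivative w' t (x * s)) (at t)" if "s \<in> {0..1}" for t s
        by (rule wD[OF xs[OF that]])
      show "continuous_on {0..1} (\<lambda>s. ?w (q, t) (x * s))" for t
        by (rule continuous_on_ray[OF Ck_continuous_on_arg[OF wC[of 0]] x]) (use q in simp)
      have "continuous_on (UNIV \<times> {0..1}) (\<lambda>p :: real \<times> real. w' (fst (fst p, x * snd p)) (snd (fst p, x * snd p)))"
        by (rule continuous_on_compose2[OF w'c]) (use xs in \<open>auto intro!: continuous_intros simp del: greaterThanLessThan_iff\<close>)
      then show "continuous_on (UNIV \<times> {0..1}) (\<lambda>(t, s). w' t (x * s))" by (simp add: split_beta)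
    qed auto
    from DERIV_add[OF C1_has_derivative[OF v(1), of t] DERIV_cmult[OF this, of x]]
    have "((\<lambda>t. U (q, t) x) has_real_derivative deriv v t + x * integral {0..1} (\<lambda>s. w' t (x * s))) (at t)"
      by (simp only: Useg[OF x, symmetric])
    moreover have "deriv v t + x * integral {0..1} (\<lambda>s. w' t (x * s))
        = deriv v t + e q * f (v t) + c x - e q * f (U (q, t) x)"
      unfolding Yseg[OF x] by simp
    ultimately show ?thesis by (simp only:)
  qed
  have "integral {0..1} (\<lambda>t. U (q, t) x) = integral {0..1} v + x" if x: "x \<in> ?J" for x
  proof -
    have mD: "((\<lambda>x. integral {0..1} (\<lambda>t. U (q, t) x) - x) has_real_derivative 0) (at y within ?J)" if y: "y \<in> ?J" for y
    proof -
      have "((\<lambda>x. integral {0..1} (\<lambda>t. U (q, t) x)) has_real_derivative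
          integral {0..1} (\<lambda>t. ?w (q, t) y)) (at y)"
      proof (rule parametric_integral_has_derivative[OF J(1,2) y])
        show "((\<lambda>x. U (q, t) x) has_real_derivative ?w (q, t) x) (at x)" if "x \<in> ?J" for x t
          using UD[OF that] .
        show "continuous_on {0..1} (\<lambda>t. U (q, t) x)" if "x \<in> ?J" for x
          by (rule Ck_continuous_on_slice[OF U[of 0] q that])
        show "continuous_on (?J \<times> {0..1}) (\<lambda>(x, t). ?w (q, t) x)"
          unfolding split_beta
          by (rule continuous_on_joint_compose[OF Ck_imp_continuous_on[OF wC[of 0]]])
            (use q in \<open>auto intro!: continuous_intros\<close>)
      qed
      moreover have "integral {0..1} (\<lambda>t. ?w (q, t) y) = 1"
        using integral_flow_speed[OF hcont[OF y] hper[OF y]] by (simp add: w_eq)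
      ultimately have "((\<lambda>x. integral {0..1} (\<lambda>t. U (q, t) x)) has_real_derivative 1) (at y)" by simp
      from DERIV_diff[OF this DERIV_ident] show ?thesis
        by (simp add: has_field_derivative_at_within)
    qed
    have "\<exists>m. \<forall>y\<in>?J. integral {0..1} (\<lambda>t. U (q, t) y) - y = m"
      by (rule has_field_derivative_zero_constant[OF J(2)]) (rule mD)
    then have "integral {0..1} (\<lambda>t. U (q, t) x) - x = integral {0..1} (\<lambda>t. U (q, t) 0) - 0"
      using x J(3) by metis
    then show ?thesis using v(2) by (simp add: eta_contract_eq)
  qed
  then show ?thesis using cD c0 van' UT
    by (intro exI[of _ c] exI[of _ c'] conjI ballI allI)
qed

text \<open>For \<open>u x t = U (N * t) x\<close> the chain rule multiplies the equation with
  coefficient \<open>1 / N\<close> by \<open>N\<close>, which restores \<open>f\<close> and turns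
  \<open>c\<close> into \<open>N * c\<close>. Because \<open>N\<close> is an integer, the period 1
  and the averages are preserved.\<close>

lemma vanishing_flow_in_S:
  assumes f: "smooth f" and N: "0 < N" and \<delta>: "0 < \<delta>" and v: "v \<in> C1"
    and c: "\<And>x. x \<in> {-\<delta><..<\<delta>} \<Longrightarrow> (c has_real_derivative c' x) (at x)" "c 0 = 0"
      "vanishes k {-\<delta><..<\<delta>} 0 c'"
    and U: "\<And>t x. x \<in> {-\<delta><..<\<delta>} \<Longrightarrow> ((\<lambda>t. U t x) has_real_derivative
      deriv v t + 1 / real N * f (v t) + c x - 1 / real N * f (U t x)) (at t)"
      "\<And>t x. x \<in> {-\<delta><..<\<delta>} \<Longrightarrow> U (t + 1) x = U t x" "\<And>t. U t 0 = v t"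
      "\<And>x. x \<in> {-\<delta><..<\<delta>} \<Longrightarrow> integral {0..1} (\<lambda>t. U t x) = integral {0..1} v + x"
  shows "(\<lambda>t. v (real N * t)) \<in> S B k f"
proof -
  let ?J = "{-\<delta><..<\<delta>}"
  have J: "open ?J" "0 \<in> ?J" using \<delta> by auto
  define u where "u x t = U (real N * t) x" for x t
  have Uc: "continuous_on A (\<lambda>t. U t x)" if "x \<in> ?J" for A x
    by (rule DERIV_continuous_on) (rule has_field_derivative_at_within[OF U(1)[OF that]])
  have uD: "(u x has_real_derivative
      real N * deriv v (real N * t) + f (v (real N * t)) + real N * c x - f (u x t)) (at t)" if x: "x \<in> ?J" for t x
  proof -
    have "((\<lambda>t. real N * t) has_real_derivative real N) (at t)"
      by (auto intro!: derivative_eq_intros)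
    from DERIV_chain2[OF U(1)[OF x] this]
    have "(u x has_real_derivative (deriv v (real N * t) + 1 / real N * f (v (real N * t)) + c x
        - 1 / real N * f (u x t)) * real N) (at t)"
      by (simp only: u_def[abs_def])
    moreover have "(deriv v (real N * t) + 1 / real N * f (v (real N * t)) + c x - 1 / real N * f (u x t)) * real N
        = real N * deriv v (real N * t) + f (v (real N * t)) + real N * c x - f (u x t)"
      using N by (simp add: field_simps)
    ultimately show ?thesis by (simp only:)
  qed
  have lin: "continuous_on UNIV (\<lambda>t. real N * t)" by (intro continuous_intros)
  have u: "u x \<in> C1 \<and> (\<forall>t. deriv (u x) t = real N * deriv v (real N * t) + f (v (real N * t)) + real N * c x - f (u x t))"
    if x: "x \<in> ?J" for x
  proof -
    have "periodic (u x)"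
      unfolding periodic_def u_def
      using periodic_add_nat[of "\<lambda>t. U t x", OF U(2)[OF x]] by (simp add: distrib_left)
    moreover have "continuous_on UNIV (\<lambda>t. real N * deriv v (real N * t) + f (v (real N * t)) + real N * c x - f (u x t))"
    proof -
      have "continuous_on UNIV (\<lambda>t. deriv v (real N * t))"
        by (rule continuous_on_compose2[OF C1_deriv_continuous_on[OF v, of UNIV] lin]) simp
      moreover have "continuous_on UNIV (\<lambda>t. v (real N * t))"
        by (rule continuous_on_compose2[OF C1_continuous_on[OF v, of UNIV] lin]) simp
      moreover have "continuous_on UNIV (u x)"
        unfolding u_def[abs_def] by (rule continuous_on_compose2[OF Uc[OF x, of UNIV] lin]) simp
      ultimately show ?thesis
        using smooth_compose_continuous_on[OF f, where n = 0] by (intro continuous_intros) simp_all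
    qed
    ultimately show ?thesis using C1I[OF _ uD[OF x]] by auto
  qed
  have avg: "circle_int (u x) = integral {0..1} v + x" if x: "x \<in> ?J" for x
  proof -
    have "circle_int (u x) = integral {0..1} (u x)"
      using u[OF x] by (intro continuous_circle_integrable(2) C1_continuous_on) blast
    also have "\<dots> = integral {0..1} (\<lambda>t. U t x)"
      unfolding u_def[abs_def] by (rule integral_scaled_period[OF Uc[OF x] U(2)[OF x] N])
    finally show ?thesis using U(4)[OF x] by simp
  qed
  let ?P = "phi B f (tilde (Psi B f (u 0)))" and ?a = "circle_int (Psi B f (u 0))"
  let ?C = "circle_int (\<lambda>t. deriv (u 0) t + f (u 0 t))"
  have P: "?P (?a + x) = ?C + real N * c x" if x: "x \<in> ?J" for x
  proof (rule phi_along_curve[OF f J(2) _ _ _ x])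
    show "u x \<in> C1" if "x \<in> ?J" for x using u[OF that] by blast
    show "deriv (u x) t + f (u x t) = deriv (u 0) t + f (u 0 t) + real N * c x" if "x \<in> ?J" for x t
      using u[OF that] u[OF J(2)] c(2) by simp
    show "circle_int (u x) = circle_int (u 0) + x" if "x \<in> ?J" for x
      using avg[OF that] avg[OF J(2)] by simp
  qed
  have "(deriv ^^ j) ?P ?a = 0" if j: "j \<in> {1..k}" for j
  proof -
    \<comment> \<open>One derivative is spent on passing from \<open>c\<close> to \<open>c'\<close>:
      the orders 1 to \<open>k\<close> for \<open>phi\<close> are the orders 0 to
      \<open>k - 1\<close> for \<open>c'\<close>, up to the factor \<open>N\<close>.\<close>
    obtain n where n: "j = Suc n" "n < k" using j by (cases j) auto
    have "(deriv ^^ j) ?P ?a = (deriv ^^ j) (\<lambda>x. ?P (x + ?a)) 0"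
      by (simp add: deriv_funpow_shift)
    also have "\<dots> = (deriv ^^ j) (\<lambda>x. ?C + real N * c x) 0"
      by (rule deriv_funpow_cong_open[OF J(1) _ J(2)]) (use P in \<open>simp add: add.commute\<close>)
    also have "\<dots> = (deriv ^^ n) (deriv (\<lambda>x. ?C + real N * c x)) 0"
      unfolding n(1) by (simp only: funpow_Suc_right o_apply)
    also have "\<dots> = (deriv ^^ n) (\<lambda>x. c' x * real N) 0"
    proof (rule deriv_funpow_cong_open[OF J(1) _ J(2)])
      show "deriv (\<lambda>x. ?C + real N * c x) x = c' x * real N" if "x \<in> ?J" for x
        using DERIV_imp_deriv[OF DERIV_add[OF DERIV_const DERIV_cmult[OF c(1)[OF that]]], of ?C "real N"]
        by (simp add: mult.commute)
    qed
    also have "\<dots> = 0"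
    proof (rule vanishes_imp_deriv[OF J _ n(2)])
      have "Ck k ?J {0 :: real} (\<lambda>z x. real N)" by (rule Ck_const) simp
      from vanishes_mult[OF c(3) singletonI this] show "vanishes k ?J 0 (\<lambda>x. c' x * real N)" .
    qed
    finally show ?thesis .
  qed
  moreover have "u 0 \<in> B1 B" using C1_subset_B1 u[OF J(2)] by blast
  ultimately have "u 0 \<in> S B k f" by (simp add: S_def)
  moreover have "u 0 = (\<lambda>t. v (real N * t))" by (simp add: u_def U(3) fun_eq_iff)
  ultimately show ?thesis by simp
qed

lemma interior_hull_imp_S_nonempty:
  fixes f :: "real \<Rightarrow> real"
  assumes f: "smooth f"
    and int: "(0 :: real ^ 'k::{finite, linorder}) \<in> interior (convex hull (range (gamma_hat f)))"
  shows "S B CARD('k) f \<noteq> {}"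
proof -
  let ?g = "gamma_hat f :: real \<Rightarrow> real ^ 'k::{finite, linorder}"
  have gc: "continuous_on A ?g" for A
    by (rule gamma_hat_continuous_on[OF f continuous_on_id])
  obtain r v where r: "0 < r" and vc: "continuous_on (cball 0 r \<times> UNIV) v"
    and v: "\<forall>p\<in>cball 0 r. (\<lambda>t. v (p, t)) \<in> C1 \<and> integral {0..1} (\<lambda>t. ?g (v (p, t))) = p"
    using realizing_family[OF gc int] by blast
  \<comment> \<open>Including \<epsilon> = 0 places the explicitly solvable case in the same compact
    family as the positive \<epsilon> that are to be compared with it.\<close>
  define Q where "Q = {0..1::real} \<times> cball (0 :: real ^ 'k::{finite, linorder}) r"
  define vv where "vv z = v (snd (fst z), snd z)" for z :: "(real \<times> (real ^ 'k::{finite, linorder})) \<times> real"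
  have Q: "compact Q" unfolding Q_def by (intro compact_Times compact_cball compact_Icc)
  have sf': "smooth (deriv f)" by (rule smooth_deriv[OF f])
  have ec: "continuous_on Q fst" by (intro continuous_intros)
  have vvc: "continuous_on (Q \<times> UNIV) vv"
    unfolding vv_def[abs_def]
    by (rule continuous_on_compose2[OF vc]) (auto simp: Q_def intro!: continuous_intros)
  have vvp: "vv (q, t + 1) = vv (q, t)" if "q \<in> Q" for q t
  proof -
    have "snd q \<in> cball 0 r" using that by (auto simp: Q_def)
    then have "(\<lambda>t. v (snd q, t)) \<in> C1" using v by blast
    from C1_periodic[OF this] show ?thesis by (simp add: vv_def)
  qed
  obtain \<delta> U where \<delta>: "0 < \<delta>" and U: "\<forall>m. Ck m {-\<delta><..<\<delta>} (Q \<times> UNIV) U"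
    and per: "periodic_on Q {-\<delta><..<\<delta>} U" and U0: "\<forall>z\<in>Q \<times> UNIV. U z 0 = vv z"
    and UD: "\<forall>z\<in>Q \<times> UNIV. \<forall>x\<in>{-\<delta><..<\<delta>}. (U z has_real_derivative speed fst (deriv f) U z x) (at x)"
    using parametric_flow[OF Q sf' ec vvc vvp] by blast
  let ?J = "{-\<delta><..<\<delta>}"
  have J: "open ?J" "convex ?J" "0 \<in> ?J" using \<delta> by auto
  define I where "I q x = integral {0..1} (\<lambda>t. deriv f (U (q, t) x))" for q x
  have IC: "Ck m ?J Q I" for m
  proof -
    have "Ck m ?J (Q \<times> {0..1}) (\<lambda>z x. deriv f (U z x))"
      by (rule Ck_subst[OF continuous_on_id _ Ck_compose[OF sf' U[rule_format]]]) auto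
    from Ck_integral[OF J(1,2) this] show ?thesis by (simp add: I_def[abs_def])
  qed
  \<comment> \<open>The jet of \<open>I q\<close> at 0, of orders 0 to \<open>k - 1\<close>. Ranks
    start at 1 and \<open>I\<close> already contains one derivative of \<open>f\<close>, hence the
    \<open>- 1\<close>.\<close>
  define E :: "real \<times> (real ^ 'k::{finite, linorder}) \<Rightarrow> real ^ 'k::{finite, linorder}"
    where "E q = (\<chi> i. (deriv ^^ (card {..i} - 1)) (I q) 0)" for q
  have Ec: "continuous_on Q E"
    unfolding E_def[abs_def]
  proof (rule continuous_on_vec_lambda)
    fix i :: 'k
    have "Ck 0 ?J Q (\<lambda>q. (deriv ^^ (card {..i} - 1)) (I q))"
      by (rule Ck_deriv_funpow[OF J(1) IC])
    then have "continuous_on (Q \<times> ?J) (\<lambda>(q, x). (deriv ^^ (card {..i} - 1)) (I q) x)" by simp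
    then show "continuous_on Q (\<lambda>q. (deriv ^^ (card {..i} - 1)) (I q) 0)"
      by (rule continuous_on_joint_compose) (use J(3) in \<open>auto intro!: continuous_intros\<close>)
  qed
  have E0: "E (0, p) = p" if p: "p \<in> cball 0 r" for p
  proof -
    have q: "(0, p) \<in> Q" using p by (simp add: Q_def)
    have vpc: "continuous_on {0..1} (\<lambda>t. v (p, t))" by (rule C1_continuous_on) (use v p in blast)
    have Ueq: "U ((0, p), t) x = v (p, t) + x" if x: "x \<in> ?J" for t x
    proof -
      have z: "((0, p), t) \<in> Q \<times> UNIV" using q by simp
      \<comment> \<open>At \<epsilon> = 0 the linear equation reduces to \<open>w' = d\<close>,
        whose periodic solution with average 1 is constant.\<close>
      have sp: "speed fst (deriv f) U ((0, p), t) y = 1" for y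
        by (simp add: speed_def flow_speed_zero)
      have "((\<lambda>x. U ((0, p), t) x - x) has_real_derivative 0) (at y within ?J)" if y: "y \<in> ?J" for y
        using DERIV_diff[OF bspec[OF bspec[OF UD z] y, unfolded sp] DERIV_ident]
        by (simp add: has_field_derivative_at_within)
      from has_field_derivative_zero_constant[OF J(2) this]
      have "U ((0, p), t) x - x = U ((0, p), t) 0 - 0" using x J(3) by metis
      then show ?thesis using bspec[OF U0 z] by (simp add: vv_def)
    qed
    have "E (0, p) $ i = p $ i" for i
    proof -
      define n where "n = card {..i} - 1"
      have n: "card {..i} = Suc n" using card_gt_0_iff[of "{..i}"] by (auto simp: n_def)
      have "(deriv ^^ n) (I (0, p)) 0 = (deriv ^^ n) (\<lambda>x. integral {0..1} (\<lambda>t. deriv f (v (p, t) + x))) 0"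
        by (rule deriv_funpow_cong_open[OF J(1) _ J(3)]) (simp only: I_def Ueq)
      also have "\<dots> = integral {0..1} (\<lambda>t. (deriv ^^ n) (deriv f) (v (p, t)))"
        unfolding deriv_funpow_integral_shift[OF sf' vpc] by simp
      also have "\<dots> = integral {0..1} (\<lambda>t. ?g (v (p, t)) $ i)"
        by (simp add: gamma_hat_def n funpow_Suc_right del: funpow.simps)
      also have "\<dots> = integral {0..1} (\<lambda>t. ?g (v (p, t))) $ i"
        by (rule integral_component_eq_cart)
          (intro integrable_continuous_real gamma_hat_continuous_on[OF f vpc])
      also have "\<dots> = p $ i" using v p by simp
      finally show ?thesis by (simp add: E_def n)
    qed
    then show ?thesis by (simp add: vec_eq_iff)
  qed
  \<comment> \<open>As \<open>E (0, p) = p\<close>, uniform continuity with tolerance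
    \<open>r\<close> gives \<open>norm (E (\<epsilon>, p) - p) < r\<close> for all \<open>p\<close>
    in the ball at once, as soon as \<epsilon> is below \<open>d\<close>.\<close>
  have "uniformly_continuous_on Q E" by (rule compact_uniformly_continuous[OF Ec Q])
  then obtain d where d: "0 < d" "\<And>q q'. q \<in> Q \<Longrightarrow> q' \<in> Q \<Longrightarrow> dist q' q < d \<Longrightarrow> dist (E q') (E q) < r"
    using r unfolding uniformly_continuous_on_def by metis
  obtain M where M: "inverse (real (Suc M)) < d" using reals_Archimedean[OF d(1)] by blast
  define N where "N = Suc M"
  define \<epsilon> where "\<epsilon> = 1 / real N"
  have \<epsilon>: "0 < \<epsilon>" "\<epsilon> \<le> 1" "\<epsilon> < d" using M by (auto simp: \<epsilon>_def N_def divide_inverse inverse_le_1_iff)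
  have Qe: "(\<epsilon>, p) \<in> Q" "(0, p) \<in> Q" if "p \<in> cball 0 r" for p
    using that \<epsilon> by (auto simp: Q_def)
  have near: "norm (E (\<epsilon>, p) - p) \<le> r" if p: "p \<in> cball 0 r" for p
    using d(2)[OF Qe(2)[OF p] Qe(1)[OF p]] \<epsilon> E0[OF p] by (simp add: dist_Pair_Pair dist_norm)
  \<comment> \<open>Fixed points of \<open>p \<mapsto> p - E (\<epsilon>, p)\<close> are the zeros
    of \<open>E (\<epsilon>, _)\<close>. The map preserves the ball because its value is the
    deviation of \<open>E (\<epsilon>, p)\<close> from \<open>p\<close>, of norm at most
    \<open>r\<close>.\<close>
  obtain p where p: "p \<in> cball 0 r" "p - E (\<epsilon>, p) = p"
  proof (rule brouwer_ball[OF r, of 0 "\<lambda>p. p - E (\<epsilon>, p)"])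
    show "continuous_on (cball 0 r) (\<lambda>p. p - E (\<epsilon>, p))"
      by (intro continuous_intros continuous_on_compose2[OF Ec]) (use Qe in auto)
    show "(\<lambda>p. p - E (\<epsilon>, p)) \<in> cball 0 r \<rightarrow> cball 0 r"
      using near by (auto simp: norm_minus_commute)
  qed
  have "E (\<epsilon>, p) = 0" using p(2) by simp
  let ?q = "(\<epsilon>, p)"
  have van: "(deriv ^^ n) (\<lambda>x. integral {0..1} (\<lambda>t. deriv f (U (?q, t) x))) 0 = 0" if n: "n < CARD('k)" for n
  proof -
    obtain i :: 'k where i: "card {..i} = Suc n" using rank_surj[OF n] by blast
    have "E ?q $ i = 0" using \<open>E ?q = 0\<close> by simp
    then show ?thesis by (simp add: E_def i I_def[abs_def])
  qed
  have q: "?q \<in> Q" by (rule Qe(1)[OF p(1)])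
  have vC: "(\<lambda>t. v (p, t)) \<in> C1" using v p(1) by blast
  have Uv: "U (?q, t) 0 = v (p, t)" for t using U0 q by (simp add: vv_def)
  have UDq: "(U (?q, t) has_real_derivative speed fst (deriv f) U (?q, t) x) (at x)" if "x \<in> ?J" for t x
    using UD q that by blast
  obtain c c' where c: "\<forall>x\<in>?J. (c has_real_derivative c' x) (at x)" "c 0 = 0" "vanishes CARD('k) ?J 0 c'"
    and UT: "\<forall>x\<in>?J. \<forall>t. ((\<lambda>t. U (?q, t) x) has_real_derivative
      deriv (\<lambda>t. v (p, t)) t + fst ?q * f (v (p, t)) + c x - fst ?q * f (U (?q, t) x)) (at t)"
    and avg: "\<forall>x\<in>?J. integral {0..1} (\<lambda>t. U (?q, t) x) = integral {0..1} (\<lambda>t. v (p, t)) + x"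
    using flow_solves_equation[OF f ec q \<delta> U[rule_format] per UDq vC Uv van] by blast
  have "(\<lambda>t. v (p, real N * t)) \<in> S B CARD('k) f"
  proof (rule vanishing_flow_in_S[OF f _ \<delta> vC, of N c c' "CARD('k)" "\<lambda>t. U (?q, t)"])
    show "((\<lambda>t. U (?q, t) x) has_real_derivative
      deriv (\<lambda>t. v (p, t)) t + 1 / real N * f (v (p, t)) + c x - 1 / real N * f (U (?q, t) x)) (at t)"
      if "x \<in> ?J" for t x
      using UT that by (simp add: \<epsilon>_def)
    show "U (?q, t + 1) x = U (?q, t) x" if "x \<in> ?J" for t x
      using per q that by (simp add: periodic_on_def)
  qed (use c avg Uv in \<open>simp_all add: N_def\<close>)
  then show ?thesis by blast
qed

theorem lemma3p5:
  fixes f :: "real \<Rightarrow> real" and B :: space_pair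
  assumes "smooth f" and "good TYPE('k::{finite, linorder}) f"
  shows "(S_hat TYPE('k) B f \<noteq> {} \<longleftrightarrow>
            (0 :: real ^ 'k::{finite, linorder}) \<in> interior (convex hull (range (gamma_hat f)))) \<and>
         (S_hat TYPE('k) B f \<noteq> {} \<longrightarrow> S B CARD('k) f \<noteq> {})"
proof -
  let ?g = "gamma_hat f :: real \<Rightarrow> real ^ 'k::{finite, linorder}"
  have int_eq: "circle_int (\<lambda>t. ?g (v t)) = integral {0..1} (\<lambda>t. ?g (v t))" if "continuous_on {0..1} v" for v
    by (rule continuous_circle_integrable(2)[OF gamma_hat_continuous_on[OF assms(1) that]])
  have 1: "0 \<in> interior (convex hull (range ?g))" if ne: "S_hat TYPE('k) B f \<noteq> {}"
  proof -
    obtain v where v: "v \<in> B1 B" "circle_int (\<lambda>t. ?g (v t)) = 0"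
      using ne by (auto simp: S_hat_def)
    have vc: "continuous_on {0..1} v" by (rule B1_continuous_on[OF v(1)])
    show ?thesis
      by (rule zero_integral_imp_interior_hull[OF assms vc]) (use v(2) int_eq[OF vc] in simp)
  qed
  have 2: "S_hat TYPE('k) B f \<noteq> {}" if int: "0 \<in> interior (convex hull (range ?g))"
  proof -
    have gc: "continuous_on UNIV ?g" by (rule gamma_hat_continuous_on[OF assms(1) continuous_on_id])
    obtain r v where r: "0 < r"
      and v: "\<forall>p\<in>cball 0 r. (\<lambda>t. v (p, t)) \<in> C1 \<and> integral {0..1} (\<lambda>t. ?g (v (p, t))) = p"
      using realizing_family[OF gc int] by blast
    have v0: "(\<lambda>t. v (0, t)) \<in> C1" "integral {0..1} (\<lambda>t. ?g (v (0, t))) = 0" using v r by auto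
    have "(\<lambda>t. v (0, t)) \<in> S_hat TYPE('k) B f"
      unfolding S_hat_def using C1_subset_B1[OF v0(1)] int_eq[OF C1_continuous_on[OF v0(1)]] v0(2) by simp
    then show ?thesis by blast
  qed
  show ?thesis using 1 2 interior_hull_imp_S_nonempty[OF assms(1), where B = B] by blast
qed

end
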